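(* Let $n \geq 2$ and $2 \leq m \leq n+1$ be integers. Then $$\mathrm{conn}(\mathrm{Hom}(K_2\times K_n, K_m)) = \begin{cases} 0 & \text{if } m = n+1,\\ -1 & \text{if } m = n,\\ m-3 & \text{otherwise.}\end{cases}$$
   Context: A graph $G$ is a pair $(V(G),E(G))$ with $E(G)\subset V(G)\times V(G)$ symmetric (undirected graph; loops are allowed); $x\sim y$ means $(x,y)\in E(G)$. $K_n$ is the complete graph on $[n]=\{1,\dots,n\}$, without loops. Categorical product: $G\times H$ has vertex set $V(G)\times V(H)$, and $(g,h)\sim(g',h')$ iff $g\sim g'$ in $G$ and $h\sim h'$ in $H$. Hom complex: $\mathrm{Hom}(G,H)$ is the polyhedral complex whose cells are indexed by all functions $\eta:V(G)\to 2^{V(H)}\setminus\{\emptyset\}$ such that $(v,w)\in E(G)$ implies $\eta(v)\times\eta(w)\subset E(H)$; the cell $\eta$ is a face of the cell $\eta'$ iff $\eta(v)\subset\eta'(v)$ for all $v\in V(G)$. As a topological space it is the geometric realization of the order complex (simplicial complex of chains) of this face poset. Connectivity: a nonempty space $X$ is $k$-connected ($k\ge 0$) if $\pi_j(X)=0$ for all $0\le j\le k$, where $\pi_0(X)=0$ means that $X$ is (path) connected. $\mathrm{conn}(X)$ is the largest integer $k$ such that $X$ is $k$-connected; a nonempty disconnected space has $\mathrm{conn}(X)=-1$, and $\mathrm{conn}(\emptyset)=-\infty$. *)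

theory Defs
  imports
    "HOL-Analysis.Analysis"
    "HOL-Library.Extended"
    "Graph_Theory.Pair_Digraph"
begin

section \<open>Graphs\<close>

text \<open>
  A graph (undirected, loops allowed) is a \<^typ>\<open>'a pair_pre_digraph\<close> satisfying
  \<^const>\<open>pair_sym_digraph\<close>: a vertex set together with a symmetric set of pairs of vertices.
\<close>

definition complete_graph :: "nat \<Rightarrow> nat pair_pre_digraph" where
  "complete_graph n =
     \<lparr> pverts = {1..n}, parcs = {(x, y). x \<in> {1..n} \<and> y \<in> {1..n} \<and> x \<noteq> y} \<rparr>"

definition cat_product ::
    "'a pair_pre_digraph \<Rightarrow> 'b pair_pre_digraph \<Rightarrow> ('a \<times> 'b) pair_pre_digraph" where
  "cat_product G H =
     \<lparr> pverts = pverts G \<times> pverts H,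
       parcs = {((g, h), (g', h')). (g, g') \<in> parcs G \<and> (h, h') \<in> parcs H} \<rparr>"

lemma pair_graph_complete_graph: "pair_graph (complete_graph n)"
proof unfold_locales
  have "parcs (complete_graph n) \<subseteq> {1..n} \<times> {1..n}"
    by (auto simp: complete_graph_def)
  then show "finite (parcs (complete_graph n))"
    by (rule finite_subset) simp
qed (auto simp: complete_graph_def symmetric_def intro!: symI)

lemma pair_sym_digraph_cat_product:
  assumes "pair_sym_digraph G" "pair_sym_digraph H"
  shows "pair_sym_digraph (cat_product G H)"
proof -
  interpret G: pair_sym_digraph G by fact
  interpret H: pair_sym_digraph H by fact
  have "sym (parcs G)" "sym (parcs H)"
    using G.pair_sym_arcs H.pair_sym_arcs by (simp_all add: symmetric_def)
  then have "sym (parcs (cat_product G H))"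
    by (auto simp: cat_product_def sym_def)
  then show ?thesis
    by unfold_locales
      (auto simp: cat_product_def symmetric_def dest: G.wellformed' H.wellformed')
qed


section \<open>Order complexes and geometric realization\<close>

definition order_complex :: "'a set \<Rightarrow> ('a \<Rightarrow> 'a \<Rightarrow> bool) \<Rightarrow> 'a set set" where
  "order_complex P le =
     {C. C \<subseteq> P \<and> finite C \<and> C \<noteq> {} \<and> Complete_Partial_Order.chain le C}"

text \<open>
  Points of the realization of an abstract simplicial complex (given by its set of nonempty
  finite simplices) are described by barycentric coordinates.  The realization carries the
  weak topology determined by its closed simplices, so that the definition is also the
  usual one for complexes with infinitely many simplices.
\<close>

definition closed_simplex :: "'a set \<Rightarrow> ('a \<Rightarrow> real) set" where
  "closed_simplex \<sigma> = {x. (\<forall>v. 0 \<le> x v) \<and> (\<forall>v. v \<notin> \<sigma> \<longrightarrow> x v = 0) \<and> (\<Sum>v\<in>\<sigma>. x v) = 1}"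

definition geometric_realization :: "'a set set \<Rightarrow> ('a \<Rightarrow> real) topology" where
  "geometric_realization K =
     topology (\<lambda>U. U \<subseteq> (\<Union>\<sigma>\<in>K. closed_simplex \<sigma>) \<and>
       (\<forall>\<sigma>\<in>K. openin (subtopology (powertop_real UNIV) (closed_simplex \<sigma>))
                       (U \<inter> closed_simplex \<sigma>)))"

lemma openin_geometric_realization:
  "openin (geometric_realization K) U \<longleftrightarrow>
     U \<subseteq> (\<Union>\<sigma>\<in>K. closed_simplex \<sigma>) \<and>
     (\<forall>\<sigma>\<in>K. openin (subtopology (powertop_real UNIV) (closed_simplex \<sigma>))
                     (U \<inter> closed_simplex \<sigma>))"
proof -
  let ?T = "\<lambda>\<sigma>::'a set. subtopology (powertop_real UNIV) (closed_simplex \<sigma>)"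
  let ?L = "\<lambda>U. U \<subseteq> (\<Union>\<sigma>\<in>K. closed_simplex \<sigma>) \<and>
                 (\<forall>\<sigma>\<in>K. openin (?T \<sigma>) (U \<inter> closed_simplex \<sigma>))"
  have "istopology ?L"
    unfolding istopology_def
  proof (rule conjI; intro allI impI)
    fix S T assume S: "?L S" and T: "?L T"
    have "openin (?T \<sigma>) (S \<inter> T \<inter> closed_simplex \<sigma>)" if "\<sigma> \<in> K" for \<sigma>
    proof -
      have "S \<inter> T \<inter> closed_simplex \<sigma> =
          (S \<inter> closed_simplex \<sigma>) \<inter> (T \<inter> closed_simplex \<sigma>)"
        by (simp add: Int_ac)
      then show ?thesis
        using S T that by (simp only: openin_Int)
    qed
    then show "?L (S \<inter> T)"
      using S by (simp add: le_infI1)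
  next
    fix \<U> assume U: "\<forall>U\<in>\<U>. ?L U"
    have "openin (?T \<sigma>) (\<Union>\<U> \<inter> closed_simplex \<sigma>)" if "\<sigma> \<in> K" for \<sigma>
    proof -
      have "openin (?T \<sigma>) (\<Union>U\<in>\<U>. U \<inter> closed_simplex \<sigma>)"
        using U that by (intro openin_Union) (simp add: image_iff Bex_def, metis)
      moreover have "\<Union>\<U> \<inter> closed_simplex \<sigma> = (\<Union>U\<in>\<U>. U \<inter> closed_simplex \<sigma>)"
        by (rule Int_Union2)
      ultimately show ?thesis by (simp only:)
    qed
    moreover have "\<Union>\<U> \<subseteq> (\<Union>\<sigma>\<in>K. closed_simplex \<sigma>)"
      using U by (intro Union_least) simp
    ultimately show "?L (\<Union>\<U>)" by blast
  qed
  then show ?thesis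
    by (simp add: geometric_realization_def topology_inverse')
qed


section \<open>The Hom complex\<close>

text \<open>
  Cells are functions on the vertices of the first graph; as elements of a function space
  \<^term>\<open>PiE (pverts G) B\<close> they take the value \<^const>\<open>undefined\<close> off \<^term>\<open>pverts G\<close>.
\<close>

definition Hom_cells ::
    "'a pair_pre_digraph \<Rightarrow> 'b pair_pre_digraph \<Rightarrow> ('a \<Rightarrow> 'b set) set" where
  "Hom_cells G H =
     {\<eta> \<in> pverts G \<rightarrow>\<^sub>E (Pow (pverts H) - {{}}).
        \<forall>(v, w)\<in>parcs G. \<eta> v \<times> \<eta> w \<subseteq> parcs H}"

definition Hom_face ::
    "'a pair_pre_digraph \<Rightarrow> ('a \<Rightarrow> 'b set) \<Rightarrow> ('a \<Rightarrow> 'b set) \<Rightarrow> bool" where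
  "Hom_face G \<eta> \<eta>' \<longleftrightarrow> (\<forall>v\<in>pverts G. \<eta> v \<subseteq> \<eta>' v)"

definition Hom_complex ::
    "'a pair_pre_digraph \<Rightarrow> 'b pair_pre_digraph \<Rightarrow> (('a \<Rightarrow> 'b set) \<Rightarrow> real) topology" where
  "Hom_complex G H = geometric_realization (order_complex (Hom_cells G H) (Hom_face G))"


section \<open>Homotopy groups and connectivity\<close>

definition cube :: "nat \<Rightarrow> (nat \<Rightarrow> real) topology" where
  "cube j = subtopology (Euclidean_space j) {t. \<forall>i<j. 0 \<le> t i \<and> t i \<le> 1}"

definition cube_boundary :: "nat \<Rightarrow> (nat \<Rightarrow> real) set" where
  "cube_boundary j = {t \<in> topspace (cube j). \<exists>i<j. t i = 0 \<or> t i = 1}"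

definition cube_maps :: "nat \<Rightarrow> 'a topology \<Rightarrow> 'a \<Rightarrow> ((nat \<Rightarrow> real) \<Rightarrow> 'a) set" where
  "cube_maps j X x = {f. continuous_map (cube j) X f \<and> (\<forall>t\<in>cube_boundary j. f t = x)}"

definition cube_homotopic ::
    "nat \<Rightarrow> 'a topology \<Rightarrow> 'a \<Rightarrow> (((nat \<Rightarrow> real) \<Rightarrow> 'a) \<times> ((nat \<Rightarrow> real) \<Rightarrow> 'a)) set" where
  "cube_homotopic j X x =
     {(f, g). homotopic_with (\<lambda>h. \<forall>t\<in>cube_boundary j. h t = x) (cube j) X f g}"

lemma equiv_cube_homotopic: "equiv (cube_maps j X x) (cube_homotopic j X x)"
proof (rule equivI)
  show "cube_homotopic j X x \<subseteq> cube_maps j X x \<times> cube_maps j X x"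
  proof (rule subrelI)
    fix f g assume "(f, g) \<in> cube_homotopic j X x"
    then have H: "homotopic_with (\<lambda>h. \<forall>t\<in>cube_boundary j. h t = x) (cube j) X f g"
      by (simp add: cube_homotopic_def)
    show "(f, g) \<in> cube_maps j X x \<times> cube_maps j X x"
      using homotopic_with_imp_continuous_maps[OF H] homotopic_with_imp_property[OF H]
      by (simp add: cube_maps_def)
  qed
  show "refl_on (cube_maps j X x) (cube_homotopic j X x)"
    by (simp add: refl_on_def cube_maps_def cube_homotopic_def)
  show "sym (cube_homotopic j X x)"
    by (rule symI) (simp add: cube_homotopic_def homotopic_with_symD)
  show "trans (cube_homotopic j X x)"
  proof (rule transI)
    fix f g h assume "(f, g) \<in> cube_homotopic j X x" "(g, h) \<in> cube_homotopic j X x"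
    then show "(f, h) \<in> cube_homotopic j X x"
      unfolding cube_homotopic_def mem_Collect_eq prod.case by (rule homotopic_with_trans)
  qed
qed

text \<open>
  The underlying set of the \<open>j\<close>-th homotopy group: classes of maps of the \<open>j\<close>-cube sending
  its boundary to the base point, up to homotopy through such maps.  The neutral element is
  the class of the constant map; the group operation plays no role in stating triviality.
\<close>

definition homotopy_group_set ::
    "nat \<Rightarrow> 'a topology \<Rightarrow> 'a \<Rightarrow> ((nat \<Rightarrow> real) \<Rightarrow> 'a) set set" where
  "homotopy_group_set j X x = cube_maps j X x // cube_homotopic j X x"

definition trivial_pi :: "nat \<Rightarrow> 'a topology \<Rightarrow> bool" where
  "trivial_pi j X \<longleftrightarrow>
     (if j = 0 then path_connected_space X
      else \<forall>x\<in>topspace X. homotopy_group_set j X x = {cube_homotopic j X x `` {\<lambda>t. x}})"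

text \<open>
  The index is an integer so that every nonempty space is \<open>-1\<close>-connected, there being no
  condition on homotopy groups in that case.
\<close>

definition k_connected :: "int \<Rightarrow> 'a topology \<Rightarrow> bool" where
  "k_connected k X \<longleftrightarrow> topspace X \<noteq> {} \<and> (\<forall>j::nat. int j \<le> k \<longrightarrow> trivial_pi j X)"

definition conn :: "'a topology \<Rightarrow> int extended" where
  "conn X =
     (if topspace X = {} then Minf
      else if \<forall>k. k_connected k X then Pinf
      else Fin (GREATEST k. k_connected k X))"

lemma conn_eq_Fin_iff:
  "conn X = Fin k \<longleftrightarrow> k_connected k X \<and> (\<forall>k'. k_connected k' X \<longrightarrow> k' \<le> k)"
proof -
  have mono: "k_connected a X" if "k_connected b X" "a \<le> b" for a b
    using that by (auto simp: k_connected_def)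
  have Greatest: "(GREATEST k. k_connected k X) = k"
    if "k_connected k X" "\<forall>k'. k_connected k' X \<longrightarrow> k' \<le> k" for k
    using that by (intro Greatest_equality) auto
  have neg: "k_connected (-1) X" if "topspace X \<noteq> {}"
    using that by (simp add: k_connected_def)
  have ex: "\<exists>k. k_connected k X \<and> (\<forall>k'. k_connected k' X \<longrightarrow> k' \<le> k)"
    if ne: "topspace X \<noteq> {}" and nall: "\<not> (\<forall>k. k_connected k X)"
  proof -
    obtain b where b: "\<not> k_connected b X" using nall by blast
    let ?S = "{-1..b} \<inter> {k. k_connected k X}"
    have bd: "k < b" if "k_connected k X" for k
      using mono[OF that, of b] b by linarith
    have S: "finite ?S" "-1 \<in> ?S"
      using neg[OF ne] bd[OF neg[OF ne]] by auto
    then have M: "Max ?S \<in> ?S" by (intro Max_in) auto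
    have "k' \<le> Max ?S" if "k_connected k' X" for k'
    proof (cases "-1 \<le> k'")
      case True
      with that bd[OF that] S(1) show ?thesis by (intro Max_ge) auto
    next
      case False
      with Max_ge[OF S] show ?thesis by linarith
    qed
    with M show ?thesis by blast
  qed
  show ?thesis
  proof
    assume L: "conn X = Fin k"
    then have ne: "topspace X \<noteq> {}" "\<not> (\<forall>k. k_connected k X)"
      by (auto simp: conn_def split: if_splits)
    then obtain k0 where k0: "k_connected k0 X" "\<forall>k'. k_connected k' X \<longrightarrow> k' \<le> k0"
      using ex by blast
    with L ne Greatest[OF k0] show "k_connected k X \<and> (\<forall>k'. k_connected k' X \<longrightarrow> k' \<le> k)"
      by (auto simp: conn_def split: if_splits)
  next
    assume R: "k_connected k X \<and> (\<forall>k'. k_connected k' X \<longrightarrow> k' \<le> k)"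
    then have "topspace X \<noteq> {}" by (simp add: k_connected_def)
    moreover have "\<not> k_connected (k + 1) X" using R by force
    ultimately show "conn X = Fin k"
      using Greatest R by (auto simp: conn_def)
  qed
qed

end

theory Submission
  imports Defs "HOL-Homology.Brouwer_Degree" "HOL-Complex_Analysis.Riemann_Mapping"
begin

text \<open>
  The complex \<open>Hom(G, H)\<close> is homeomorphic to the space of weights on \<open>V(G) \<times> V(H)\<close> whose
  supports are cells, with maximum \<open>1\<close> at every vertex of \<open>G\<close>. For \<open>G = K\<^sub>2 \<times> K\<^sub>n\<close> a
  point consists of weights \<open>a\<^sub>i\<close> and \<open>b\<^sub>i\<close> on the colours such that \<open>a\<^sub>i\<close> and \<open>b\<^sub>j\<close> have disjoint
  supports for \<open>i \<noteq> j\<close>.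

  For \<open>m < n\<close> some colour is used only by the \<open>a\<^sub>i\<close> and some only by the \<open>b\<^sub>i\<close>. Replacing \<open>a\<^sub>i\<close> by the
  positive part of \<open>2 a\<^sub>i - b\<^sub>i\<close> and \<open>b\<^sub>i\<close> by that of \<open>2 b\<^sub>i - a\<^sub>i\<close> makes room for moving all \<open>a\<^sub>i\<close> to the
  positive part of \<open>\<Sum> a\<^sub>i - 2 \<Sum> b\<^sub>i\<close>, and all \<open>b\<^sub>i\<close> to that of \<open>\<Sum> b\<^sub>i - 2 \<Sum> a\<^sub>i\<close>. Hence the space is
  homotopy equivalent to the sphere of dimension \<open>m - 2\<close>, which is \<open>(m - 3)\<close>-connected by general
  position and not \<open>(m - 2)\<close>-connected since its homology is nontrivial.

  For \<open>m = n\<close> the points with \<open>a\<^sub>i = b\<^sub>i\<close> concentrated on a single colour are isolated. For \<open>m = n + 1\<close>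
  these points become passages between cells with an unused colour, and a determinant-like
  map to \<open>\<complex> - {0}\<close> has nonzero winding number on a loop running through one of them.
\<close>

section \<open>Homotopy groups and homotopy equivalences\<close>

text \<open>The obstacle throughout is that \<open>a i\<close> and \<open>b i\<close> may share a
  colour, so a cell need not split the colours into two classes. For \<open>m < n\<close> the
  factors 2 deal with this: if \<open>b j\<close> uses a colour \<open>c\<close> that dominates on
  the first side, disjointness leaves only \<open>a j\<close> to contribute to the sum at
  \<open>c\<close>, hence \<open>a j c > 2 * b j c\<close> and the thinned \<open>b j\<close>
  vanishes at \<open>c\<close>. Homotopies then reduce to checks on supports, since a rescaled
  segment joins two points whose supports together form a cell. A trivial homotopy group of the
  sphere in its own dimension would contract the map collapsing the boundary of the cube; that
  contraction descends to one of the sphere, which homology forbids. For \<open>m = n + 1\<close>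
  the map to the plane takes the value 1 at every passage and -1 wherever no permutation has
  positive weight. The sign of its imaginary part records on which side the leftover colour is used.
  A loop leaving a passage by one side and returning by the other therefore crosses the upper and
  the lower half-plane once each.\<close>

lemma cube_eq_top_of_set:
  "cube j = top_of_set {t. (\<forall>i<j. 0 \<le> t i \<and> t i \<le> 1) \<and> (\<forall>i\<ge>j. t i = 0)}"
  by (simp add: cube_def Euclidean_space_def euclidean_product_topology subtopology_subtopology
      Collect_conj_eq Int_commute)

lemma topspace_cube: "topspace (cube j) = {t. (\<forall>i<j. 0 \<le> t i \<and> t i \<le> 1) \<and> (\<forall>i\<ge>j. t i = 0)}"
  by (simp add: cube_eq_top_of_set)

lemma cube_top_of_set: "cube j = top_of_set (topspace (cube j))"
  by (simp add: cube_eq_top_of_set)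

section \<open>The sup norm on the cube and dilations about its centre\<close>

lemma continuous_on_Max:
  fixes f :: "'i \<Rightarrow> 'a::topological_space \<Rightarrow> real"
  assumes "finite I" "I \<noteq> {}" "\<And>i. i \<in> I \<Longrightarrow> continuous_on S (f i)"
  shows "continuous_on S (\<lambda>x. Max ((\<lambda>i. f i x) ` I))"
  using assms
proof (induction I rule: finite_ne_induct)
  case (insert i I)
  then have "continuous_on S (\<lambda>x. max (f i x) (Max ((\<lambda>i. f i x) ` I)))"
    by (intro continuous_on_max) auto
  with insert.hyps show ?case by simp
qed simp

text \<open>This is the sup norm of \<open>2 * t - 1\<close>: its unit ball is the cube and its unit
  sphere the boundary.\<close>

definition cube_norm :: "nat \<Rightarrow> (nat \<Rightarrow> real) \<Rightarrow> real" where
  "cube_norm j t = Max ((\<lambda>i. \<bar>2 * t i - 1\<bar>) ` {..<j})"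

lemma continuous_on_cube_norm: "0 < j \<Longrightarrow> continuous_on S (cube_norm j)"
  unfolding cube_norm_def
  by (rule continuous_on_Max)
    (auto intro!: continuous_intros intro: continuous_on_product_then_coordinatewise)

lemma cube_norm_ge: "i < j \<Longrightarrow> \<bar>2 * t i - 1\<bar> \<le> cube_norm j t"
  unfolding cube_norm_def by (intro Max_ge) auto

lemma cube_norm_attained: "0 < j \<Longrightarrow> \<exists>i<j. cube_norm j t = \<bar>2 * t i - 1\<bar>"
  unfolding cube_norm_def using Max_in[of "(\<lambda>i. \<bar>2 * t i - 1\<bar>) ` {..<j}"] by fastforce

lemma cube_norm_le_1: "0 < j \<Longrightarrow> t \<in> topspace (cube j) \<Longrightarrow> cube_norm j t \<le> 1"
  using cube_norm_attained[of j t] by (auto simp: topspace_cube)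

lemma cube_norm_eq_1_iff:
  assumes "0 < j" "t \<in> topspace (cube j)"
  shows "cube_norm j t = 1 \<longleftrightarrow> t \<in> cube_boundary j"
proof
  assume "cube_norm j t = 1"
  then show "t \<in> cube_boundary j"
    using cube_norm_attained[OF assms(1), of t] assms(2) by (force simp: cube_boundary_def)
next
  assume "t \<in> cube_boundary j"
  then obtain i where "i < j" "t i = 0 \<or> t i = 1" by (auto simp: cube_boundary_def)
  then have "1 \<le> cube_norm j t" using cube_norm_ge[of i j t] by auto
  with cube_norm_le_1[OF assms] show "cube_norm j t = 1" by linarith
qed

text \<open>The dilation by \<open>1 / r\<close> about the centre of the cube. Entries from
  \<open>j\<close> on are 0, as for all points of \<open>cube j\<close>.\<close>

definition cube_stretch :: "nat \<Rightarrow> real \<Rightarrow> (nat \<Rightarrow> real) \<Rightarrow> (nat \<Rightarrow> real)" where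
  "cube_stretch j r t = (\<lambda>i. if i < j then 1/2 + (t i - 1/2) / r else 0)"

lemma cube_stretch_in_cube:
  assumes "0 < j" "0 < r" "cube_norm j t \<le> r"
  shows "cube_stretch j r t \<in> topspace (cube j)"
proof -
  have bd: "\<bar>(t i - 1/2) / r\<bar> \<le> 1/2" if "i < j" for i
  proof -
    have "\<bar>2 * t i - 1\<bar> \<le> r" using cube_norm_ge[OF that, of t] assms by linarith
    then have "\<bar>t i - 1/2\<bar> \<le> r/2" by linarith
    then show ?thesis using assms(2) by (simp add: abs_divide field_simps)
  qed
  have "0 \<le> 1/2 + (t i - 1/2) / r \<and> 1/2 + (t i - 1/2) / r \<le> 1" if "i < j" for i
    using bd[OF that] unfolding abs_le_iff by linarith
  then show ?thesis by (auto simp: topspace_cube cube_stretch_def)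
qed

lemma cube_norm_stretch:
  assumes "0 < j" "0 < r"
  shows "cube_norm j (cube_stretch j r t) = cube_norm j t / r"
proof -
  have e: "(\<lambda>i. \<bar>2 * cube_stretch j r t i - 1\<bar>) ` {..<j} = (\<lambda>x. x / r) ` (\<lambda>i. \<bar>2 * t i - 1\<bar>) ` {..<j}"
  proof -
    have "\<bar>2 * cube_stretch j r t i - 1\<bar> = \<bar>2 * t i - 1\<bar> / r" if "i < j" for i
    proof -
      have "2 * cube_stretch j r t i - 1 = (2 * t i - 1) / r"
        using that assms(2) by (simp add: cube_stretch_def field_simps)
      then show ?thesis using assms(2) by (simp add: abs_divide)
    qed
    then show ?thesis by (auto simp: image_image)
  qed
  have "mono (\<lambda>x. x / r)" using assms by (intro monoI) (simp add: divide_right_mono)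
  then show ?thesis
    unfolding cube_norm_def e using assms by (subst mono_Max_commute[symmetric]) auto
qed

lemma cube_stretch_1: "t \<in> topspace (cube j) \<Longrightarrow> cube_stretch j 1 t = t"
  by (rule ext) (auto simp: cube_stretch_def topspace_cube)

lemma prod_interval_cube:
  "prod_topology (top_of_set {0..1::real}) (cube j) = top_of_set ({0..1} \<times> topspace (cube j))"
  using cube_top_of_set[of j] prod_topology_subtopology_eu[of "{0..1::real}" "topspace (cube j)"] by simp

text \<open>In a homotopy through such maps the base point may travel, so homotopies obtained by
  composition need no correction of base points until the very end.\<close>

definition boundary_constant :: "nat \<Rightarrow> ((nat \<Rightarrow> real) \<Rightarrow> 'a) \<Rightarrow> bool" where
  "boundary_constant j h \<longleftrightarrow> (\<exists>a. \<forall>t\<in>cube_boundary j. h t = a)"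

text \<open>
  The path traced by the base point is undone in a collar of the boundary of the cube.
\<close>
lemma nullhomotopic_rel_cube_boundary:
  assumes j: "0 < j"
    and hom: "homotopic_with (boundary_constant j) (cube j) X f (\<lambda>_. y)"
    and fx: "\<And>t. t \<in> cube_boundary j \<Longrightarrow> f t = x"
  shows "homotopic_with (\<lambda>h. \<forall>t\<in>cube_boundary j. h t = x) (cube j) X f (\<lambda>_. x)"
proof -
  let ?C = "topspace (cube j)" and ?n = "cube_norm j"
  obtain K where K: "continuous_map (top_of_set ({0..1::real} \<times> ?C)) X K"
    and K0: "\<forall>t. K (0, t) = f t" and K1: "\<forall>t. K (1, t) = y"
    and Kb: "\<forall>s\<in>{0..1}. boundary_constant j (\<lambda>t. K (s, t))"
    using hom unfolding homotopic_with_def prod_interval_cube by blast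
  define o' where "o' = (\<lambda>i::nat. 0::real)"
  have ob: "o' \<in> cube_boundary j" using j by (auto simp: o'_def cube_boundary_def topspace_cube)
  then have oC: "o' \<in> ?C" by (auto simp: cube_boundary_def)
  define p where "p s = K (s, o')" for s
  have Kp: "K (s, t) = p s" if "s \<in> {0..1}" "t \<in> cube_boundary j" for s t
    using Kb[rule_format, OF that(1)] that(2) ob by (auto simp: boundary_constant_def p_def)
  have p0: "p 0 = x" using K0 ob fx by (simp add: p_def)
  \<comment> \<open>At time \<open>s\<close> the inner cube of radius \<open>1 - s/2\<close> is
    stretched to full size and runs \<open>K\<close> at time \<open>s\<close>. A point of the
    surrounding collar is pushed radially to the boundary and runs \<open>K\<close> at the earlier
    time \<open>2 * (1 - n)\<close>, where \<open>n\<close> is its norm; this time is 0 on the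
    boundary itself.\<close>
  define G where "G = (\<lambda>(s, t). (min s (2 * (1 - ?n t)), cube_stretch j (max (1 - s/2) (?n t)) t))"
  have cn: "continuous_on A (\<lambda>z. ?n (snd z))" for A :: "(real \<times> (nat \<Rightarrow> real)) set"
    using continuous_on_compose2[OF continuous_on_cube_norm[OF j, of UNIV] continuous_on_snd[OF continuous_on_id]]
    by auto
  have pos: "0 < max (1 - s/2) (?n t)" if "s \<le> 1" for s t using that by auto
  have G: "continuous_on ({0..1} \<times> ?C) G"
    unfolding G_def case_prod_beta
  proof (intro continuous_on_Pair)
    show "continuous_on ({0..1} \<times> ?C) (\<lambda>z. min (fst z) (2 * (1 - ?n (snd z))))"
      by (intro continuous_intros cn)
    have "continuous_on ({0..1} \<times> ?C) (\<lambda>z. cube_stretch j (max (1 - fst z/2) (?n (snd z))) (snd z) i)" for i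
      unfolding cube_stretch_def
      using pos by (cases "i < j")
        (force intro!: continuous_intros cn continuous_on_product_then_coordinatewise[OF continuous_on_snd[OF continuous_on_id]])+
    then show "continuous_on ({0..1} \<times> ?C) (\<lambda>z. cube_stretch j (max (1 - fst z/2) (?n (snd z))) (snd z))"
      by (rule continuous_on_coordinatewise_then_product)
  qed
  have GC: "G z \<in> {0..1} \<times> ?C" if "z \<in> {0..1} \<times> ?C" for z
    using that cube_norm_le_1[OF j] pos
    by (auto simp: G_def intro!: cube_stretch_in_cube[OF j])
  have L: "continuous_map (top_of_set ({0..1} \<times> ?C)) X (K \<circ> G)"
    by (rule continuous_map_compose[OF _ K]) (use G GC in auto)
  \<comment> \<open>In the collar the second component of \<open>G\<close> lies on the boundary,
    where \<open>K\<close> sees only the base point path \<open>p\<close>.\<close>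
  have b: "K (G (s, t)) = p (2 * (1 - ?n t))"
    if "s \<in> {0..1}" "t \<in> ?C" "1 - s/2 \<le> ?n t" for s t
  proof -
    have n: "0 < ?n t" using that pos[of s t] by auto
    have m: "max (1 - s/2) (?n t) = ?n t" "min s (2 * (1 - ?n t)) = 2 * (1 - ?n t)" using that(3) by auto
    have "cube_stretch j (?n t) t \<in> cube_boundary j"
      using cube_norm_eq_1_iff[OF j cube_stretch_in_cube[OF j n]] cube_norm_stretch[OF j n, of t] n by auto
    moreover have "2 * (1 - ?n t) \<in> {0..1}" using that cube_norm_le_1[OF j that(2)] by auto
    ultimately show ?thesis using Kp m by (simp add: G_def)
  qed
  have L0: "K (G (0, t)) = f t" if "t \<in> ?C" for t
    using cube_norm_le_1[OF j that] cube_stretch_1[OF that] K0 by (simp add: G_def max_absorb1 min_absorb1)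
  have L1: "K (G (1, t)) = p (min 1 (2 * (1 - ?n t)))" if "t \<in> ?C" for t
  proof (cases "1/2 \<le> ?n t")
    case True
    then show ?thesis using b[of 1 t] that by simp
  next
    case False
    then show ?thesis using K1 by (simp add: G_def p_def min_absorb1)
  qed
  have Lb: "K (G (s, t)) = x" if "s \<in> {0..1}" "t \<in> cube_boundary j" for s t
  proof -
    have "t \<in> ?C" using that by (auto simp: cube_boundary_def)
    then show ?thesis using b[of s t] that p0 cube_norm_eq_1_iff[OF j \<open>t \<in> ?C\<close>] by simp
  qed
  have P: "(\<And>t. t \<in> ?C \<Longrightarrow> h t = k t) \<Longrightarrow>
      (\<forall>t\<in>cube_boundary j. h t = x) \<longleftrightarrow> (\<forall>t\<in>cube_boundary j. k t = x)" for h k :: "_ \<Rightarrow> 'a"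
    by (auto simp: cube_boundary_def)
  have 1: "homotopic_with (\<lambda>h. \<forall>t\<in>cube_boundary j. h t = x) (cube j) X f
            (\<lambda>t. p (min 1 (2 * (1 - ?n t))))"
    by (subst homotopic_with[OF P], simp, unfold prod_interval_cube, rule exI[of _ "K \<circ> G"])
      (use L L0 L1 Lb in auto)
  \<comment> \<open>The map reached so far depends on the norm alone and factors through
    \<open>p\<close>; shrinking the time parameter retracts it along \<open>p\<close> to
    \<open>x\<close>.\<close>
  define M where "M = (\<lambda>(s, t). ((1 - s) * min 1 (2 * (1 - ?n t)), o'))"
  have M: "continuous_on ({0..1} \<times> ?C) M"
    unfolding M_def case_prod_beta by (intro continuous_intros cn)
  have MC: "M z \<in> {0..1} \<times> ?C" if mem: "z \<in> {0..1} \<times> ?C" for z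
  proof -
    obtain s t where z: "z = (s, t)" "0 \<le> s" "s \<le> 1" "t \<in> ?C" using mem by auto
    have "0 \<le> min 1 (2 * (1 - ?n t))" using cube_norm_le_1[OF j z(4)] by simp
    moreover have "(1 - s) * min 1 (2 * (1 - ?n t)) \<le> 1 * 1"
      using z calculation by (intro mult_mono) auto
    ultimately show ?thesis using z oC by (simp add: M_def)
  qed
  have LM: "continuous_map (top_of_set ({0..1} \<times> ?C)) X (K \<circ> M)"
    by (rule continuous_map_compose[OF _ K]) (use M MC in auto)
  have 2: "homotopic_with (\<lambda>h. \<forall>t\<in>cube_boundary j. h t = x) (cube j) X
            (\<lambda>t. p (min 1 (2 * (1 - ?n t)))) (\<lambda>_. x)"
  proof (subst homotopic_with[OF P], simp, unfold prod_interval_cube, rule exI[of _ "K \<circ> M"], intro conjI ballI)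
    fix s t assume "s \<in> {0..1::real}" "t \<in> cube_boundary j"
    then have "?n t = 1" using cube_norm_eq_1_iff[OF j] by (auto simp: cube_boundary_def)
    then show "(K \<circ> M) (s, t) = x" using p0 by (simp add: M_def p_def)
  qed (use LM p0 in \<open>auto simp: M_def p_def\<close>)
  show ?thesis by (rule homotopic_with_trans[OF 1 2])
qed

section \<open>Homotopy groups under homotopy equivalence\<close>

lemma trivial_pi_iff:
  assumes "0 < j"
  shows "trivial_pi j X \<longleftrightarrow>
    (\<forall>x\<in>topspace X. \<forall>f. continuous_map (cube j) X f \<longrightarrow> (\<forall>t\<in>cube_boundary j. f t = x) \<longrightarrow>
       homotopic_with (\<lambda>h. \<forall>t\<in>cube_boundary j. h t = x) (cube j) X f (\<lambda>_. x))" (is "_ \<longleftrightarrow> ?R")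
proof -
  have "homotopy_group_set j X x = {cube_homotopic j X x `` {\<lambda>t. x}} \<longleftrightarrow>
     (\<forall>f\<in>cube_maps j X x. (f, \<lambda>_. x) \<in> cube_homotopic j X x)" if "x \<in> topspace X" for x
  proof -
    have c: "(\<lambda>t. x) \<in> cube_maps j X x" using that by (simp add: cube_maps_def)
    note E = equiv_cube_homotopic[of j X x]
    show ?thesis
    proof
      assume L: "homotopy_group_set j X x = {cube_homotopic j X x `` {\<lambda>t. x}}"
      show "\<forall>f\<in>cube_maps j X x. (f, \<lambda>_. x) \<in> cube_homotopic j X x"
      proof
        fix f assume f: "f \<in> cube_maps j X x"
        have "cube_homotopic j X x `` {f} \<in> homotopy_group_set j X x"
          unfolding homotopy_group_set_def by (rule quotientI[OF f])
        then have "cube_homotopic j X x `` {f} = cube_homotopic j X x `` {\<lambda>t. x}"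
          unfolding L by (rule singletonD)
        then show "(f, \<lambda>_. x) \<in> cube_homotopic j X x"
          using eq_equiv_class_iff[OF E f c] by simp
      qed
    next
      assume R: "\<forall>f\<in>cube_maps j X x. (f, \<lambda>_. x) \<in> cube_homotopic j X x"
      then have "cube_homotopic j X x `` {f} = cube_homotopic j X x `` {\<lambda>t. x}" if "f \<in> cube_maps j X x" for f
        using eq_equiv_class_iff[OF E that c] that by simp
      then show "homotopy_group_set j X x = {cube_homotopic j X x `` {\<lambda>t. x}}"
        using c unfolding homotopy_group_set_def quotient_def by blast
    qed
  qed
  then show ?thesis using assms by (auto simp: trivial_pi_def cube_maps_def cube_homotopic_def)
qed

lemma trivial_piI:
  assumes "0 < j"
    and "\<And>f. continuous_map (cube j) X f \<Longrightarrow> boundary_constant j f \<Longrightarrow>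
           \<exists>y. homotopic_with (boundary_constant j) (cube j) X f (\<lambda>_. y)"
  shows "trivial_pi j X"
  unfolding trivial_pi_iff[OF assms(1)]
proof (intro ballI allI impI)
  fix x f assume f: "continuous_map (cube j) X f" "\<forall>t\<in>cube_boundary j. f t = x"
  then have "boundary_constant j f" unfolding boundary_constant_def by blast
  with assms(2) f obtain y where "homotopic_with (boundary_constant j) (cube j) X f (\<lambda>_. y)" by blast
  then show "homotopic_with (\<lambda>h. \<forall>t\<in>cube_boundary j. h t = x) (cube j) X f (\<lambda>_. x)"
    by (rule nullhomotopic_rel_cube_boundary[OF assms(1)]) (simp add: f(2))
qed

text \<open>A map into \<open>X\<close> is sent to \<open>Y\<close> by \<open>s\<close>, contracted
  there and brought back by \<open>r\<close>. The homotopy from \<open>r \<circ> s\<close> to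
  \<open>id\<close> moves the base point, which \<open>trivial_piI\<close> tolerates. For
  \<open>j = 0\<close> the same homotopy provides paths from \<open>r (s z)\<close> to
  \<open>z\<close>.\<close>

lemma trivial_pi_dominated:
  assumes r: "continuous_map Y X r" and s: "continuous_map X Y s"
    and rs: "homotopic_with (\<lambda>_. True) X X (r \<circ> s) id" and Y: "trivial_pi j Y"
  shows "trivial_pi j X"
proof (cases "j = 0")
  case True
  have "path_component_of X x y" if "x \<in> topspace X" "y \<in> topspace X" for x y
  proof -
    have *: "path_component_of X (r (s z)) z" if "z \<in> topspace X" for z
    proof -
      have "homotopic_with (\<lambda>_. True) X X (\<lambda>_. r (s z)) (\<lambda>_. z)"
        using homotopic_with_compose_continuous_map_right[OF rs, of X "\<lambda>_. z" "\<lambda>_. True"] that by (simp add: o_def)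
      then show ?thesis using homotopic_constant_maps[of X X "r (s z)" z] that by auto
    qed
    have "path_component_of Y (s x) (s y)"
      using Y True that s by (auto simp: trivial_pi_def path_connected_space_iff_path_component continuous_map_def)
    then obtain g where g: "pathin Y g" "g 0 = s x" "g 1 = s y" unfolding path_component_of_def by blast
    then have "path_component_of X (r (s x)) (r (s y))" unfolding path_component_of_def
      using pathin_compose[OF g(1) r] by (intro exI[of _ "r \<circ> g"]) auto
    then show ?thesis using *[OF that(1)] *[OF that(2)] by (meson path_component_of_sym path_component_of_trans)
  qed
  with True show ?thesis by (auto simp: trivial_pi_def path_connected_space_iff_path_component)
next
  case False
  show ?thesis
  proof (rule trivial_piI)
    fix f assume f: "continuous_map (cube j) X f" and "boundary_constant j f"
    then obtain x where x: "\<forall>t\<in>cube_boundary j. f t = x" by (auto simp: boundary_constant_def)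
    have "(\<lambda>i. 0) \<in> cube_boundary j" using False by (auto simp: cube_boundary_def topspace_cube)
    then have "x \<in> topspace X" using x f by (force simp: continuous_map_def cube_boundary_def)
    then have sx: "s x \<in> topspace Y" using s by (auto simp: continuous_map_def)
    have "homotopic_with (\<lambda>h. \<forall>t\<in>cube_boundary j. h t = s x) (cube j) Y (s \<circ> f) (\<lambda>_. s x)"
      using Y[unfolded trivial_pi_iff[OF False[unfolded neq0_conv]]] sx x f s
      by (simp add: continuous_map_compose)
    then have 1: "homotopic_with (boundary_constant j) (cube j) X (r \<circ> (s \<circ> f)) (r \<circ> (\<lambda>_. s x))"
      by (rule homotopic_with_compose_continuous_map_left[OF _ r]) (auto simp: boundary_constant_def)
    have 2: "homotopic_with (boundary_constant j) (cube j) X ((r \<circ> s) \<circ> f) (id \<circ> f)"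
      by (rule homotopic_with_compose_continuous_map_right[OF rs f])
        (use x in \<open>auto simp: boundary_constant_def\<close>)
    show "\<exists>y. homotopic_with (boundary_constant j) (cube j) X f (\<lambda>_. y)"
      using homotopic_with_trans[OF homotopic_with_symD[OF 2], of "\<lambda>_. r (s x)"] 1 by (auto simp: o_def)
  qed (use False in simp)
qed

lemma trivial_pi_homotopy_equivalent:
  assumes "X homotopy_equivalent_space Y"
  shows "trivial_pi j X \<longleftrightarrow> trivial_pi j Y"
  using assms trivial_pi_dominated[of X Y _ _ j] trivial_pi_dominated[of Y X _ _ j]
  unfolding homotopy_equivalent_space_def by blast

lemma k_connected_homotopy_equivalent:
  assumes "X homotopy_equivalent_space Y"
  shows "k_connected k X \<longleftrightarrow> k_connected k Y"
proof -
  have "topspace X = {} \<longleftrightarrow> topspace Y = {}"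
    using assms unfolding homotopy_equivalent_space_def continuous_map_def by fastforce
  then show ?thesis using trivial_pi_homotopy_equivalent[OF assms] by (simp add: k_connected_def)
qed

lemma conn_homotopy_equivalent:
  assumes "X homotopy_equivalent_space Y"
  shows "conn X = conn Y"
proof -
  have "topspace X = {} \<longleftrightarrow> topspace Y = {}"
    using assms unfolding homotopy_equivalent_space_def continuous_map_def by fastforce
  then show ?thesis using k_connected_homotopy_equivalent[OF assms] by (simp add: conn_def)
qed

text \<open>For \<open>k = -1\<close> the second premise is vacuous and \<open>l = 0\<close>, so
  disconnected spaces are covered too.\<close>

lemma conn_eq_FinI:
  assumes "topspace X \<noteq> {}" "\<And>j. int j \<le> k \<Longrightarrow> trivial_pi j X" "\<not> trivial_pi l X" "int l = k + 1"
  shows "conn X = Fin k"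
  unfolding conn_eq_Fin_iff k_connected_def using assms by (metis linorder_not_le zle_add1_eq_le)

section \<open>Maps from cubes into spheres of larger dimension\<close>

definition radial :: "nat \<Rightarrow> (nat \<Rightarrow> real) \<Rightarrow> (nat \<Rightarrow> real)" where
  "radial k x = (\<lambda>i. x i / sqrt (\<Sum>i\<le>k. (x i)\<^sup>2))"

lemma nsphere_top_of_set:
  "nsphere k = top_of_set {x. (\<Sum>i\<le>k. (x i)\<^sup>2) = 1 \<and> (\<forall>i>k. x i = 0)}"
  by (simp add: nsphere euclidean_product_topology)

lemma topspace_nsphere: "topspace (nsphere k) = {x. (\<Sum>i\<le>k. (x i)\<^sup>2) = 1 \<and> (\<forall>i>k. x i = 0)}"
  by (simp add: nsphere_top_of_set)

lemma sum_squares_pos: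
  fixes x :: "nat \<Rightarrow> real"
  assumes "\<exists>i\<le>k. x i \<noteq> 0"
  shows "0 < (\<Sum>i\<le>k. (x i)\<^sup>2)"
proof -
  obtain i where "i \<le> k" "x i \<noteq> 0" using assms by blast
  then show ?thesis by (intro sum_pos2[of _ i]) auto
qed

lemma radial_in_nsphere:
  assumes "\<exists>i\<le>k. x i \<noteq> 0" "\<And>i. i > k \<Longrightarrow> x i = 0"
  shows "radial k x \<in> topspace (nsphere k)"
  using sum_squares_pos[OF assms(1)] assms(2)
  by (auto simp: topspace_nsphere radial_def power_divide simp flip: sum_divide_distrib)

lemma radial_nsphere: "x \<in> topspace (nsphere k) \<Longrightarrow> radial k x = x"
  by (simp add: radial_def topspace_nsphere)

lemma radial_scale: "0 < c \<Longrightarrow> radial k (\<lambda>i. c * x i) = radial k x"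
  by (auto simp: radial_def power_mult_distrib real_sqrt_mult simp flip: sum_distrib_left)

lemma nsphere_nonzero: "x \<in> topspace (nsphere k) \<Longrightarrow> \<exists>i\<le>k. x i \<noteq> 0"
  by (rule ccontr) (auto simp: topspace_nsphere)

lemma continuous_on_radial:
  fixes f :: "'a::topological_space \<Rightarrow> nat \<Rightarrow> real"
  assumes "\<And>i. continuous_on S (\<lambda>x. f x i)" "\<And>x. x \<in> S \<Longrightarrow> \<exists>i\<le>k. f x i \<noteq> 0"
  shows "continuous_on S (\<lambda>x. radial k (f x))"
  unfolding radial_def
  using sum_squares_pos[OF assms(2)]
  by (intro continuous_on_coordinatewise_then_product continuous_intros assms(1)) force+

text \<open>The segments between \<open>f t\<close> and \<open>g t\<close> avoid the origin and are
  projected radially. On the boundary both ends are constant, hence so is every stage.\<close>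

lemma nsphere_straight_homotopy:
  fixes f g :: "(nat \<Rightarrow> real) \<Rightarrow> nat \<Rightarrow> real"
  defines "C j \<equiv> topspace (cube j)"
  assumes f: "\<And>i. continuous_on (C j) (\<lambda>t. f t i)" and g: "\<And>i. continuous_on (C j) (\<lambda>t. g t i)"
    and z: "\<And>t i. t \<in> C j \<Longrightarrow> i > k \<Longrightarrow> f t i = 0 \<and> g t i = 0"
    and bf: "boundary_constant j f" and bg: "boundary_constant j g"
    and nz: "\<And>s t. 0 \<le> s \<Longrightarrow> s \<le> 1 \<Longrightarrow> t \<in> C j \<Longrightarrow> \<exists>i\<le>k. (1 - s) * f t i + s * g t i \<noteq> 0"
  shows "homotopic_with (boundary_constant j) (cube j) (nsphere k) (\<lambda>t. radial k (f t)) (\<lambda>t. radial k (g t))"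
  unfolding homotopic_with_def prod_interval_cube
proof (intro exI conjI allI ballI)
  let ?h = "\<lambda>(s, t). radial k (\<lambda>i. (1 - s) * f t i + s * g t i)"
  have "continuous_on ({0..1} \<times> C j) ?h"
    unfolding case_prod_beta
  proof (rule continuous_on_radial)
    have cs: "continuous_on ({0..1} \<times> C j) (\<lambda>z. h (snd z) i)"
      if "\<And>i. continuous_on (C j) (\<lambda>t. h t i)" for h :: "(nat \<Rightarrow> real) \<Rightarrow> nat \<Rightarrow> real" and i
      by (rule continuous_on_compose2[OF that continuous_on_snd[OF continuous_on_id]]) auto
    show "continuous_on ({0..1} \<times> C j) (\<lambda>x. (1 - fst x) * f (snd x) i + fst x * g (snd x) i)" for i
      by (intro continuous_intros cs f g)
  qed (use nz in auto)
  moreover have "?h z \<in> topspace (nsphere k)" if "z \<in> {0..1} \<times> C j" for z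
    using that nz z by (auto intro!: radial_in_nsphere)
  ultimately show "continuous_map (top_of_set ({0..1} \<times> topspace (cube j))) (nsphere k) ?h"
    unfolding C_def nsphere_top_of_set by (auto simp: topspace_nsphere)
  show "boundary_constant j (\<lambda>x. ?h (s, x))" for s
    using bf bg by (auto simp: boundary_constant_def)
qed auto

section \<open>Lipschitz maps on the cube and missed rays\<close>

definition cube_dist :: "nat \<Rightarrow> (nat \<Rightarrow> real) \<Rightarrow> (nat \<Rightarrow> real) \<Rightarrow> real" where
  "cube_dist j s t = (\<Sum>i<j. \<bar>s i - t i\<bar>)"

lemma cube_dist_nonneg: "0 \<le> cube_dist j s t"
  by (simp add: cube_dist_def sum_nonneg)

lemma compact_topspace_cube: "compact (topspace (cube j))"
proof -
  have "topspace (cube j) = PiE UNIV (\<lambda>i. if i < j then {0..1} else {0})"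
  proof (rule Set.set_eqI)
    fix t :: "nat \<Rightarrow> real"
    have "(\<forall>i. t i \<in> (if i < j then {0..1} else {0})) \<longleftrightarrow>
        (\<forall>i<j. 0 \<le> t i \<and> t i \<le> 1) \<and> (\<forall>i\<ge>j. t i = 0)"
      by (metis atLeastAtMost_iff linorder_not_le singleton_iff)
    then show "t \<in> topspace (cube j) \<longleftrightarrow> t \<in> PiE UNIV (\<lambda>i. if i < j then {0..1} else {0})"
      by (simp add: topspace_cube PiE_iff)
  qed
  then have "compactin (powertop_real UNIV) (topspace (cube j))"
    by (simp add: compactin_PiE)
  then show ?thesis by (simp add: euclidean_product_topology)
qed

text \<open>Stone-Weierstrass for the algebra of Lipschitz functions; the coordinates separate
  points.\<close>

lemma Lipschitz_approximation:
  fixes f :: "(nat \<Rightarrow> real) \<Rightarrow> real"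
  assumes "continuous_on (topspace (cube j)) f" "0 < e"
  shows "\<exists>g L. 0 \<le> L \<and> continuous_on (topspace (cube j)) g \<and>
    (\<forall>t\<in>topspace (cube j). \<bar>f t - g t\<bar> < e) \<and>
    (\<forall>s\<in>topspace (cube j). \<forall>t\<in>topspace (cube j). \<bar>g s - g t\<bar> \<le> L * cube_dist j s t)"
proof -
  let ?C = "topspace (cube j)"
  \<comment> \<open>The bound \<open>B\<close> is carried along because a product of Lipschitz
    functions is Lipschitz only when both factors are bounded.\<close>
  define P where "P g \<longleftrightarrow> continuous_on ?C g \<and>
    (\<exists>L\<ge>0. \<forall>s\<in>?C. \<forall>t\<in>?C. \<bar>g s - g t\<bar> \<le> L * cube_dist j s t) \<and> (\<exists>B\<ge>0. \<forall>t\<in>?C. \<bar>g t\<bar> \<le> B)"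
    for g :: "(nat \<Rightarrow> real) \<Rightarrow> real"
  have "\<exists>g. P g \<and> (\<forall>t\<in>?C. \<bar>f t - g t\<bar> < e)"
  proof (rule Stone_Weierstrass_HOL[OF compact_topspace_cube, where P = P])
    show "P (\<lambda>x. c)" for c
      unfolding P_def by (intro conjI exI[of _ 0] exI[of _ "\<bar>c\<bar>"]) auto
  next
    fix f g assume fg: "P f \<and> P g"
    obtain L A where c1: "continuous_on ?C f" and nn1: "0 \<le> L" "0 \<le> A"
      and L': "\<forall>s\<in>?C. \<forall>t\<in>?C. \<bar>f s - f t\<bar> \<le> L * cube_dist j s t"
      and A': "\<forall>t\<in>?C. \<bar>f t\<bar> \<le> A"
      using fg unfolding P_def by (elim conjE exE) (rule that)
    note L = L'[rule_format] and A = A'[rule_format]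
    obtain M B where c2: "continuous_on ?C g" and nn2: "0 \<le> M" "0 \<le> B"
      and M': "\<forall>s\<in>?C. \<forall>t\<in>?C. \<bar>g s - g t\<bar> \<le> M * cube_dist j s t"
      and B': "\<forall>t\<in>?C. \<bar>g t\<bar> \<le> B"
      using fg unfolding P_def by (elim conjE exE) (rule that)
    note M = M'[rule_format] and B = B'[rule_format]
    note c = c1 c2 and nn = nn1 nn2
    show "P (\<lambda>x. f x + g x)" unfolding P_def
    proof (intro conjI exI ballI)
      show "\<bar>f s + g s - (f t + g t)\<bar> \<le> (L + M) * cube_dist j s t" if "s \<in> ?C" "t \<in> ?C" for s t
        using L[OF that] M[OF that] by (simp add: algebra_simps)
      show "\<bar>f t + g t\<bar> \<le> A + B" if "t \<in> ?C" for t using A[OF that] B[OF that] by linarith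
    qed (use c nn in \<open>auto intro: continuous_intros\<close>)
    show "P (\<lambda>x. f x * g x)" unfolding P_def
    proof (intro conjI exI ballI)
      show "\<bar>f s * g s - f t * g t\<bar> \<le> (A * M + B * L) * cube_dist j s t" if "s \<in> ?C" "t \<in> ?C" for s t
      proof -
        have "f s * g s - f t * g t = f s * (g s - g t) + g t * (f s - f t)" by (simp add: algebra_simps)
        then have "\<bar>f s * g s - f t * g t\<bar> \<le> \<bar>f s\<bar> * \<bar>g s - g t\<bar> + \<bar>g t\<bar> * \<bar>f s - f t\<bar>"
          by (metis abs_mult abs_triangle_ineq)
        also have "\<dots> \<le> A * (M * cube_dist j s t) + B * (L * cube_dist j s t)"
          using A B L M that nn by (intro add_mono mult_mono) auto
        finally show ?thesis by (simp add: algebra_simps)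
      qed
      show "\<bar>f t * g t\<bar> \<le> A * B" if "t \<in> ?C" for t
        using A[OF that] B[OF that] nn by (simp add: abs_mult mult_mono)
    qed (use c nn in \<open>auto intro: continuous_intros\<close>)
  next
    fix x y assume xy: "x \<in> ?C \<and> y \<in> ?C \<and> x \<noteq> y"
    then obtain i where i: "x i \<noteq> y i" by blast
    with xy have "i < j" by (metis (mono_tags, lifting) mem_Collect_eq not_le topspace_cube)
    have "\<bar>s i - t i\<bar> \<le> 1 * cube_dist j s t" for s t :: "nat \<Rightarrow> real"
      unfolding cube_dist_def using \<open>i < j\<close> member_le_sum[of i "{..<j}" "\<lambda>i. \<bar>s i - t i\<bar>"] by simp
    moreover have "\<bar>t i\<bar> \<le> 1" if "t \<in> ?C" for t using that \<open>i < j\<close> by (auto simp: topspace_cube)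
    moreover have "continuous_on ?C (\<lambda>t. t i)"
      by (rule continuous_on_product_then_coordinatewise) simp
    ultimately have "P (\<lambda>t. t i)" unfolding P_def by (metis zero_le_one)
    with i show "\<exists>f. P f \<and> f x \<noteq> f y" by blast
  qed (use assms in \<open>auto simp: P_def\<close>)
  then show ?thesis unfolding P_def by blast
qed

text \<open>
  The points of \<open>{1} \<times> {0, 1/M, \<dots>, (M-1)/M}\<^sup>k\<close> lie on distinct rays. If every one of these rays
  met the image, then the preimages would be \<open>M\<^sup>k\<close> points of the \<open>j\<close>-cube with mutual distances
  at least of order \<open>1/M\<close>, of which there are at most of order \<open>M\<^sup>j\<close>.
\<close>
lemma Lipschitz_image_misses_ray:
  fixes f :: "(nat \<Rightarrow> real) \<Rightarrow> nat \<Rightarrow> real"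
  assumes jk: "j < k" and L: "0 \<le> L" and eta: "0 < \<eta>"
    and lip: "\<And>i s t. i \<le> k \<Longrightarrow> s \<in> topspace (cube j) \<Longrightarrow> t \<in> topspace (cube j) \<Longrightarrow>
                \<bar>f s i - f t i\<bar> \<le> L * cube_dist j s t"
    and big: "\<And>t. t \<in> topspace (cube j) \<Longrightarrow> \<exists>i\<le>k. \<eta> \<le> \<bar>f t i\<bar>"
  shows "\<exists>y. y 0 = 1 \<and> (\<forall>i>k. y i = 0) \<and>
    (\<forall>t\<in>topspace (cube j). \<forall>c>0. \<exists>i\<le>k. f t i \<noteq> c * y i)"
proof (rule ccontr)
  assume neg: "\<not> ?thesis"
  let ?C = "topspace (cube j)"
  \<comment> \<open>If the preimages of two grid points lie in one box of side \<open>1 / B\<close>,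
    the grid points differ by at most \<open>(2 * L * j / \<eta>) / B < K / B = 1 / M\<close> in
    each coordinate, so they coincide.\<close>
  define K where "K = nat \<lceil>2 * L * j / \<eta>\<rceil> + 1"
  have K: "2 * L * j / \<eta> < real K" unfolding K_def by linarith
  \<comment> \<open>Being larger than \<open>(K + 1) ^ j\<close>, \<open>M\<close> makes the
    \<open>M ^ k\<close> rays outnumber the boxes, of which there are at most
    \<open>M ^ j * (K + 1) ^ j\<close>; this is where \<open>j < k\<close> enters.\<close>
  define M where "M = (K + 1) ^ j + 1"
  have M0: "0 < M" by (simp add: M_def)
  define B where "B = M * K"
  have B0: "0 < B" using M0 by (simp add: B_def K_def)
  define G where "G = PiE {1..k} (\<lambda>_. {..<M})"
  define y where "y g i = (if i = 0 then 1 else if i \<le> k then real (g i) / M else 0)" for g :: "nat \<Rightarrow> nat" and i :: nat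
  have "\<exists>t c. t \<in> ?C \<and> 0 < c \<and> (\<forall>i\<le>k. f t i = c * y g i)" for g :: "nat \<Rightarrow> nat"
  proof -
    have "y g 0 = 1" "\<forall>i>k. y g i = 0" by (simp_all add: y_def)
    with neg show ?thesis by blast
  qed
  then obtain T c where T: "\<And>g. T g \<in> ?C" and c: "\<And>g. 0 < c g" and fT: "\<And>g i. i \<le> k \<Longrightarrow> f (T g) i = c g * y g i"
    by metis
  have y1: "\<bar>y g i\<bar> \<le> 1" if "g \<in> G" for g i
  proof (cases "1 \<le> i \<and> i \<le> k")
    case True
    then have "g i < M" using that by (auto simp: G_def PiE_iff)
    then show ?thesis using True M0 by (simp add: y_def field_simps)
  qed (auto simp: y_def)
  \<comment> \<open>Some coordinate of the image is at least \<open>\<eta>\<close> in absolute value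
    while those of \<open>y g\<close> are at most 1, so the scaling factor cannot be small.\<close>
  have c\<eta>: "\<eta> \<le> c g" if "g \<in> G" for g
  proof -
    obtain i where i: "i \<le> k" "\<eta> \<le> \<bar>f (T g) i\<bar>" using big T by blast
    then have "\<eta> \<le> c g * \<bar>y g i\<bar>" using fT c[of g] by (simp add: abs_mult)
    also have "\<dots> \<le> c g * 1" using y1[OF that] c[of g] by (intro mult_left_mono) auto
    finally show ?thesis by simp
  qed
  \<comment> \<open>The index of the box of side \<open>1 / B\<close> containing the chosen
    preimage.\<close>
  define bx where "bx g = restrict (\<lambda>i. nat \<lfloor>T g i * B\<rfloor>) {..<j}" for g
  have "inj_on bx G"
  proof (rule inj_onI)
    fix g h assume g: "g \<in> G" and h: "h \<in> G" and eq: "bx g = bx h"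
    have "\<bar>T g i - T h i\<bar> \<le> 1 / B" if "i < j" for i
    proof -
      have nn: "0 \<le> T g i * B" "0 \<le> T h i * B" using T that by (auto simp: topspace_cube)
      have "nat \<lfloor>T g i * B\<rfloor> = nat \<lfloor>T h i * B\<rfloor>"
        using fun_cong[OF eq, of i] that by (simp add: bx_def)
      then have "\<lfloor>T g i * B\<rfloor> = \<lfloor>T h i * B\<rfloor>" using nn by (simp add: eq_nat_nat_iff)
      then have "\<bar>T g i * B - T h i * B\<bar> \<le> 1" by linarith
      then have "\<bar>T g i - T h i\<bar> * B \<le> 1" by (simp add: left_diff_distrib[symmetric] abs_mult)
      then show ?thesis using B0 by (simp add: field_simps)
    qed
    then have d: "cube_dist j (T g) (T h) \<le> j / B"
      unfolding cube_dist_def using sum_bounded_above[of "{..<j}" "\<lambda>i. \<bar>T g i - T h i\<bar>" "1 / B"] by simp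
    have le: "\<bar>f (T g) i - f (T h) i\<bar> \<le> L * (j / B)" if "i \<le> k" for i
      using order_trans[OF lip[OF that T T] mult_left_mono[OF d L]] .
    show "g = h"
    proof (rule PiE_ext[OF g[unfolded G_def] h[unfolded G_def]])
      fix i assume i: "i \<in> {1..k}"
      have c0: "c g - c h = f (T g) 0 - f (T h) 0" using fT[of 0] by (simp add: y_def)
      have "c g * (y g i - y h i) = (f (T g) i - f (T h) i) - (c g - c h) * y h i"
        using fT[of i g] fT[of i h] i by (simp add: algebra_simps)
      then have "c g * \<bar>y g i - y h i\<bar> = \<bar>(f (T g) i - f (T h) i) - (c g - c h) * y h i\<bar>"
        using c[of g] by (metis abs_mult abs_of_pos)
      also have "\<dots> \<le> \<bar>f (T g) i - f (T h) i\<bar> + \<bar>c g - c h\<bar> * \<bar>y h i\<bar>"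
        by (metis abs_mult abs_triangle_ineq4)
      also have "\<dots> \<le> L * (j / B) + L * (j / B) * 1"
        using le[of i] le[of 0] i y1[OF h, of i] c0 L by (intro add_mono mult_mono) auto
      finally have "c g * \<bar>y g i - y h i\<bar> \<le> 2 * L * j / B" by simp
      moreover have "\<eta> * \<bar>y g i - y h i\<bar> \<le> c g * \<bar>y g i - y h i\<bar>"
        by (intro mult_right_mono c\<eta> g) auto
      ultimately have "\<eta> * \<bar>y g i - y h i\<bar> \<le> 2 * L * j / B" by linarith
      then have "\<bar>y g i - y h i\<bar> \<le> (2 * L * j / \<eta>) / B" using eta B0 by (simp add: field_simps)
      also have "\<dots> < real K / B" using K B0 by (intro divide_strict_right_mono) auto
      also have "\<dots> = 1 / M" using B0 by (simp add: B_def)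
      finally have "\<bar>real (g i) / M - real (h i) / M\<bar> < 1 / M" using i by (simp add: y_def)
      then have "\<bar>real (g i) - real (h i)\<bar> < 1"
        using M0 by (simp add: diff_divide_distrib[symmetric] divide_less_cancel)
      then show "g i = h i" by linarith
    qed
  qed
  moreover have "bx ` G \<subseteq> PiE {..<j} (\<lambda>_. {..B})"
  proof -
    have "nat \<lfloor>T g i * B\<rfloor> \<le> B" if "i < j" for g i
    proof -
      have "T g i * B \<le> 1 * real B" using T[of g] that by (intro mult_right_mono) (auto simp: topspace_cube)
      then show ?thesis by linarith
    qed
    then show ?thesis by (auto simp: bx_def split: if_split_asm)
  qed
  ultimately have "card G \<le> card (PiE {..<j} (\<lambda>_. {..B}))"
    by (intro card_inj_on_le[of bx]) (auto intro: finite_PiE)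
  then have "M ^ k \<le> (B + 1) ^ j" by (simp add: G_def card_PiE)
  also have "\<dots> \<le> (M * (K + 1)) ^ j" using M0 by (intro power_mono) (auto simp: B_def)
  also have "\<dots> = M ^ j * (K + 1) ^ j" by (rule power_mult_distrib)
  also have "\<dots> < M ^ j * M" using M0 by (simp add: M_def)
  also have "\<dots> = M ^ Suc j" by simp
  also have "\<dots> \<le> M ^ k" using jk M0 by (intro power_increasing) auto
  finally show False by simp
qed

text \<open>The shrinkage function: values of modulus at most \<open>e\<close> become 0 and all
  others move by \<open>e\<close> towards 0. It makes an approximation exactly constant where the
  approximated map is constant, at no cost to the Lipschitz constant.\<close>

definition soft_threshold :: "real \<Rightarrow> real \<Rightarrow> real" where
  "soft_threshold e x = x - max (- e) (min e x)"

lemma soft_threshold_nonexpansive: "\<bar>soft_threshold e x - soft_threshold e y\<bar> \<le> \<bar>x - y\<bar>"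
  unfolding soft_threshold_def max_def min_def by (smt (verit))

lemma soft_threshold_close: "0 \<le> e \<Longrightarrow> \<bar>soft_threshold e x - x\<bar> \<le> e"
  unfolding soft_threshold_def max_def min_def by (smt (verit))

lemma soft_threshold_eq_0: "\<bar>x\<bar> \<le> e \<Longrightarrow> soft_threshold e x = 0"
  unfolding soft_threshold_def max_def min_def by (smt (verit))

text \<open>General position: \<open>f\<close> is deformed to a Lipschitz map, whose image misses a
  ray when \<open>j < k\<close>, and then contracted to the point opposite that ray.\<close>

lemma trivial_pi_nsphere_pos:
  assumes j: "0 < j" and jk: "j < k"
  shows "trivial_pi j (nsphere k)"
proof (rule trivial_piI[OF j])
  let ?C = "topspace (cube j)"
  fix f assume f: "continuous_map (cube j) (nsphere k) f" and "boundary_constant j f"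
  then obtain a where a: "\<And>t. t \<in> cube_boundary j \<Longrightarrow> f t = a" by (auto simp: boundary_constant_def)
  have fN: "f t \<in> topspace (nsphere k)" if "t \<in> ?C" for t
    using f that by (auto simp: continuous_map_def)
  have "continuous_map (top_of_set ?C) (nsphere k) f" using f cube_top_of_set[of j] by simp
  then have "continuous_on ?C f" unfolding nsphere_top_of_set by simp
  then have fc: "continuous_on ?C (\<lambda>t. f t i)" for i by (rule continuous_on_product_then_coordinatewise)
  \<comment> \<open>On the unit sphere some coordinate is at least
    \<open>4 * e = 1 / (k + 1)\<close> in modulus, since otherwise the \<open>k + 1\<close> squares
    would sum to less than 1. An error below \<open>2 * e\<close> therefore never reaches the
    origin.\<close>
  define e where "e = 1 / (4 * real (k + 1))"
  have e: "0 < e" by (simp add: e_def)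
  have "\<exists>g L. 0 \<le> L \<and> continuous_on ?C g \<and> (\<forall>t\<in>?C. \<bar>(f t i - a i) - g t\<bar> < e) \<and>
    (\<forall>s\<in>?C. \<forall>t\<in>?C. \<bar>g s - g t\<bar> \<le> L * cube_dist j s t)" for i
    by (intro Lipschitz_approximation continuous_intros fc e)
  then obtain q L where L0: "\<And>i. 0 \<le> L i" and qc: "\<And>i. continuous_on ?C (q i)"
    and qa: "\<And>i t. t \<in> ?C \<Longrightarrow> \<bar>(f t i - a i) - q i t\<bar> < e"
    and ql: "\<And>i s t. s \<in> ?C \<Longrightarrow> t \<in> ?C \<Longrightarrow> \<bar>q i s - q i t\<bar> \<le> L i * cube_dist j s t"
    by metis
  \<comment> \<open>On the boundary \<open>f t i - a i\<close> is 0, so \<open>q i t\<close> is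
    below the threshold and \<open>g\<close> is constant there.\<close>
  define g where "g t i = (if i \<le> k then a i + soft_threshold e (q i t) else 0)" for t i
  have gc: "continuous_on ?C (\<lambda>t. g t i)" for i
    unfolding g_def soft_threshold_def by (cases "i \<le> k") (auto intro!: continuous_intros qc)
  have gf: "\<bar>g t i - f t i\<bar> < 2 * e" if "t \<in> ?C" "i \<le> k" for t i
    using qa[OF that(1), of i] soft_threshold_close[of e "q i t"] e that(2) by (simp add: g_def)
  have "g t = (\<lambda>i. if i \<le> k then a i else 0)" if "t \<in> cube_boundary j" for t
  proof -
    have "t \<in> ?C" using that by (simp add: cube_boundary_def)
    then have "soft_threshold e (q i t) = 0" for i
      using qa[of t i] a[OF that] by (intro soft_threshold_eq_0) auto
    then show ?thesis by (auto simp: g_def)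
  qed
  then have bg: "boundary_constant j g" by (auto simp: boundary_constant_def)
  have large: "\<exists>i\<le>k. 4 * e \<le> \<bar>f t i\<bar>" if "t \<in> ?C" for t
  proof (rule ccontr)
    assume neg: "\<not> ?thesis"
    have "(f t i)\<^sup>2 < 4 * e" if "i \<le> k" for i
    proof -
      have "\<bar>f t i\<bar> < 4 * e" using neg that by auto
      moreover have "4 * e \<le> 1" by (simp add: e_def field_simps)
      ultimately have "\<bar>f t i\<bar> * \<bar>f t i\<bar> \<le> \<bar>f t i\<bar> * 1" by (intro mult_left_mono) auto
      with \<open>\<bar>f t i\<bar> < 4 * e\<close> show ?thesis by (simp add: power2_eq_square)
    qed
    then have "(\<Sum>i\<le>k. (f t i)\<^sup>2) < (\<Sum>i\<le>k. 4 * e)" by (intro sum_strict_mono) auto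
    then show False using fN[OF that] by (simp add: topspace_nsphere e_def)
  qed
  have 1: "homotopic_with (boundary_constant j) (cube j) (nsphere k) (\<lambda>t. radial k (f t)) (\<lambda>t. radial k (g t))"
  proof (rule nsphere_straight_homotopy)
    fix s t assume s: "0 \<le> s" "s \<le> (1::real)" and t: "t \<in> ?C"
    obtain i where i: "i \<le> k" "4 * e \<le> \<bar>f t i\<bar>" using large[OF t] by blast
    have "(1 - s) * f t i + s * g t i = f t i + s * (g t i - f t i)" by (simp add: algebra_simps)
    moreover have "\<bar>s * (g t i - f t i)\<bar> < 4 * e"
    proof -
      have "\<bar>s * (g t i - f t i)\<bar> \<le> 1 * \<bar>g t i - f t i\<bar>"
        unfolding abs_mult using s by (intro mult_right_mono) auto
      also have "\<dots> < 4 * e" using gf[OF t i(1)] e by simp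
      finally show ?thesis .
    qed
    ultimately show "\<exists>i\<le>k. (1 - s) * f t i + s * g t i \<noteq> 0" using i by (intro exI[of _ i]) auto
  qed (use fc gc bg a fN in \<open>auto simp: boundary_constant_def topspace_nsphere g_def\<close>)
  have "\<exists>y. y 0 = 1 \<and> (\<forall>i>k. y i = 0) \<and> (\<forall>t\<in>?C. \<forall>c>0. \<exists>i\<le>k. g t i \<noteq> c * y i)"
  proof (rule Lipschitz_image_misses_ray[OF jk, where L = "\<Sum>i\<le>k. L i" and \<eta> = "2 * e"])
    show "0 \<le> (\<Sum>i\<le>k. L i)" by (simp add: L0 sum_nonneg)
    show "\<bar>g s i - g t i\<bar> \<le> (\<Sum>i\<le>k. L i) * cube_dist j s t" if "i \<le> k" "s \<in> ?C" "t \<in> ?C" for i s t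
    proof -
      have "\<bar>g s i - g t i\<bar> \<le> L i * cube_dist j s t"
        using soft_threshold_nonexpansive[of e "q i s" "q i t"] ql[OF that(2,3), of i] that(1) by (simp add: g_def)
      also have "\<dots> \<le> (\<Sum>i\<le>k. L i) * cube_dist j s t"
        using that(1) L0 by (intro mult_right_mono cube_dist_nonneg member_le_sum) auto
      finally show ?thesis .
    qed
    show "\<exists>i\<le>k. 2 * e \<le> \<bar>g t i\<bar>" if tC: "t \<in> ?C" for t
    proof -
      obtain i where "i \<le> k" "4 * e \<le> \<bar>f t i\<bar>" using large[OF tC] by blast
      with gf[OF tC \<open>i \<le> k\<close>] show ?thesis by (intro exI[of _ i]) linarith
    qed
  qed (use e in auto)
  then obtain y where y0: "y 0 = 1" and yk: "\<And>i. i > k \<Longrightarrow> y i = 0"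
    and y: "\<And>t c. t \<in> ?C \<Longrightarrow> c > 0 \<Longrightarrow> \<exists>i\<le>k. g t i \<noteq> c * y i" by blast
  have gnz: "\<exists>i\<le>k. g t i \<noteq> 0" if tC: "t \<in> ?C" for t
  proof -
    obtain i where "i \<le> k" "4 * e \<le> \<bar>f t i\<bar>" using large[OF tC] by blast
    with gf[OF tC \<open>i \<le> k\<close>] e show ?thesis by (intro exI[of _ i]) auto
  qed
  \<comment> \<open>A segment from \<open>g t\<close> to \<open>- y\<close> through the origin would
    make \<open>g t\<close> a positive multiple of \<open>y\<close>, on the missed ray.\<close>
  have 2: "homotopic_with (boundary_constant j) (cube j) (nsphere k) (\<lambda>t. radial k (g t)) (\<lambda>t. radial k (\<lambda>i. - y i))"
  proof (rule nsphere_straight_homotopy)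
    fix s t assume s: "0 \<le> s" "s \<le> (1::real)" and t: "t \<in> ?C"
    consider "s = 0" | "s = 1" | "0 < s" "s < 1" using s by linarith
    then show "\<exists>i\<le>k. (1 - s) * g t i + s * (- y i) \<noteq> 0"
    proof cases
      case 3
      then obtain i where i: "i \<le> k" "g t i \<noteq> s / (1 - s) * y i" using y[OF t, of "s / (1 - s)"] by auto
      have "(1 - s) * g t i + s * (- y i) \<noteq> 0"
      proof
        assume "(1 - s) * g t i + s * (- y i) = 0"
        then have "g t i = s / (1 - s) * y i" using 3 by (simp add: field_simps)
        with i show False by simp
      qed
      with i show ?thesis by blast
    qed (use gnz[OF t] y0 in auto)
  qed (use gc bg yk in \<open>auto simp: boundary_constant_def g_def\<close>)
  have "homotopic_with (boundary_constant j) (cube j) (nsphere k) f (\<lambda>t. radial k (f t))"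
    using f a fN radial_nsphere by (intro homotopic_with_equal) (auto simp: boundary_constant_def
        intro: continuous_map_eq)
  with 1 2 show "\<exists>y. homotopic_with (boundary_constant j) (cube j) (nsphere k) f (\<lambda>_. y)"
    by (meson homotopic_with_trans)
qed

text \<open>A segment avoids the origin as soon as some coordinate is nonzero at one end and 0 at
  the other. Unit vectors serve as stopovers with this property.\<close>

lemma path_connected_space_nsphere:
  assumes "0 < k"
  shows "path_connected_space (nsphere k)"
proof -
  have seg: "path_component_of (nsphere k) x y"
    if x: "x \<in> topspace (nsphere k)" and y: "y \<in> topspace (nsphere k)"
      and nz: "\<And>s. 0 \<le> s \<Longrightarrow> s \<le> 1 \<Longrightarrow> \<exists>i\<le>k. (1 - s) * x i + s * y i \<noteq> 0" for x y
    unfolding path_component_of_def pathin_def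
  proof (intro exI conjI)
    let ?g = "\<lambda>s. radial k (\<lambda>i. (1 - s) * x i + s * y i)"
    have "continuous_on {0..1} ?g" using nz by (intro continuous_on_radial continuous_intros) auto
    moreover have "?g s \<in> topspace (nsphere k)" if "s \<in> {0..1}" for s
      using that nz x y by (intro radial_in_nsphere) (auto simp: topspace_nsphere)
    ultimately show "continuous_map (top_of_set {0..1}) (nsphere k) ?g"
      unfolding nsphere_top_of_set by (auto simp: topspace_nsphere)
  qed (use radial_nsphere x y in auto)
  have sp: "path_component_of (nsphere k) x z"
    if x: "x \<in> topspace (nsphere k)" and z: "z \<in> topspace (nsphere k)" and ne: "x i \<noteq> 0" "z i = 0" "i \<le> k" for x z i
  proof (rule seg[OF x z])
    fix s :: real
    show "\<exists>l\<le>k. (1 - s) * x l + s * z l \<noteq> 0"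
    proof (cases "s = 1")
      case True
      then show ?thesis using nsphere_nonzero[OF z] by auto
    next
      case False
      then show ?thesis using ne by (intro exI[of _ i]) auto
    qed
  qed
  define E where "E l = (\<lambda>i. if i = l then 1 else (0::real))" for l :: nat
  have E: "E l \<in> topspace (nsphere k)" if "l \<le> k" for l
    using that by (simp add: E_def topspace_nsphere if_distrib[of "\<lambda>x. x\<^sup>2"] cong: if_cong)
  have E01: "path_component_of (nsphere k) (E l) (E 0)" if "l \<le> k" for l
    using that E sp[of "E l" "E 0" l] path_component_of_refl[of "nsphere k" "E 0"]
    by (cases "l = 0") (auto simp: E_def)
  have "path_component_of (nsphere k) x (E 0)" if x: "x \<in> topspace (nsphere k)" for x
  proof -
    obtain i where i: "i \<le> k" "x i \<noteq> 0" using nsphere_nonzero[OF x] by blast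
    \<comment> \<open>\<open>E l\<close> vanishes at \<open>i\<close>, where \<open>x\<close> does
      not; a second index exists because \<open>0 < k\<close>.\<close>
    define l where "l = (if i = 0 then 1 else 0::nat)"
    have l: "l \<le> k" "l \<noteq> i" using assms by (auto simp: l_def)
    have "path_component_of (nsphere k) x (E l)" using sp[OF x E[OF l(1)] i(2) _ i(1)] l by (simp add: E_def)
    with E01[OF l(1)] show ?thesis by (meson path_component_of_trans)
  qed
  then show ?thesis unfolding path_connected_space_iff_path_component
    by (meson path_component_of_sym path_component_of_trans)
qed

lemma trivial_pi_nsphere: "j < k \<Longrightarrow> trivial_pi j (nsphere k)"
  using trivial_pi_nsphere_pos path_connected_space_nsphere by (cases "j = 0") (auto simp: trivial_pi_def)

section \<open>Connectivity of spheres\<close>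

text \<open>
  The inverse stereographic projection of \<open>u / (1 - \<parallel>u\<parallel>\<^sub>\<infinity>)\<close>, where \<open>u = 2 t - 1\<close>, written
  with denominators cleared so that it extends to the boundary of the cube.
\<close>
definition cube_collapse :: "nat \<Rightarrow> (nat \<Rightarrow> real) \<Rightarrow> (nat \<Rightarrow> real)" where
  "cube_collapse k t =
    (let l = 1 - cube_norm k t; q = (\<Sum>i<k. (2 * t i - 1)\<^sup>2) in
     (\<lambda>i. if i < k then 2 * l * (2 * t i - 1) / (q + l\<^sup>2)
          else if i = k then (q - l\<^sup>2) / (q + l\<^sup>2) else 0))"

context
  fixes k :: nat
  assumes k: "0 < k"
begin

private definition "north = (\<lambda>i. if i = k then 1 else (0::real))"

private abbreviation "lam t \<equiv> 1 - cube_norm k t"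
private abbreviation "sq t \<equiv> (\<Sum>i<k. (2 * t i - 1)\<^sup>2)"

lemma collapse_denominator_pos: "0 < sq t + (lam t)\<^sup>2"
proof (cases "lam t = 0")
  case True
  then obtain i where "i < k" "\<bar>2 * t i - 1\<bar> = 1" using cube_norm_attained[OF k, of t] by auto
  then have "2 * t i - 1 \<noteq> 0" by auto
  then have "0 < sq t" using \<open>i < k\<close> by (intro sum_pos2[of _ i]) auto
  then show ?thesis by (simp add: add_pos_nonneg)
next
  case False
  moreover have "0 \<le> sq t" by (simp add: sum_nonneg)
  ultimately show ?thesis by (simp add: add_nonneg_pos)
qed

lemma cube_collapse_in_nsphere: "cube_collapse k t \<in> topspace (nsphere k)"
proof -
  define l q where lq: "l = lam t" "q = sq t"
  have d: "q + l\<^sup>2 \<noteq> 0" using collapse_denominator_pos[of t] by (simp add: lq)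
  have "(\<Sum>i\<le>k. (cube_collapse k t i)\<^sup>2) =
      (\<Sum>i<k. (2 * l * (2 * t i - 1) / (q + l\<^sup>2))\<^sup>2) + ((q - l\<^sup>2) / (q + l\<^sup>2))\<^sup>2"
    by (simp add: lessThan_Suc_atMost[symmetric] cube_collapse_def Let_def lq)
  also have "(\<Sum>i<k. (2 * l * (2 * t i - 1) / (q + l\<^sup>2))\<^sup>2) = 4 * l\<^sup>2 * q / (q + l\<^sup>2)\<^sup>2"
    unfolding lq(2) sum_distrib_left sum_divide_distrib
    by (intro sum.cong refl) (simp add: power_divide power_mult_distrib)
  also have "4 * l\<^sup>2 * q / (q + l\<^sup>2)\<^sup>2 + ((q - l\<^sup>2) / (q + l\<^sup>2))\<^sup>2 = (4 * l\<^sup>2 * q + (q - l\<^sup>2)\<^sup>2) / (q + l\<^sup>2)\<^sup>2"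
    by (simp add: power_divide add_divide_distrib)
  also have "4 * l\<^sup>2 * q + (q - l\<^sup>2)\<^sup>2 = (q + l\<^sup>2)\<^sup>2" by (simp add: power2_eq_square algebra_simps)
  finally show ?thesis using d by (simp add: topspace_nsphere cube_collapse_def Let_def)
qed

lemma continuous_map_cube_collapse: "continuous_map (cube k) (nsphere k) (cube_collapse k)"
proof -
  have c: "continuous_on S (\<lambda>t. t i)" for S :: "(nat \<Rightarrow> real) set" and i
    by (rule continuous_on_product_then_coordinatewise) simp
  have "continuous_on S (\<lambda>t. cube_collapse k t i)" for S i
  proof -
    have nz: "sq t + (lam t)\<^sup>2 \<noteq> 0" for t using collapse_denominator_pos[of t] by simp
    note n = continuous_on_cube_norm[OF k, of S]
    consider "i < k" | "i = k" | "i > k" by linarith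
    then show ?thesis
      unfolding cube_collapse_def Let_def
      by cases (simp_all, (intro continuous_intros c n ballI nz)+)
  qed
  then have "continuous_on (topspace (cube k)) (cube_collapse k)"
    by (rule continuous_on_coordinatewise_then_product)
  then show ?thesis
    using cube_collapse_in_nsphere
    by (subst cube_top_of_set) (auto simp: nsphere_top_of_set topspace_nsphere)
qed

lemma cube_collapse_boundary:
  assumes "t \<in> cube_boundary k"
  shows "cube_collapse k t = north"
proof -
  have t: "lam t = 0" using assms cube_norm_eq_1_iff[OF k, of t] by (auto simp: cube_boundary_def)
  then show ?thesis using collapse_denominator_pos[of t]
    by (auto simp: cube_collapse_def Let_def north_def)
qed

text \<open>The last coordinate is 1 exactly on the boundary. Elsewhere stereographic projection
  recovers \<open>(2 * t i - 1) / lam t\<close>, whose largest modulus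
  \<open>cube_norm k t / lam t\<close> determines \<open>lam t\<close> and thus
  \<open>t\<close>.\<close>

lemma cube_collapse_eq:
  assumes s: "s \<in> topspace (cube k)" and t: "t \<in> topspace (cube k)"
    and eq: "cube_collapse k s = cube_collapse k t"
  shows "s = t \<or> (s \<in> cube_boundary k \<and> t \<in> cube_boundary k)"
proof -
  have last: "1 - cube_collapse k t k = 2 * (lam t)\<^sup>2 / (sq t + (lam t)\<^sup>2)" for t
  proof -
    have "1 - cube_collapse k t k = (sq t + (lam t)\<^sup>2) / (sq t + (lam t)\<^sup>2) - (sq t - (lam t)\<^sup>2) / (sq t + (lam t)\<^sup>2)"
      using collapse_denominator_pos[of t] by (simp add: cube_collapse_def Let_def)
    also have "\<dots> = 2 * (lam t)\<^sup>2 / (sq t + (lam t)\<^sup>2)"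
      unfolding diff_divide_distrib[symmetric] by simp
    finally show ?thesis .
  qed
  have z: "1 - cube_collapse k t k = 0 \<longleftrightarrow> t \<in> cube_boundary k" if "t \<in> topspace (cube k)" for t
    unfolding last using collapse_denominator_pos[of t] cube_norm_eq_1_iff[OF k that] by auto
  show ?thesis
  proof (cases "s \<in> cube_boundary k")
    case True
    then show ?thesis using z[OF s] z[OF t] eq by simp
  next
    case False
    then have tb: "t \<notin> cube_boundary k" using z[OF s] z[OF t] eq by simp
    have pos: "0 < lam s" "0 < lam t"
      using cube_norm_le_1[OF k] cube_norm_eq_1_iff[OF k] s t False tb by (smt (verit))+
    have ratio: "cube_collapse k t i / (1 - cube_collapse k t k) = (2 * t i - 1) / lam t"
      if "i < k" "0 < lam t" for t i
    proof -
      have "cube_collapse k t i = 2 * lam t * (2 * t i - 1) / (sq t + (lam t)\<^sup>2)"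
        using that by (simp add: cube_collapse_def Let_def)
      then have e1: "cube_collapse k t i / (1 - cube_collapse k t k) = (2 * lam t * (2 * t i - 1)) / (2 * (lam t)\<^sup>2)"
        unfolding last using collapse_denominator_pos[of t] by simp
      have e2: "(2 * l * x) / (2 * l\<^sup>2) = x / l" if "0 < l" for l x :: real
        using that by (simp add: power2_eq_square)
      show ?thesis by (rule trans[OF e1 e2[OF that(2)]])
    qed
    have r: "(2 * s i - 1) / lam s = (2 * t i - 1) / lam t" if "i < k" for i
      using ratio[OF that pos(1)] ratio[OF that pos(2)] eq by simp
    have r': "\<bar>2 * s i - 1\<bar> * lam t = \<bar>2 * t i - 1\<bar> * lam s" if "i < k" for i
    proof -
      have "(2 * s i - 1) * lam t = (2 * t i - 1) * lam s" using r[OF that] pos by (simp add: divide_eq_eq eq_divide_eq field_simps)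
      then have "\<bar>(2 * s i - 1) * lam t\<bar> = \<bar>(2 * t i - 1) * lam s\<bar>" by simp
      then show ?thesis using pos by (simp add: abs_mult)
    qed
    obtain i where i: "i < k" "cube_norm k s = \<bar>2 * s i - 1\<bar>" using cube_norm_attained[OF k] by blast
    obtain i' where i': "i' < k" "cube_norm k t = \<bar>2 * t i' - 1\<bar>" using cube_norm_attained[OF k] by blast
    have "cube_norm k s * lam t \<le> cube_norm k t * lam s"
      using r'[OF i(1)] cube_norm_ge[OF i(1), of t] pos i(2) by (simp add: mult_right_mono)
    moreover have "cube_norm k t * lam s \<le> cube_norm k s * lam t"
      using r'[OF i'(1), symmetric] cube_norm_ge[OF i'(1), of s] pos i'(2) by (simp add: mult_right_mono)
    ultimately have "lam s = lam t" by (simp add: algebra_simps)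
    then have "s i = t i" if "i < k" for i using r[OF that] pos by simp
    moreover have "s i = t i" if "\<not> i < k" for i using s t that by (auto simp: topspace_cube)
    ultimately show ?thesis by blast
  qed
qed

lemma cube_collapse_surj:
  assumes y: "y \<in> topspace (nsphere k)"
  shows "\<exists>t\<in>topspace (cube k). cube_collapse k t = y"
proof -
  have sum: "(\<Sum>i<k. (y i)\<^sup>2) = 1 - (y k)\<^sup>2" and out: "\<And>i. i > k \<Longrightarrow> y i = 0"
    using y by (auto simp: topspace_nsphere lessThan_Suc_atMost[symmetric])
  have "(y k)\<^sup>2 \<le> 1" using sum sum_nonneg[of "{..<k}" "\<lambda>i. (y i)\<^sup>2"] by simp
  then have le: "y k \<le> 1" using abs_le_square_iff[of "y k" 1] by auto
  show ?thesis
  proof (cases "y k = 1")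
    case True
    then have "y i = 0" if "i < k" for i
      using sum that sum_nonneg_eq_0_iff[of "{..<k}" "\<lambda>i. (y i)\<^sup>2"] by auto
    then have "y = north" using True out by (auto simp: north_def fun_eq_iff) (metis linorder_neqE_nat)
    moreover have "(\<lambda>i. 0) \<in> cube_boundary k" using k by (auto simp: cube_boundary_def topspace_cube)
    ultimately show ?thesis using cube_collapse_boundary by (auto simp: cube_boundary_def)
  next
    case False
    with le have p: "0 < 1 - y k" by simp
    define w where "w i = y i / (1 - y k)" for i
    define m where "m = Max ((\<lambda>i. \<bar>w i\<bar>) ` {..<k})"
    have m0: "0 \<le> m" unfolding m_def using k by (subst Max_ge_iff) auto
    \<comment> \<open>From \<open>w = u / (1 - m')\<close>, with \<open>m'\<close> the sup norm of
      \<open>u\<close>, follows \<open>m = m' / (1 - m')\<close> for the sup norm \<open>m\<close>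
      of \<open>w\<close>; hence \<open>1 - m' = 1 / (1 + m)\<close> and
      \<open>u = l * w\<close>.\<close>
    define l where "l = 1 / (1 + m)"
    have l: "0 < l" "l * (1 + m) = 1" using m0 by (auto simp: l_def)
    define t where "t i = (if i < k then (l * w i + 1) / 2 else 0)" for i
    have u: "2 * t i - 1 = l * w i" if "i < k" for i using that by (simp add: t_def field_simps)
    have n: "cube_norm k t = l * m"
    proof -
      have "(\<lambda>i. \<bar>2 * t i - 1\<bar>) ` {..<k} = (\<lambda>x. l * x) ` (\<lambda>i. \<bar>w i\<bar>) ` {..<k}"
        unfolding image_image using u l(1) by (intro image_cong) (auto simp: abs_mult)
      moreover have "mono (\<lambda>x. l * x)" using l by (intro monoI) (simp add: mult_left_mono)
      ultimately show ?thesis unfolding cube_norm_def m_def using k by (subst mono_Max_commute) auto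
    qed
    then have lt: "lam t = l" using l(2) by (simp add: algebra_simps)
    have "l * m \<le> 1" using l m0 by (simp add: distrib_left)
    then have "cube_norm k t \<le> 1" using n by simp
    then have b: "0 \<le> t i \<and> t i \<le> 1" if "i < k" for i using cube_norm_ge[OF that, of t] by linarith
    then have tC: "t \<in> topspace (cube k)" by (auto simp: topspace_cube t_def)
    have q: "sq t = l\<^sup>2 * ((1 + y k) / (1 - y k))"
    proof -
      have "sq t = (\<Sum>i<k. l\<^sup>2 / (1 - y k)\<^sup>2 * (y i)\<^sup>2)"
        using u by (intro sum.cong) (auto simp: w_def power_mult_distrib power_divide)
      also have "\<dots> = l\<^sup>2 / (1 - y k)\<^sup>2 * (1 - (y k)\<^sup>2)" unfolding sum_distrib_left[symmetric] sum ..
      also have "1 - (y k)\<^sup>2 = (1 + y k) * (1 - y k)" by (simp add: power2_eq_square algebra_simps)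
      also have "l\<^sup>2 / (1 - y k)\<^sup>2 * ((1 + y k) * (1 - y k)) = l\<^sup>2 * ((1 + y k) / (1 - y k))"
        using p by (simp add: power2_eq_square)
      finally show ?thesis .
    qed
    have q1: "sq t + (lam t)\<^sup>2 = 2 * l\<^sup>2 / (1 - y k)"
      unfolding q lt using p by (simp add: field_simps)
    have q2: "sq t - (lam t)\<^sup>2 = 2 * l\<^sup>2 * y k / (1 - y k)"
      unfolding q lt using p by (simp add: field_simps)
    have "cube_collapse k t i = y i" for i
    proof -
      consider "i < k" | "i = k" | "i > k" by linarith
      then show ?thesis
      proof cases
        case 1
        then have "cube_collapse k t i = 2 * l * (l * w i) / (2 * l\<^sup>2 / (1 - y k))"
          unfolding cube_collapse_def Let_def q1 using u lt by simp
        also have "\<dots> = w i * (1 - y k)" using l(1) p by (simp add: power2_eq_square)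
        finally show ?thesis using p by (simp add: w_def)
      next
        case 2
        then have "cube_collapse k t i = (2 * l\<^sup>2 * y k / (1 - y k)) / (2 * l\<^sup>2 / (1 - y k))"
          unfolding cube_collapse_def Let_def q1 q2 by simp
        then show ?thesis using l(1) p 2 by simp
      next
        case 3
        then show ?thesis using out by (simp add: cube_collapse_def Let_def)
      qed
    qed
    then show ?thesis using tC by blast
  qed
qed

text \<open>Applied to \<open>cube_collapse\<close>, triviality would yield a homotopy from the
  identity of the sphere to a constant, contradicting the noncontractibility of spheres.\<close>

lemma not_trivial_pi_nsphere_pos: "\<not> trivial_pi k (nsphere k)"
proof
  assume triv: "trivial_pi k (nsphere k)"
  let ?C = "topspace (cube k)" and ?c = "cube_collapse k" and ?S = "nsphere k"
  let ?I = "top_of_set {0..1::real}"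
  have nS: "north \<in> topspace ?S"
  proof -
    have "(\<lambda>i. 0) \<in> cube_boundary k" using k by (auto simp: cube_boundary_def topspace_cube)
    then show ?thesis using cube_collapse_in_nsphere cube_collapse_boundary by metis
  qed
  have "homotopic_with (\<lambda>h. \<forall>t\<in>cube_boundary k. h t = north) (cube k) ?S ?c (\<lambda>_. north)"
    using triv[unfolded trivial_pi_iff[OF k]] nS continuous_map_cube_collapse cube_collapse_boundary by blast
  then obtain H where H: "continuous_map (prod_topology ?I (cube k)) ?S H"
    and H0: "\<forall>t. H (0, t) = ?c t" and H1: "\<forall>t. H (1, t) = north"
    and Hb: "\<forall>s\<in>{0..1}. \<forall>t\<in>cube_boundary k. H (s, t) = north"
    unfolding homotopic_with_def by blast
  \<comment> \<open>\<open>Q\<close> maps a compact space onto a Hausdorff space and so is a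
    quotient map. It identifies distinct points only over the boundary of the cube, where
    \<open>H\<close> is constantly \<open>north\<close>; hence \<open>H\<close> descends to the
    sphere.\<close>
  define Q where "Q = (\<lambda>(s::real, t). (s, ?c t))"
  have hs: "Hausdorff_space (prod_topology ?I ?S)"
    by (auto simp: Hausdorff_space_prod_topology nsphere_top_of_set intro!: Hausdorff_space_subtopology)
  have cs: "compact_space (prod_topology ?I (cube k))"
    unfolding prod_interval_cube using compact_Times[OF compact_Icc compact_topspace_cube]
    by (simp add: compact_space_subtopology)
  have Qc: "continuous_map (prod_topology ?I (cube k)) (prod_topology ?I ?S) Q"
    unfolding Q_def case_prod_beta
    by (intro continuous_map_pairedI continuous_map_fst
        continuous_map_compose[OF continuous_map_snd continuous_map_cube_collapse, unfolded o_def])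
  have surj: "?c ` ?C = topspace ?S"
    using cube_collapse_surj cube_collapse_in_nsphere by blast
  have "Q ` topspace (prod_topology ?I (cube k)) = topspace (prod_topology ?I ?S)"
  proof -
    have "Q ` ({0..1} \<times> ?C) = {0..1} \<times> ?c ` ?C" unfolding Q_def by force
    then show ?thesis using surj by simp
  qed
  then have "quotient_map (prod_topology ?I (cube k)) (prod_topology ?I ?S) Q"
    by (rule T1_Spaces.continuous_imp_quotient_map[OF Qc cs hs])
  moreover have "H z = H z'" if "z \<in> topspace (prod_topology ?I (cube k))"
    "z' \<in> topspace (prod_topology ?I (cube k))" "Q z = Q z'" for z z'
  proof -
    obtain s t where z: "z = (s, t)" by (cases z)
    obtain s' t' where z': "z' = (s', t')" by (cases z')
    show ?thesis using that cube_collapse_eq[of t t'] Hb by (auto simp: z z' Q_def)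
  qed
  ultimately obtain K where K: "continuous_map (prod_topology ?I ?S) ?S K"
    and KQ: "\<And>z. z \<in> topspace (prod_topology ?I (cube k)) \<Longrightarrow> K (Q z) = H z"
    using quotient_map_lift_exists[OF _ H, of "prod_topology ?I ?S" Q] by metis
  have KS: "K (0, y) = y \<and> K (1, y) = north" if y: "y \<in> topspace ?S" for y
  proof -
    obtain t where "t \<in> ?C" "?c t = y" using cube_collapse_surj[OF y] by blast
    then show ?thesis using KQ[of "(0, t)"] KQ[of "(1, t)"] H0 H1 by (simp add: Q_def)
  qed
  have "homotopic_with (\<lambda>_. True) ?S ?S id (\<lambda>_. north)"
    by (subst homotopic_with) (use K KS in auto)
  then have "contractible_space ?S" unfolding contractible_space_def by blast
  then show False using non_contractible_space_nsphere by blast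
qed

end

text \<open>The 0-sphere has coordinate values 1 and -1 but not 0, so its image on the line is
  disconnected.\<close>

lemma not_trivial_pi_0_nsphere: "\<not> trivial_pi 0 (nsphere 0)"
proof
  define E :: "real \<Rightarrow> nat \<Rightarrow> real" where "E a = (\<lambda>i. if i = 0 then a else 0)" for a
  assume "trivial_pi 0 (nsphere 0)"
  then have "connected_space (nsphere 0)"
    by (simp add: trivial_pi_def path_connected_imp_connected_space)
  then have "connected ((\<lambda>x. x 0) ` topspace (nsphere 0))"
    using connectedin_continuous_map_image[OF continuous_map_nsphere_projection[of 0 0], of "topspace (nsphere 0)"]
    by (simp add: connectedin_topspace)
  moreover have "a \<in> (\<lambda>x. x 0) ` topspace (nsphere 0)" if "a\<^sup>2 = 1" for a :: real
  proof -
    have "E a \<in> topspace (nsphere 0)" "E a 0 = a" using that by (auto simp: topspace_nsphere E_def)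
    then show ?thesis using imageI[of "E a" "topspace (nsphere 0)" "\<lambda>x. x 0"] by metis
  qed
  then have "1 \<in> (\<lambda>x. x 0) ` topspace (nsphere 0)" "-1 \<in> (\<lambda>x. x 0) ` topspace (nsphere 0)"
    by auto
  ultimately have "0 \<in> (\<lambda>x. x 0) ` topspace (nsphere 0)"
    using connected_contains_Icc[of _ "-1" "1::real"] by fastforce
  then show False by (auto simp: topspace_nsphere)
qed

lemma conn_nsphere: "conn (nsphere k) = Fin (int k - 1)"
proof (rule conn_eq_FinI)
  show "\<not> trivial_pi k (nsphere k)"
    using not_trivial_pi_nsphere_pos not_trivial_pi_0_nsphere by (cases "k = 0") auto
  show "topspace (nsphere k) \<noteq> {}" using in_topspace_nsphere by blast
qed (use trivial_pi_nsphere in auto)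

section \<open>The Hom complex as a space of weights\<close>

lemma continuous_on_coordinate: "continuous_on S (\<lambda>x::'a \<Rightarrow> real. x i)"
  by (rule continuous_on_product_then_coordinatewise) simp

lemma closed_closed_simplex: "closed (closed_simplex \<sigma>)"
proof -
  have "closed_simplex \<sigma> = (\<Inter>v. {x. 0 \<le> x v}) \<inter> (\<Inter>v\<in>-\<sigma>. {x. x v = 0}) \<inter> {x. (\<Sum>v\<in>\<sigma>. x v) = 1}"
    by (auto simp: closed_simplex_def)
  then show ?thesis
    by (auto intro!: closed_Int closed_INT closed_Collect_le closed_Collect_eq continuous_intros continuous_on_coordinate)
qed

lemma compact_closed_simplex:
  assumes "finite \<sigma>"
  shows "compact (closed_simplex \<sigma>)"
proof -
  have "compactin (powertop_real UNIV) (PiE UNIV (\<lambda>_::'a. {0..1::real}))" by (simp add: compactin_PiE)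
  then have "compact (PiE UNIV (\<lambda>_::'a. {0..1::real}))" by (simp add: euclidean_product_topology)
  moreover have "closed_simplex \<sigma> \<subseteq> PiE UNIV (\<lambda>_. {0..1})"
  proof
    fix x assume x: "x \<in> closed_simplex \<sigma>"
    have "x v \<le> 1" for v
    proof (cases "v \<in> \<sigma>")
      case True
      then have "x v \<le> (\<Sum>v\<in>\<sigma>. x v)"
        using x assms by (intro member_le_sum) (auto simp: closed_simplex_def)
      then show ?thesis using x by (simp add: closed_simplex_def)
    qed (use x in \<open>auto simp: closed_simplex_def\<close>)
    then show "x \<in> PiE UNIV (\<lambda>_. {0..1})" using x by (auto simp: closed_simplex_def)
  qed
  ultimately show ?thesis
    using compact_Int_closed[OF _ closed_closed_simplex] by (metis inf.absorb2)
qed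

text \<open>Each closed simplex is closed in the product topology, and a finite union of closed sets
  is closed; so the weak topology adds no open sets.\<close>

lemma geometric_realization_finite:
  assumes "finite K"
  shows "geometric_realization K = top_of_set (\<Union>\<sigma>\<in>K. closed_simplex \<sigma>)"
proof (subst topology_eq, intro allI iffI)
  let ?S = "\<Union>\<sigma>\<in>K. closed_simplex \<sigma>"
  fix U
  assume "openin (top_of_set ?S) U"
  then obtain T where T: "open T" "U = ?S \<inter> T" by (auto simp: openin_open)
  have "openin (top_of_set (closed_simplex \<sigma>)) (U \<inter> closed_simplex \<sigma>)" if "\<sigma> \<in> K" for \<sigma>
  proof -
    have "U \<inter> closed_simplex \<sigma> = closed_simplex \<sigma> \<inter> T" using T that by auto
    then show ?thesis using T by (auto simp: openin_open)
  qed
  then show "openin (geometric_realization K) U"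
    using T unfolding openin_geometric_realization euclidean_product_topology by blast
next
  let ?S = "\<Union>\<sigma>\<in>K. closed_simplex \<sigma>"
  fix U
  assume "openin (geometric_realization K) U"
  then have US: "U \<subseteq> ?S"
    and op: "\<And>\<sigma>. \<sigma> \<in> K \<Longrightarrow> openin (top_of_set (closed_simplex \<sigma>)) (U \<inter> closed_simplex \<sigma>)"
    unfolding openin_geometric_realization euclidean_product_topology by blast+
  have "closed (closed_simplex \<sigma> - U)" if sK: "\<sigma> \<in> K" for \<sigma>
  proof -
    obtain T where T: "open T" "U \<inter> closed_simplex \<sigma> = closed_simplex \<sigma> \<inter> T"
      using op[OF sK] by (auto simp: openin_open)
    then have "closed_simplex \<sigma> - U = closed_simplex \<sigma> - T" by blast
    then show ?thesis using closed_Diff[OF closed_closed_simplex T(1)] by simp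
  qed
  then have "closed (\<Union>\<sigma>\<in>K. closed_simplex \<sigma> - U)" using assms by blast
  moreover have "U = ?S \<inter> - (\<Union>\<sigma>\<in>K. closed_simplex \<sigma> - U)" using US by blast
  ultimately show "openin (top_of_set ?S) U" unfolding openin_open by (metis open_Compl)
qed

section \<open>Decompositions of functions along chains of sets\<close>

lemma Union_in_finite_chain:
  assumes "finite \<C>" "\<C> \<noteq> {}" "\<And>A B. A \<in> \<C> \<Longrightarrow> B \<in> \<C> \<Longrightarrow> A \<subseteq> B \<or> B \<subseteq> A"
  shows "\<Union>\<C> \<in> \<C>"
  using assms
proof (induction \<C> rule: finite_ne_induct)
  case (insert A \<C>)
  then have "\<Union>\<C> \<in> \<C>" by blast
  with insert.prems[of A "\<Union>\<C>"] show ?case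
    by (metis Union_insert insertCI sup.absorb1 sup.absorb2)
qed simp

lemma Inter_in_finite_chain:
  assumes "finite \<C>" "\<C> \<noteq> {}" "\<And>A B. A \<in> \<C> \<Longrightarrow> B \<in> \<C> \<Longrightarrow> A \<subseteq> B \<or> B \<subseteq> A"
  shows "\<Inter>\<C> \<in> \<C>"
  using assms
proof (induction \<C> rule: finite_ne_induct)
  case (insert A \<C>)
  then have "\<Inter>\<C> \<in> \<C>" by blast
  with insert.prems[of A "\<Inter>\<C>"] show ?case
    by (metis Inter_insert insertCI inf.absorb1 inf.absorb2)
qed simp

text \<open>Induction by peeling off the largest set of the chain, which is determined together with
  its coefficient by the weighted sum.\<close>

lemma layer_cake_unique:
  fixes t u :: "'p \<Rightarrow> real" and S :: "'p \<Rightarrow> 'e set"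
  assumes "finite C" "finite D" "inj_on S (C \<union> D)"
    and "\<And>p q. p \<in> C \<Longrightarrow> q \<in> C \<Longrightarrow> S p \<subseteq> S q \<or> S q \<subseteq> S p"
    and "\<And>p q. p \<in> D \<Longrightarrow> q \<in> D \<Longrightarrow> S p \<subseteq> S q \<or> S q \<subseteq> S p"
    and "\<And>p. p \<in> C \<union> D \<Longrightarrow> S p \<noteq> {}"
    and "\<And>p. p \<in> C \<Longrightarrow> 0 < t p" "\<And>p. p \<in> D \<Longrightarrow> 0 < u p"
    and "\<And>e. (\<Sum>p | p \<in> C \<and> e \<in> S p. t p) = (\<Sum>p | p \<in> D \<and> e \<in> S p. u p)"
  shows "C = D \<and> (\<forall>p\<in>C. t p = u p)"
  using assms
proof (induction "card C" arbitrary: C D)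
  case 0
  then have C: "C = {}" by simp
  have "D = {}"
  proof (rule ccontr)
    assume "D \<noteq> {}"
    then obtain p where p: "p \<in> D" by blast
    then obtain e where "e \<in> S p" using 0 by blast
    then have "0 < (\<Sum>p | p \<in> D \<and> e \<in> S p. u p)"
      using p 0 by (intro sum_pos2[of _ p]) (auto intro: less_imp_le)
    then show False using "0.prems"(9)[of e] C by simp
  qed
  with C show ?case by simp
next
  case (Suc n)
  \<comment> \<open>The largest set is the support of the sum. Some element of it lies in no smaller
    set, so its coefficient is the least value on the support.\<close>
  have top: "\<exists>p\<in>C'. S p = {e. 0 < (\<Sum>p | p \<in> C' \<and> e \<in> S p. t' p)} \<and>
      (\<forall>e\<in>S p. t' p \<le> (\<Sum>p | p \<in> C' \<and> e \<in> S p. t' p)) \<and>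
      (\<exists>e\<in>S p. t' p = (\<Sum>p | p \<in> C' \<and> e \<in> S p. t' p))"
    if fin: "finite C'" and ne: "C' \<noteq> {}" and inj: "inj_on S C'"
      and ch: "\<And>p q. p \<in> C' \<Longrightarrow> q \<in> C' \<Longrightarrow> S p \<subseteq> S q \<or> S q \<subseteq> S p"
      and nonemp: "\<And>p. p \<in> C' \<Longrightarrow> S p \<noteq> {}" and pos: "\<And>p. p \<in> C' \<Longrightarrow> 0 < t' p"
    for C' and t' :: "'p \<Rightarrow> real"
  proof -
    have "\<Union>(S ` C') \<in> S ` C'" using fin ne ch by (intro Union_in_finite_chain) auto
    then obtain p where p: "p \<in> C'" "S p = \<Union>(S ` C')" by auto
    have "0 < (\<Sum>p | p \<in> C' \<and> e \<in> S p. t' p) \<longleftrightarrow> e \<in> S p" for e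
    proof
      assume "0 < (\<Sum>p | p \<in> C' \<and> e \<in> S p. t' p)"
      then have "{p. p \<in> C' \<and> e \<in> S p} \<noteq> {}" by (metis less_irrefl sum.empty)
      then show "e \<in> S p" using p by blast
    next
      assume "e \<in> S p"
      then show "0 < (\<Sum>p | p \<in> C' \<and> e \<in> S p. t' p)"
        using p pos fin by (intro sum_pos2[of _ p]) (auto intro: less_imp_le)
    qed
    moreover have "t' p \<le> (\<Sum>p | p \<in> C' \<and> e \<in> S p. t' p)" if "e \<in> S p" for e
      using that p pos fin by (intro member_le_sum) (auto intro: less_imp_le)
    moreover have "\<exists>e\<in>S p. t' p = (\<Sum>p | p \<in> C' \<and> e \<in> S p. t' p)"
    proof -
      have "\<exists>e\<in>S p. \<forall>q\<in>C' - {p}. e \<notin> S q"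
      proof (cases "C' - {p} = {}")
        case True
        then show ?thesis using nonemp p by blast
      next
        case False
        have "\<Union>(S ` (C' - {p})) \<in> S ` (C' - {p})" using fin False ch by (intro Union_in_finite_chain) auto
        then obtain q where q: "q \<in> C' - {p}" "S q = \<Union>(S ` (C' - {p}))" by auto
        then have "S q \<noteq> S p" using inj p(1) by (metis DiffE inj_onD singletonI)
        then have "\<not> S p \<subseteq> S q" using p q by blast
        then show ?thesis using q by blast
      qed
      then obtain e where e: "e \<in> S p" "\<forall>q\<in>C' - {p}. e \<notin> S q" by blast
      then have "{q. q \<in> C' \<and> e \<in> S q} = {p}" using p by blast
      then show ?thesis using e by (intro bexI[of _ e]) simp_all
    qed
    ultimately show ?thesis using p(1) by (intro bexI[of _ p]) auto
  qed
  let ?x = "\<lambda>e. \<Sum>p | p \<in> C \<and> e \<in> S p. t p"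
  have Cne: "C \<noteq> {}" using Suc.hyps(2) by auto
  have topC: "\<exists>p\<in>C. S p = {e. 0 < ?x e} \<and> (\<forall>e\<in>S p. t p \<le> ?x e) \<and> (\<exists>e\<in>S p. t p = ?x e)"
    by (rule top[OF Suc.prems(1) Cne inj_on_subset[OF Suc.prems(3) Un_upper1]]) (use Suc.prems(4,6,7) in auto)
  obtain p where p: "p \<in> C" "S p = {e. 0 < ?x e}" "\<forall>e\<in>S p. t p \<le> ?x e" "\<exists>e\<in>S p. t p = ?x e"
    using topC by blast
  have Dne: "D \<noteq> {}"
  proof
    assume "D = {}"
    then have "?x e = 0" for e using Suc.prems(9) by simp
    then show False using p Suc.prems(6)[of p] by auto
  qed
  have topD: "\<exists>q\<in>D. S q = {e. 0 < ?x e} \<and> (\<forall>e\<in>S q. u q \<le> ?x e) \<and> (\<exists>e\<in>S q. u q = ?x e)"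
    unfolding Suc.prems(9)
    by (rule top[OF Suc.prems(2) Dne inj_on_subset[OF Suc.prems(3) Un_upper2]]) (use Suc.prems(5,6,8) in auto)
  obtain q where q: "q \<in> D" "S q = {e. 0 < ?x e}" "\<forall>e\<in>S q. u q \<le> ?x e" "\<exists>e\<in>S q. u q = ?x e"
    using topD by blast
  have qp: "q = p" using inj_onD[OF Suc.prems(3) trans[OF q(2) p(2)[symmetric]]] p(1) q(1) by blast
  have tu: "t p = u p" using p q unfolding qp by (metis order_antisym)
  have "C - {p} = D - {p} \<and> (\<forall>r\<in>C - {p}. t r = u r)"
  proof (rule Suc.hyps(1))
    show "n = card (C - {p})" using Suc.hyps(2) p(1) Suc.prems(1) by simp
    show "(\<Sum>r | r \<in> C - {p} \<and> e \<in> S r. t r) = (\<Sum>r | r \<in> D - {p} \<and> e \<in> S r. u r)" for e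
    proof (cases "e \<in> S p")
      case True
      have "(\<Sum>r | r \<in> C' \<and> e \<in> S r. w r) = w p + (\<Sum>r | r \<in> C' - {p} \<and> e \<in> S r. w r)"
        if "p \<in> C'" "finite C'" for C' and w :: "'p \<Rightarrow> real"
      proof -
        have "{r. r \<in> C' \<and> e \<in> S r} = insert p {r. r \<in> C' - {p} \<and> e \<in> S r}" using that True by blast
        then show ?thesis using that by simp
      qed
      then show ?thesis using Suc.prems(9)[of e] p(1) q(1) Suc.prems(1,2) tu unfolding qp by force
    next
      case False
      then have "{r. r \<in> C - {p} \<and> e \<in> S r} = {r. r \<in> C \<and> e \<in> S r}"
        "{r. r \<in> D - {p} \<and> e \<in> S r} = {r. r \<in> D \<and> e \<in> S r}" by auto
      then show ?thesis using Suc.prems(9)[of e] by simp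
    qed
    show "inj_on S (C - {p} \<union> (D - {p}))" using Suc.prems(3) by (rule inj_on_subset) auto
  qed (use Suc.prems in auto)
  then show ?case using tu p(1) q(1) unfolding qp by blast
qed

text \<open>Subtracting the least positive value on the support removes at least one element from
  the support; the support itself becomes the new largest layer. The layers are kept as superlevel
  sets, so that they can later be recognised as cells.\<close>

lemma layer_cake_exists:
  fixes x :: "'e \<Rightarrow> real"
  assumes "finite {e. 0 < x e}" "\<And>e. 0 \<le> x e"
  shows "\<exists>\<C> t. finite \<C> \<and> (\<forall>A\<in>\<C>. \<forall>B\<in>\<C>. A \<subseteq> B \<or> B \<subseteq> A) \<and>
    (\<forall>A\<in>\<C>. A \<noteq> {} \<and> (0::real) < t A \<and> (\<exists>\<theta>\<ge>0. A = {e. \<theta> < x e})) \<and>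
    (\<forall>e. x e = (\<Sum>A | A \<in> \<C> \<and> e \<in> A. t A))"
  using assms
proof (induction "card {e. 0 < x e}" arbitrary: x rule: less_induct)
  case less
  let ?s = "{e. 0 < x e}"
  show ?case
  proof (cases "?s = {}")
    case True
    then have "x e = 0" for e using less.prems(2)[of e] by (auto simp: not_less intro: antisym)
    then show ?thesis by (intro exI[of _ "{}"]) auto
  next
    case False
    define m where "m = Min (x ` ?s)"
    have m: "m \<in> x ` ?s" unfolding m_def using less.prems(1) False by (intro Min_in) auto
    then obtain e0 where e0: "0 < x e0" "x e0 = m" by auto
    have ge: "m \<le> x e" if "0 < x e" for e
      unfolding m_def using less.prems(1) that by (intro Min_le) auto
    define y where "y e = (if 0 < x e then x e - m else 0)" for e
    have y0: "0 \<le> y e" for e using ge by (simp add: y_def)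
    have ys: "{e. 0 < y e} \<subset> ?s"
    proof (intro psubsetI subsetI notI)
      assume "{e. 0 < y e} = ?s"
      then have "0 < y e0" using e0 by blast
      then show False using e0 by (simp add: y_def)
    qed (auto simp: y_def split: if_splits)
    have fy: "finite {e. 0 < y e}" using ys less.prems(1) by (meson finite_subset psubset_imp_subset)
    note IH = less.hyps[of y, OF psubset_card_mono[OF less.prems(1) ys] fy y0]
    obtain \<C> t where C1: "finite \<C>" "\<forall>A\<in>\<C>. \<forall>B\<in>\<C>. A \<subseteq> B \<or> B \<subseteq> A"
      and Cl': "\<forall>A\<in>\<C>. A \<noteq> {} \<and> (0::real) < t A \<and> (\<exists>\<theta>\<ge>0. A = {e. \<theta> < y e})"
      and yC': "\<forall>e. y e = (\<Sum>A | A \<in> \<C> \<and> e \<in> A. t A)"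
      using IH by (elim exE conjE) (rule that)
    note C = C1(1) C1(2)[rule_format] and Cl = Cl'[rule_format] and yC = yC'[rule_format]
    have sub: "A \<subset> ?s" if AC: "A \<in> \<C>" for A
    proof -
      obtain \<theta> where "\<theta> \<ge> 0" "A = {e. \<theta> < y e}" using Cl[OF AC] by blast
      then have "A \<subseteq> {e. 0 < y e}" by auto
      with ys show ?thesis by blast
    qed
    then have sC: "?s \<notin> \<C>" by blast
    let ?t = "t(?s := m)"
    have "x e = (\<Sum>A | A \<in> insert ?s \<C> \<and> e \<in> A. ?t A)" for e
    proof (cases "0 < x e")
      case True
      then have "{A. A \<in> insert ?s \<C> \<and> e \<in> A} = insert ?s {A. A \<in> \<C> \<and> e \<in> A}" by auto
      moreover have "(\<Sum>A | A \<in> \<C> \<and> e \<in> A. ?t A) = (\<Sum>A | A \<in> \<C> \<and> e \<in> A. t A)"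
        using sC by (intro sum.cong) auto
      ultimately show ?thesis using C(1) sC yC[of e] True by (simp add: y_def)
    next
      case False
      then have "{A. A \<in> insert ?s \<C> \<and> e \<in> A} = {}" using sub by blast
      then have "(\<Sum>A | A \<in> insert ?s \<C> \<and> e \<in> A. ?t A) = 0" by (simp only: sum.empty)
      then show ?thesis using False less.prems(2)[of e] by simp
    qed
    moreover have "A \<noteq> {} \<and> 0 < ?t A \<and> (\<exists>\<theta>\<ge>0. A = {e. \<theta> < x e})" if "A \<in> insert ?s \<C>" for A
    proof (cases "A = ?s")
      case True
      then show ?thesis using False e0 by auto
    next
      case ne: False
      then have A: "A \<in> \<C>" using that by blast
      then obtain \<theta> where th: "\<theta> \<ge> 0" "A = {e. \<theta> < y e}" using Cl by blast
      have "A = {e. \<theta> + m < x e}" using th e0 by (auto simp: y_def)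
      then show ?thesis using Cl[OF A] ne th e0 by (intro conjI exI[of _ "\<theta> + m"]) auto
    qed
    moreover have "A \<subseteq> B \<or> B \<subseteq> A" if "A \<in> insert ?s \<C>" "B \<in> insert ?s \<C>" for A B
      using that C(2) sub by blast
    ultimately show ?thesis using C(1) by (intro exI[of _ "insert ?s \<C>"] exI[of _ ?t]) blast
  qed
qed

text \<open>The layers of a function are its superlevel sets, so requiring these to lie in
  \<open>\<S>\<close> says that the function is a weighted sum along a chain of \<open>\<S>\<close>;
  the value 1 makes the coefficients sum to 1.\<close>

definition superlevel_space :: "'e set set \<Rightarrow> ('e \<Rightarrow> real) set" where
  "superlevel_space \<S> = {x. (\<forall>e. 0 \<le> x e \<and> x e \<le> 1) \<and> (\<exists>e. x e = 1) \<and>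
     (\<forall>\<theta>. 0 \<le> \<theta> \<longrightarrow> \<theta> < 1 \<longrightarrow> {e. \<theta> < x e} \<in> \<S>)}"

text \<open>
  Points of the barycentric subdivision are turned into points of the cell complex by
  sending the vertex \<open>p\<close> to the indicator function of \<open>S p\<close>.
\<close>
lemma order_complex_homeomorphic_superlevel_space:
  fixes S :: "'p \<Rightarrow> 'e set" and le :: "'p \<Rightarrow> 'p \<Rightarrow> bool"
  assumes fin: "finite P" and inj: "inj_on S P"
    and le: "\<And>p q. p \<in> P \<Longrightarrow> q \<in> P \<Longrightarrow> le p q \<longleftrightarrow> S p \<subseteq> S q"
    and finS: "\<And>p. p \<in> P \<Longrightarrow> finite (S p)" and ne: "\<And>p. p \<in> P \<Longrightarrow> S p \<noteq> {}"
  shows "geometric_realization (order_complex P le) homeomorphic_space top_of_set (superlevel_space (S ` P))"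
proof -
  let ?K = "order_complex P le"
  let ?R = "\<Union>\<sigma>\<in>?K. closed_simplex \<sigma>"
  define F where "F t e = (\<Sum>p | p \<in> P \<and> e \<in> S p. t p)" for t :: "'p \<Rightarrow> real" and e
  have "?K \<subseteq> Pow P" by (auto simp: order_complex_def)
  then have finK: "finite ?K" using fin by (meson finite_Pow_iff finite_subset)
  have K: "C \<subseteq> P" "finite C" "C \<noteq> {}" "\<And>p q. p \<in> C \<Longrightarrow> q \<in> C \<Longrightarrow> S p \<subseteq> S q \<or> S q \<subseteq> S p"
    if "C \<in> ?K" for C
    using that le by (auto simp: order_complex_def chain_def) (meson subsetD)
  have FC: "F t e = (\<Sum>p | p \<in> C \<and> e \<in> S p. t p)" if "C \<subseteq> P" "\<And>p. p \<notin> C \<Longrightarrow> t p = 0" for C t e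
    unfolding F_def using fin that by (intro sum.mono_neutral_right) auto
  have img1: "F t \<in> superlevel_space (S ` P)" if t: "t \<in> closed_simplex C" and C: "C \<in> ?K" for t C
  proof -
    note CK = K[OF C]
    have t0: "0 \<le> t p" and tC: "p \<notin> C \<Longrightarrow> t p = 0" and t1: "(\<Sum>p\<in>C. t p) = 1" for p
      using t by (auto simp: closed_simplex_def)
    have F: "F t e = (\<Sum>p | p \<in> C \<and> e \<in> S p. t p)" for e using FC[OF CK(1) tC] .
    have F0: "0 \<le> F t e" for e unfolding F by (intro sum_nonneg t0)
    have F1: "F t e \<le> 1" for e
      unfolding F t1[symmetric] using CK(2) t0 by (intro sum_mono2) auto
    \<comment> \<open>An element of the smallest set lies in every set of the chain, so the value
      there is the total weight 1.\<close>
    have "\<Inter>(S ` C) \<in> S ` C" using CK by (intro Inter_in_finite_chain) auto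
    then obtain p where p: "p \<in> C" "S p = \<Inter>(S ` C)" by auto
    obtain e1 where e1: "e1 \<in> S p" using ne p(1) CK(1) by blast
    then have "{p. p \<in> C \<and> e1 \<in> S p} = C" using p by auto
    then have Fe1: "F t e1 = 1" using F t1 by simp
    have "{e. \<theta> < F t e} \<in> S ` P" if \<theta>: "0 \<le> \<theta>" "\<theta> < 1" for \<theta>
    proof -
      let ?W = "{e. \<theta> < F t e}"
      \<comment> \<open>On the smallest member of the chain containing \<open>e\<close> the value is
        at least that at \<open>e\<close>. The superlevel set is thus a union of members of the
        chain, hence itself a member.\<close>
      have cov: "\<exists>p\<in>C. e \<in> S p \<and> S p \<subseteq> ?W" if e: "e \<in> ?W" for e
      proof -
        let ?Ce = "{p. p \<in> C \<and> e \<in> S p}"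
        have "?Ce \<noteq> {}"
        proof
          assume "?Ce = {}"
          then have "F t e = 0" unfolding F by (simp only: sum.empty)
          then show False using e \<theta> by simp
        qed
        then have "\<Inter>(S ` ?Ce) \<in> S ` ?Ce" using CK by (intro Inter_in_finite_chain) auto
        then obtain q where q: "q \<in> ?Ce" "S q = \<Inter>(S ` ?Ce)" by auto
        have "F t e \<le> F t e'" if "e' \<in> S q" for e'
          unfolding F using that q CK(2) t0 by (intro sum_mono2) auto
        then have "S q \<subseteq> ?W" using e by (auto intro: less_le_trans)
        then show ?thesis using q(1) by blast
      qed
      let ?A = "{p. p \<in> C \<and> S p \<subseteq> ?W}"
      have "\<Union>(S ` ?A) = ?W" using cov by blast
      moreover have "\<Union>(S ` ?A) \<in> S ` ?A"
      proof (rule Union_in_finite_chain)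
        have "e1 \<in> ?W" using Fe1 \<theta> by simp
        then show "S ` ?A \<noteq> {}" using cov by blast
      qed (use CK in auto)
      ultimately show ?thesis using CK(1) by auto
    qed
    then show ?thesis using F0 F1 Fe1 unfolding superlevel_space_def by blast
  qed
  have img2: "\<exists>t\<in>?R. F t = x" if x: "x \<in> superlevel_space (S ` P)" for x
  proof -
    have x0: "\<And>e. 0 \<le> x e" and x1: "\<And>e. x e \<le> 1"
      and xs: "\<And>\<theta>. 0 \<le> \<theta> \<Longrightarrow> \<theta> < 1 \<Longrightarrow> {e. \<theta> < x e} \<in> S ` P"
      using x by (auto simp: superlevel_space_def)
    obtain e1 where e1: "x e1 = 1" using x by (auto simp: superlevel_space_def)
    have fx: "finite {e. 0 < x e}" using xs[of 0] finS by auto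
    obtain \<C> t where C: "finite \<C>" "\<forall>A\<in>\<C>. \<forall>B\<in>\<C>. A \<subseteq> B \<or> B \<subseteq> A"
      and Cl: "\<forall>A\<in>\<C>. A \<noteq> {} \<and> (0::real) < t A \<and> (\<exists>\<theta>\<ge>0. A = {e. \<theta> < x e})"
      and xC: "\<forall>e. x e = (\<Sum>A | A \<in> \<C> \<and> e \<in> A. t A)"
      using layer_cake_exists[OF fx x0] by (elim exE conjE) (rule that)
    \<comment> \<open>A nonempty layer has threshold below 1 and so contains \<open>e1\<close>;
      evaluating at \<open>e1\<close> shows that the coefficients sum to 1.\<close>
    have CS: "A \<in> S ` P \<and> e1 \<in> A" if A: "A \<in> \<C>" for A
    proof -
      obtain \<theta> where th: "\<theta> \<ge> 0" "A = {e. \<theta> < x e}" "A \<noteq> {}" using Cl A by blast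
      then obtain e where "\<theta> < x e" by blast
      then have "\<theta> < 1" using x1[of e] by linarith
      then show ?thesis using xs[OF th(1)] th(2) e1 by auto
    qed
    define Q where "Q = {p \<in> P. S p \<in> \<C>}"
    define u where "u p = (if p \<in> Q then t (S p) else 0)" for p
    have SQ: "S ` Q = \<C>" using CS by (auto simp: Q_def)
    have injQ: "inj_on S Q" using inj by (rule inj_on_subset) (auto simp: Q_def)
    have "x e = (\<Sum>p | p \<in> Q \<and> e \<in> S p. u p)" for e
    proof -
      have "x e = (\<Sum>A | A \<in> S ` Q \<and> e \<in> A. t A)" using xC SQ by simp
      also have "{A. A \<in> S ` Q \<and> e \<in> A} = S ` {p. p \<in> Q \<and> e \<in> S p}" by auto
      also have "(\<Sum>A\<in>S ` {p. p \<in> Q \<and> e \<in> S p}. t A) = (\<Sum>p | p \<in> Q \<and> e \<in> S p. t (S p))"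
        by (rule sum.reindex_cong[OF inj_on_subset[OF injQ]]) auto
      also have "\<dots> = (\<Sum>p | p \<in> Q \<and> e \<in> S p. u p)" by (intro sum.cong) (auto simp: u_def)
      finally show ?thesis .
    qed
    moreover have "F u e = (\<Sum>p | p \<in> Q \<and> e \<in> S p. u p)" for e
      by (rule FC) (auto simp: Q_def u_def)
    ultimately have Fu: "F u = x" by auto
    have "{p. p \<in> Q \<and> e1 \<in> S p} = Q" using CS by (auto simp: Q_def)
    then have uQ: "(\<Sum>p\<in>Q. u p) = 1" using \<open>\<And>e. x e = _\<close>[of e1] e1 by simp
    have "u \<in> closed_simplex Q" using Cl uQ by (auto simp: closed_simplex_def u_def Q_def less_imp_le)
    moreover have "Q \<in> ?K"
    proof -
      have "Q \<noteq> {}" using uQ by auto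
      moreover have "le p q \<or> le q p" if "p \<in> Q" "q \<in> Q" for p q
        using that C(2) le by (auto simp: Q_def)
      ultimately show ?thesis using fin by (auto simp: order_complex_def chain_def Q_def)
    qed
    ultimately show ?thesis using Fu by blast
  qed
  have injF: "inj_on F ?R"
  proof (rule inj_onI)
    fix t u assume "t \<in> ?R" "u \<in> ?R" and eq: "F t = F u"
    then obtain C D where t: "t \<in> closed_simplex C" "C \<in> ?K" and u: "u \<in> closed_simplex D" "D \<in> ?K" by blast
    have nn: "0 \<le> t p" "0 \<le> u p" "p \<notin> C \<Longrightarrow> t p = 0" "p \<notin> D \<Longrightarrow> u p = 0" for p
      using t(1) u(1) by (auto simp: closed_simplex_def)
    let ?C = "{p \<in> C. 0 < t p}" and ?D = "{p \<in> D. 0 < u p}"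
    have Ft: "F t e = (\<Sum>p | p \<in> ?C \<and> e \<in> S p. t p)" for e
      by (rule FC) (use K(1)[OF t(2)] nn in \<open>auto simp: less_le\<close>)
    have Fu: "F u e = (\<Sum>p | p \<in> ?D \<and> e \<in> S p. u p)" for e
      by (rule FC) (use K(1)[OF u(2)] nn in \<open>auto simp: less_le\<close>)
    have CD: "?C = ?D \<and> (\<forall>p\<in>?C. t p = u p)"
    proof (rule layer_cake_unique[where S = S])
      show "inj_on S (?C \<union> ?D)" using inj by (rule inj_on_subset) (use K(1)[OF t(2)] K(1)[OF u(2)] in auto)
      show "(\<Sum>p | p \<in> ?C \<and> e \<in> S p. t p) = (\<Sum>p | p \<in> ?D \<and> e \<in> S p. u p)" for e
        using Ft[of e] Fu[of e] eq by simp
      show "S p \<noteq> {}" if "p \<in> ?C \<union> ?D" for p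
        using that K(1)[OF t(2)] K(1)[OF u(2)] ne by auto
    qed (use K[OF t(2)] K[OF u(2)] in auto)
    show "t = u"
    proof
      fix p show "t p = u p"
      proof (cases "p \<in> ?C")
        case True
        with CD show ?thesis by blast
      next
        case False
        then have "p \<notin> ?D" using CD by blast
        with False show ?thesis using nn[of p] by force
      qed
    qed
  qed
  have Fc: "continuous_on ?R F"
    unfolding F_def by (intro continuous_on_coordinatewise_then_product continuous_intros continuous_on_coordinate)
  have "compact ?R" using finK K(2) compact_closed_simplex by (intro compact_UN) auto
  moreover have "Hausdorff_space (powertop_real (UNIV :: 'e set))"
    by (simp add: Hausdorff_space_product_topology)
  then have "Hausdorff_space (euclidean :: ('e \<Rightarrow> real) topology)"
    by (simp add: euclidean_product_topology)
  moreover have "F ` ?R = superlevel_space (S ` P)" using img1 img2 by blast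
  \<comment> \<open>A continuous bijection from a compact space to a Hausdorff space.\<close>
  ultimately have "homeomorphic_map (top_of_set ?R) (top_of_set (superlevel_space (S ` P))) F"
    using Fc injF by (intro continuous_imp_homeomorphic_map)
      (simp_all add: compact_space_subtopology Hausdorff_space_subtopology image_subset_iff_funcset[symmetric])
  then show ?thesis
    unfolding geometric_realization_finite[OF finK] by (rule homeomorphic_map_imp_homeomorphic_space)
qed

text \<open>
  Weights are normalised by maximum \<open>1\<close> rather than sum \<open>1\<close>, so that the superlevel sets of a
  point are again cells.
\<close>
definition hom_space :: "'a pair_pre_digraph \<Rightarrow> 'b pair_pre_digraph \<Rightarrow> ('a \<times> 'b \<Rightarrow> real) set" where
  "hom_space G H = {x. (\<forall>e. 0 \<le> x e \<and> x e \<le> 1) \<and>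
     (\<forall>v c. x (v, c) \<noteq> 0 \<longrightarrow> v \<in> pverts G \<and> c \<in> pverts H) \<and>
     (\<forall>v\<in>pverts G. \<exists>c. x (v, c) = 1) \<and>
     (\<forall>(v, w)\<in>parcs G. \<forall>c d. 0 < x (v, c) \<longrightarrow> 0 < x (w, d) \<longrightarrow> (c, d) \<in> parcs H)}"

text \<open>A cell is identified with its graph in \<open>V(G) \<times> V(H)\<close>. Adjacency
  passes to smaller supports, so it suffices at threshold 0; nonemptiness at all thresholds below 1
  becomes the value 1 at every vertex.\<close>

lemma superlevel_space_Hom_cells:
  assumes finH: "finite (pverts H)" and V: "pverts G \<noteq> {}" and wf: "parcs G \<subseteq> pverts G \<times> pverts G"
  shows "superlevel_space ((\<lambda>\<eta>. Sigma (pverts G) \<eta>) ` Hom_cells G H) = hom_space G H"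
proof (intro equalityI subsetI)
  let ?S = "\<lambda>\<eta>. Sigma (pverts G) \<eta>"
  fix x assume x: "x \<in> superlevel_space (?S ` Hom_cells G H)"
  then have x01: "\<And>e. 0 \<le> x e \<and> x e \<le> 1" 
    and xs: "\<And>\<theta>. 0 \<le> \<theta> \<Longrightarrow> \<theta> < 1 \<Longrightarrow> {e. \<theta> < x e} \<in> ?S ` Hom_cells G H"
    by (auto simp: superlevel_space_def)
  obtain \<eta> where eta: "\<eta> \<in> Hom_cells G H" "{e. 0 < x e} = ?S \<eta>" using xs[of 0] by auto
  have pos: "0 < x (v, c) \<longleftrightarrow> v \<in> pverts G \<and> c \<in> \<eta> v" for v c using eta(2) by auto
  have sub: "\<eta> v \<subseteq> pverts H" if "v \<in> pverts G" for v using eta(1) that by (auto simp: Hom_cells_def PiE_iff)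
  have supp: "v \<in> pverts G \<and> c \<in> pverts H" if "x (v, c) \<noteq> 0" for v c
  proof -
    have "0 < x (v, c)" using that x01[of "(v, c)"] by linarith
    then show ?thesis using pos sub by blast
  qed
  have "\<exists>c. x (v, c) = 1" if v: "v \<in> pverts G" for v
  proof (rule ccontr)
    assume no: "\<nexists>c. x (v, c) = 1"
    \<comment> \<open>If \<open>v\<close> never attained 1, the superlevel set at its largest value
      would leave \<open>v\<close> without a colour. The inserted 0 makes \<theta> an admissible
      threshold.\<close>
    define \<theta> where "\<theta> = Max (insert 0 ((\<lambda>c. x (v, c)) ` pverts H))"
    have \<theta>0: "0 \<le> \<theta>" unfolding \<theta>_def using finH by (intro Max_ge) auto
    have "\<theta> \<in> insert 0 ((\<lambda>c. x (v, c)) ` pverts H)" unfolding \<theta>_def using finH by (intro Max_in) auto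
    then have "\<theta> < 1" using no x01 by (auto simp: less_le)
    then obtain \<xi> where xi: "\<xi> \<in> Hom_cells G H" "{e. \<theta> < x e} = ?S \<xi>" using xs[OF \<theta>0] by auto
    have "\<xi> v \<noteq> {}" using xi(1) v by (auto simp: Hom_cells_def PiE_iff)
    then obtain c where "c \<in> \<xi> v" by blast
    then have c: "\<theta> < x (v, c)" using xi(2) v by auto
    then have "c \<in> pverts H" using supp[of v c] \<theta>0 by auto
    then have "x (v, c) \<le> \<theta>" unfolding \<theta>_def using finH by (intro Max_ge) auto
    with c show False by simp
  qed
  moreover have "(c, d) \<in> parcs H" if "(v, w) \<in> parcs G" "0 < x (v, c)" "0 < x (w, d)" for v w c d
    using that eta(1) pos by (fastforce simp: Hom_cells_def)
  ultimately show "x \<in> hom_space G H" using x01 supp unfolding hom_space_def by blast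
next
  let ?S = "\<lambda>\<eta>. Sigma (pverts G) \<eta>"
  fix x assume x: "x \<in> hom_space G H"
  then have x01: "\<And>e. 0 \<le> x e \<and> x e \<le> 1" 
    and supp: "\<And>v c. x (v, c) \<noteq> 0 \<Longrightarrow> v \<in> pverts G \<and> c \<in> pverts H"
    and one: "\<And>v. v \<in> pverts G \<Longrightarrow> \<exists>c. x (v, c) = 1"
    and arc: "\<And>v w c d. (v, w) \<in> parcs G \<Longrightarrow> 0 < x (v, c) \<Longrightarrow> 0 < x (w, d) \<Longrightarrow> (c, d) \<in> parcs H"
    by (auto simp: hom_space_def)
  have "{e. \<theta> < x e} \<in> ?S ` Hom_cells G H" if \<theta>: "0 \<le> \<theta>" "\<theta> < 1" for \<theta>
  proof -
    define \<eta> where "\<eta> = (\<lambda>v\<in>pverts G. {c. \<theta> < x (v, c)})"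
    have s: "x (v, c) \<noteq> 0" if "\<theta> < x (v, c)" for v c using that \<theta> by auto
    have "{e. \<theta> < x e} = ?S \<eta>" using supp[OF s] by (auto simp: \<eta>_def)
    moreover have "{c. \<theta> < x (v, c)} \<in> Pow (pverts H) - {{}}" if v: "v \<in> pverts G" for v
    proof -
      obtain c where "x (v, c) = 1" using one[OF v] by blast
      then have "c \<in> {c. \<theta> < x (v, c)}" using \<theta> by simp
      moreover have "{c. \<theta> < x (v, c)} \<subseteq> pverts H" using supp[OF s] by blast
      ultimately show ?thesis by blast
    qed
    then have "\<eta> \<in> pverts G \<rightarrow>\<^sub>E (Pow (pverts H) - {{}})" by (auto simp: \<eta>_def)
    moreover have "\<eta> v \<times> \<eta> w \<subseteq> parcs H" if "(v, w) \<in> parcs G" for v w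
    proof -
      have "v \<in> pverts G" "w \<in> pverts G" using that wf by auto
      then show ?thesis using arc[OF that] \<theta> by (auto simp: \<eta>_def)
    qed
    ultimately show ?thesis unfolding Hom_cells_def by blast
  qed
  moreover obtain e where "x e = 1" using one V by blast
  ultimately show "x \<in> superlevel_space (?S ` Hom_cells G H)" using x01 unfolding superlevel_space_def by blast
qed

theorem Hom_complex_homeomorphic_hom_space:
  assumes finG: "finite (pverts G)" and finH: "finite (pverts H)" and V: "pverts G \<noteq> {}"
    and wf: "parcs G \<subseteq> pverts G \<times> pverts G"
  shows "Hom_complex G H homeomorphic_space top_of_set (hom_space G H)"
  unfolding Hom_complex_def superlevel_space_Hom_cells[OF finH V wf, symmetric]
proof (rule order_complex_homeomorphic_superlevel_space)
  have "Hom_cells G H \<subseteq> pverts G \<rightarrow>\<^sub>E (Pow (pverts H) - {{}})" by (auto simp: Hom_cells_def)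
  moreover have "finite (pverts G \<rightarrow>\<^sub>E (Pow (pverts H) - {{}}))" using finG finH by (intro finite_PiE) auto
  ultimately show "finite (Hom_cells G H)" by (rule finite_subset)
  show "inj_on (\<lambda>\<eta>. Sigma (pverts G) \<eta>) (Hom_cells G H)"
  proof (rule inj_onI)
    fix \<eta> \<xi> assume "\<eta> \<in> Hom_cells G H" "\<xi> \<in> Hom_cells G H" and eq: "Sigma (pverts G) \<eta> = Sigma (pverts G) \<xi>"
    then have "\<eta> \<in> pverts G \<rightarrow>\<^sub>E (Pow (pverts H) - {{}})" "\<xi> \<in> pverts G \<rightarrow>\<^sub>E (Pow (pverts H) - {{}})"
      by (auto simp: Hom_cells_def)
    then show "\<eta> = \<xi>" by (rule PiE_ext) (use eq in auto)
  qed
  show "Hom_face G \<eta> \<xi> \<longleftrightarrow> Sigma (pverts G) \<eta> \<subseteq> Sigma (pverts G) \<xi>" for \<eta> \<xi>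
    by (auto simp: Hom_face_def)
  fix \<eta> assume "\<eta> \<in> Hom_cells G H"
  then have eta: "\<And>v. v \<in> pverts G \<Longrightarrow> \<eta> v \<subseteq> pverts H \<and> \<eta> v \<noteq> {}" by (auto simp: Hom_cells_def PiE_iff)
  then show "finite (Sigma (pverts G) \<eta>)" using finG finH by (meson finite_SigmaI finite_subset)
  show "Sigma (pverts G) \<eta> \<noteq> {}" using eta V by blast
qed

text \<open>The normalisation is dropped, so only the support matters. Constructions produce such
  weights first and are then rescaled.\<close>

definition hom_weight :: "'a pair_pre_digraph \<Rightarrow> 'b pair_pre_digraph \<Rightarrow> ('a \<times> 'b \<Rightarrow> real) \<Rightarrow> bool" where
  "hom_weight G H y \<longleftrightarrow> (\<forall>e. 0 \<le> y e) \<and>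
     (\<forall>v c. y (v, c) \<noteq> 0 \<longrightarrow> v \<in> pverts G \<and> c \<in> pverts H) \<and>
     (\<forall>v\<in>pverts G. \<exists>c. 0 < y (v, c)) \<and>
     (\<forall>(v, w)\<in>parcs G. \<forall>c d. 0 < y (v, c) \<longrightarrow> 0 < y (w, d) \<longrightarrow> (c, d) \<in> parcs H)"

lemma hom_space_iff_weight:
  "x \<in> hom_space G H \<longleftrightarrow> hom_weight G H x \<and> (\<forall>e. x e \<le> 1) \<and> (\<forall>v\<in>pverts G. \<exists>c. x (v, c) = 1)"
  unfolding hom_space_def hom_weight_def by (auto, (metis zero_less_one)+)

definition peak :: "'b pair_pre_digraph \<Rightarrow> ('a \<times> 'b \<Rightarrow> real) \<Rightarrow> 'a \<Rightarrow> real" where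
  "peak H y v = Max ((\<lambda>c. y (v, c)) ` pverts H)"

text \<open>Every vertex is rescaled by its own maximum, which changes no support and fixes the
  points of \<open>hom_space\<close>.\<close>

definition normalise :: "'b pair_pre_digraph \<Rightarrow> ('a \<times> 'b \<Rightarrow> real) \<Rightarrow> ('a \<times> 'b \<Rightarrow> real)" where
  "normalise H y = (\<lambda>(v, c). y (v, c) / peak H y v)"

context
  fixes G :: "'a pair_pre_digraph" and H :: "'b pair_pre_digraph"
  assumes finH: "finite (pverts H)"
begin

lemma peak_ge: "c \<in> pverts H \<Longrightarrow> y (v, c) \<le> peak H y v"
  unfolding peak_def using finH by (intro Max_ge) auto

lemma peak_pos:
  assumes "hom_weight G H y" "v \<in> pverts G"
  shows "0 < peak H y v"
proof -
  obtain c where c: "0 < y (v, c)" using assms by (auto simp: hom_weight_def)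
  then have "c \<in> pverts H" using assms(1) unfolding hom_weight_def by (metis less_irrefl)
  with c show ?thesis using peak_ge[of c y v] by linarith
qed

lemma peak_attained:
  assumes "hom_weight G H y" "v \<in> pverts G"
  shows "\<exists>c\<in>pverts H. y (v, c) = peak H y v"
proof -
  obtain c where c: "0 < y (v, c)" using assms by (auto simp: hom_weight_def)
  then have "c \<in> pverts H" using assms(1) unfolding hom_weight_def by (metis less_irrefl)
  then have "peak H y v \<in> (\<lambda>c. y (v, c)) ` pverts H"
    unfolding peak_def using finH by (intro Max_in) auto
  then show ?thesis by force
qed

lemma normalise_pos_iff:
  assumes "hom_weight G H y"
  shows "0 < normalise H y (v, c) \<longleftrightarrow> 0 < y (v, c)"
proof (cases "v \<in> pverts G")
  case True
  then show ?thesis using peak_pos[OF assms True] by (simp add: normalise_def zero_less_divide_iff)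
next
  case False
  then have "y (v, c) = 0" using assms unfolding hom_weight_def by blast
  then show ?thesis by (simp add: normalise_def)
qed

lemma normalise_in_hom_space:
  assumes y: "hom_weight G H y"
  shows "normalise H y \<in> hom_space G H"
proof -
  have nn: "0 \<le> normalise H y (v, c)" and le: "normalise H y (v, c) \<le> 1"
    and supp: "normalise H y (v, c) \<noteq> 0 \<Longrightarrow> v \<in> pverts G \<and> c \<in> pverts H" for v c
  proof -
    show "normalise H y (v, c) \<noteq> 0 \<Longrightarrow> v \<in> pverts G \<and> c \<in> pverts H"
      using y by (auto simp: normalise_def hom_weight_def)
    have "0 \<le> normalise H y (v, c) \<and> normalise H y (v, c) \<le> 1"
    proof (cases "v \<in> pverts G \<and> c \<in> pverts H")
      case True
      then show ?thesis
        using peak_pos[OF y, of v] peak_ge[of c y v] y by (simp add: normalise_def hom_weight_def)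
    next
      case False
      then have "y (v, c) = 0" using y unfolding hom_weight_def by blast
      then show ?thesis by (simp add: normalise_def)
    qed
    then show "0 \<le> normalise H y (v, c)" "normalise H y (v, c) \<le> 1" by auto
  qed
  have one: "\<exists>c. normalise H y (v, c) = 1" if v: "v \<in> pverts G" for v
  proof -
    obtain c where c: "y (v, c) = peak H y v" using peak_attained[OF y v] by blast
    then show ?thesis using peak_pos[OF y v] by (intro exI[of _ c]) (simp add: normalise_def)
  qed
  have "\<forall>(v, w)\<in>parcs G. \<forall>c d. 0 < normalise H y (v, c) \<longrightarrow> 0 < normalise H y (w, d) \<longrightarrow> (c, d) \<in> parcs H"
    using y unfolding normalise_pos_iff[OF y] hom_weight_def by blast
  with nn le supp one show ?thesis unfolding hom_space_def by auto
qed

lemma normalise_hom_space: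
  assumes x: "x \<in> hom_space G H"
  shows "normalise H x = x"
proof
  fix e :: "'a \<times> 'b"
  obtain v c where e: "e = (v, c)" by (cases e)
  show "normalise H x e = x e"
  proof (cases "v \<in> pverts G")
    case True
    then obtain d where d: "x (v, d) = 1" using x by (auto simp: hom_space_def)
    then have "d \<in> pverts H" using x unfolding hom_space_def by (metis (mono_tags, lifting) mem_Collect_eq zero_neq_one)
    then have "1 \<le> peak H x v" using peak_ge[of d x v] d by simp
    moreover have "peak H x v \<le> 1"
    proof -
      have "hom_weight G H x" using x by (simp add: hom_space_iff_weight)
      then obtain c where "x (v, c) = peak H x v" using peak_attained True by blast
      then show ?thesis using x by (metis hom_space_iff_weight)
    qed
    ultimately show ?thesis by (simp add: e normalise_def)
  next
    case False
    then have "x (v, c) = 0" using x unfolding hom_space_def by blast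
    then show ?thesis by (simp add: e normalise_def)
  qed
qed

lemma continuous_on_normalise:
  fixes f :: "'t::topological_space \<Rightarrow> 'a \<times> 'b \<Rightarrow> real"
  assumes f: "\<And>e. continuous_on A (\<lambda>t. f t e)" and w: "\<And>t. t \<in> A \<Longrightarrow> hom_weight G H (f t)"
  shows "continuous_on A (\<lambda>t. normalise H (f t))"
proof (rule continuous_on_coordinatewise_then_product)
  fix e :: "'a \<times> 'b"
  obtain v c where e: "e = (v, c)" by (cases e)
  show "continuous_on A (\<lambda>t. normalise H (f t) e)"
  proof (cases "A = {} \<or> v \<notin> pverts G")
    case True
    then have "normalise H (f t) e = 0" if "t \<in> A" for t
      using w[OF that] that unfolding e normalise_def hom_weight_def by auto
    then show ?thesis by (simp cong: continuous_on_cong)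
  next
    case False
    then obtain t where "t \<in> A" "v \<in> pverts G" by blast
    then have "pverts H \<noteq> {}" using peak_attained[OF w] by blast
    then have "continuous_on A (\<lambda>t. peak H (f t) v)"
      unfolding peak_def using finH f by (intro continuous_on_Max) auto
    moreover have "peak H (f t) v \<noteq> 0" if "t \<in> A" for t using peak_pos[OF w[OF that], of v] False by simp
    ultimately show ?thesis unfolding e normalise_def using f by (auto intro!: continuous_intros)
  qed
qed

text \<open>
  The straight-line homotopy, rescaled so as to stay in \<^term>\<open>hom_space G H\<close>.
\<close>
lemma contiguous_imp_homotopic:
  fixes f g :: "'t::topological_space \<Rightarrow> 'a \<times> 'b \<Rightarrow> real"
  assumes f: "continuous_on A f" "\<And>t. t \<in> A \<Longrightarrow> f t \<in> hom_space G H"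
    and g: "continuous_on A g" "\<And>t. t \<in> A \<Longrightarrow> g t \<in> hom_space G H"
    and w: "\<And>t. t \<in> A \<Longrightarrow> hom_weight G H (\<lambda>e. f t e + g t e)"
  shows "homotopic_with_canon (\<lambda>_. True) A (hom_space G H) f g"
proof -
  define h where "h = (\<lambda>(s, t) e. (1 - s) * f t e + s * g t e)"
  have nn: "0 \<le> f t e" "0 \<le> g t e" if "t \<in> A" for t e
    using f(2)[OF that] g(2)[OF that] unfolding hom_space_def by blast+
  have hw: "hom_weight G H (h z)" if z: "z \<in> {0..1} \<times> A" for z
  proof -
    obtain s t where st: "z = (s, t)" "0 \<le> s" "s \<le> 1" "t \<in> A" using z by auto
    have le: "0 \<le> h z e" for e using st nn by (simp add: h_def)
    have pos: "0 < f t e + g t e" if "h z e \<noteq> 0" for e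
    proof (rule ccontr)
      assume "\<not> ?thesis"
      then have "f t e = 0" "g t e = 0" using nn[OF st(4), of e] by linarith+
      then show False using that st by (simp add: h_def)
    qed
    have "\<exists>c. 0 < h z (v, c)" if v: "v \<in> pverts G" for v
    proof (cases "s = 1")
      case True
      obtain c where "g t (v, c) = 1" using g(2)[OF st(4)] v by (auto simp: hom_space_def)
      then show ?thesis using st True by (intro exI[of _ c]) (simp add: h_def)
    next
      case False
      obtain c where "f t (v, c) = 1" using f(2)[OF st(4)] v by (auto simp: hom_space_def)
      then show ?thesis using st False nn(2)[OF st(4), of "(v, c)"]
        by (intro exI[of _ c]) (simp add: h_def add_pos_nonneg)
    qed
    moreover have "v \<in> pverts G \<and> c \<in> pverts H" if "h z (v, c) \<noteq> 0" for v c
      using pos[OF that] w[OF st(4)] unfolding hom_weight_def by (metis less_irrefl)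
    moreover have "(c, d) \<in> parcs H" if "(v, w) \<in> parcs G" "0 < h z (v, c)" "0 < h z (w, d)" for v w c d
    proof -
      have "0 < f t (v, c) + g t (v, c)" "0 < f t (w, d) + g t (w, d)" using pos that by auto
      then show ?thesis using w[OF st(4)] that(1) unfolding hom_weight_def by blast
    qed
    ultimately show ?thesis using le unfolding hom_weight_def by blast
  qed
  have c2: "continuous_on ({0..1} \<times> A) (\<lambda>z. k (snd z) e)" if "continuous_on A k"
    for k :: "'t \<Rightarrow> 'a \<times> 'b \<Rightarrow> real" and e
    by (rule continuous_on_compose2[OF continuous_on_product_then_coordinatewise[OF that] continuous_on_snd[OF continuous_on_id]]) auto
  have hc: "continuous_on ({0..1} \<times> A) (\<lambda>z. h z e)" for e
    unfolding h_def case_prod_beta by (intro continuous_intros c2 f g)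
  show ?thesis
  proof (subst homotopic_with, simp, intro exI[of _ "\<lambda>z. normalise H (h z)"] conjI ballI)
    show "continuous_map (prod_topology (top_of_set {0..1}) (top_of_set A)) (top_of_set (hom_space G H))
        (\<lambda>z. normalise H (h z))"
      using continuous_on_normalise[OF hc hw] normalise_in_hom_space[OF hw] by auto
    fix t assume "t \<in> topspace (top_of_set A)"
    then have t: "t \<in> A" by simp
    show "normalise H (h (0, t)) = f t" "normalise H (h (1, t)) = g t"
      using normalise_hom_space[OF f(2)[OF t]] normalise_hom_space[OF g(2)[OF t]] by (simp_all add: h_def)
  qed simp
qed

end

text \<open>
  Coordinates on \<^term>\<open>hom_space (cat_product (complete_graph 2) (complete_graph n)) (complete_graph m)\<close>:
  the weight of the colour \<open>c\<close> at the vertex \<open>(1, i)\<close> is \<open>a i c\<close>, at \<open>(2, i)\<close> it is \<open>b i c\<close>.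
\<close>
definition two_sided :: "nat \<Rightarrow> nat \<Rightarrow> (nat \<Rightarrow> nat \<Rightarrow> real) \<Rightarrow> (nat \<Rightarrow> nat \<Rightarrow> real) \<Rightarrow> (nat \<times> nat) \<times> nat \<Rightarrow> real" where
  "two_sided n m a b = (\<lambda>((p, i), c). if i \<in> {1..n} \<and> c \<in> {1..m} then
     if p = 1 then a i c else if p = 2 then b i c else 0 else 0)"

abbreviation K2K :: "nat \<Rightarrow> (nat \<times> nat) pair_pre_digraph" where
  "K2K n \<equiv> cat_product (complete_graph 2) (complete_graph n)"

abbreviation K2K_space :: "nat \<Rightarrow> nat \<Rightarrow> ((nat \<times> nat) \<times> nat \<Rightarrow> real) set" where
  "K2K_space n m \<equiv> hom_space (K2K n) (complete_graph m)"

section \<open>Points of \<open>K2K_space\<close> as pairs of weight families\<close>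

lemma finite_complete_graph: "finite (pverts (complete_graph m))"
  by (simp add: complete_graph_def)

text \<open>Adjacent vertices lie on different sides and have different indices. As the target is
  complete without loops, an edge only forbids a common colour, and both orientations of it give the
  same condition.\<close>

lemma hom_weight_K2K_iff:
  "hom_weight (K2K n) (complete_graph m) y \<longleftrightarrow> (\<forall>e. 0 \<le> y e) \<and>
     (\<forall>p i c. y ((p, i), c) \<noteq> 0 \<longrightarrow> (p = 1 \<or> p = 2) \<and> i \<in> {1..n} \<and> c \<in> {1..m}) \<and>
     (\<forall>i\<in>{1..n}. (\<exists>c. 0 < y ((1, i), c)) \<and> (\<exists>c. 0 < y ((2, i), c))) \<and>
     (\<forall>i\<in>{1..n}. \<forall>j\<in>{1..n}. \<forall>c. i \<noteq> j \<longrightarrow> \<not> (0 < y ((1, i), c) \<and> 0 < y ((2, j), c)))"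
  (is "?L \<longleftrightarrow> ?nn \<and> ?su \<and> ?ex \<and> ?di")
proof
  have V: "pverts (K2K n) = {1, 2} \<times> {1..n}" "pverts (complete_graph m) = {1..m}"
    by (auto simp: cat_product_def complete_graph_def)
  have E: "((p, i), (q, j)) \<in> parcs (K2K n) \<longleftrightarrow> p \<in> {1, 2} \<and> q \<in> {1, 2} \<and> p \<noteq> q \<and> i \<in> {1..n} \<and> j \<in> {1..n} \<and> i \<noteq> j" for p q i j
    by (auto simp: cat_product_def complete_graph_def)
  have EH: "(c, d) \<in> parcs (complete_graph m) \<longleftrightarrow> c \<in> {1..m} \<and> d \<in> {1..m} \<and> c \<noteq> d" for c d
    by (auto simp: complete_graph_def)
  {
    assume L: ?L
    then have nn: ?nn and ex: "\<And>v. v \<in> {1, 2} \<times> {1..n} \<Longrightarrow> \<exists>c. 0 < y (v, c)"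
      and su: "\<And>v c. y (v, c) \<noteq> 0 \<Longrightarrow> v \<in> {1, 2} \<times> {1..n} \<and> c \<in> {1..m}"
      and ar: "\<And>v w c d. (v, w) \<in> parcs (K2K n) \<Longrightarrow> 0 < y (v, c) \<Longrightarrow> 0 < y (w, d) \<Longrightarrow> (c, d) \<in> parcs (complete_graph m)"
      unfolding hom_weight_def V by blast+
    have ?su using su by fastforce
    moreover have ?ex using ex by simp
    moreover have ?di
    proof (intro ballI allI impI notI)
      fix i j c assume "i \<in> {1..n}" "j \<in> {1..n}" "i \<noteq> j" "0 < y ((1, i), c) \<and> 0 < y ((2, j), c)"
      then have "(c, c) \<in> parcs (complete_graph m)" using ar[of "(1, i)" "(2, j)" c c] unfolding E by simp
      then show False unfolding EH by simp
    qed
    ultimately show "?nn \<and> ?su \<and> ?ex \<and> ?di" using nn by blast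
  }
  {
    assume R: "?nn \<and> ?su \<and> ?ex \<and> ?di"
    then have nn: ?nn and su: ?su and ex: ?ex and di: ?di by blast+
    have "(c, d) \<in> parcs (complete_graph m)"
      if "(v, w) \<in> parcs (K2K n)" "0 < y (v, c)" "0 < y (w, d)" for v w c d
    proof -
      obtain p i q j where vw: "v = (p, i)" "w = (q, j)" by fastforce
      have e: "p \<in> {1, 2}" "q \<in> {1, 2}" "p \<noteq> q" "i \<in> {1..n}" "j \<in> {1..n}" "i \<noteq> j" using that(1) unfolding vw E by auto
      have cd: "c \<in> {1..m}" "d \<in> {1..m}" using su that unfolding vw by (metis less_irrefl)+
      have "c \<noteq> d"
      proof
        assume "c = d"
        have "p = 1 \<and> q = 2 \<or> p = 2 \<and> q = 1" using e by auto
        then show False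
        proof (elim disjE conjE)
          assume "p = 1" "q = 2"
          then show False using di[rule_format, OF e(4,5,6), of c] that(2,3) \<open>c = d\<close> unfolding vw by simp
        next
          assume "p = 2" "q = 1"
          then show False using di[rule_format, OF e(5,4) e(6)[symmetric], of c] that(2,3) \<open>c = d\<close> unfolding vw by simp
        qed
      qed
      then show ?thesis using cd unfolding EH by simp
    qed
    moreover have "\<forall>v\<in>{1, 2} \<times> {1..n}. \<exists>c. 0 < y (v, c)" using ex by auto
    moreover have "\<forall>v c. y (v, c) \<noteq> 0 \<longrightarrow> v \<in> {1, 2} \<times> {1..n} \<and> c \<in> {1..m}" using su by auto
    ultimately show ?L using nn unfolding hom_weight_def V by blast
  }
qed

lemma two_sided_simps [simp]:
  "i \<in> {1..n} \<Longrightarrow> c \<in> {1..m} \<Longrightarrow> two_sided n m a b ((1, i), c) = a i c"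
  "i \<in> {1..n} \<Longrightarrow> c \<in> {1..m} \<Longrightarrow> two_sided n m a b ((Suc 0, i), c) = a i c"
  "i \<in> {1..n} \<Longrightarrow> c \<in> {1..m} \<Longrightarrow> two_sided n m a b ((2, i), c) = b i c"
  "i \<notin> {1..n} \<or> c \<notin> {1..m} \<Longrightarrow> two_sided n m a b ((p, i), c) = 0"
  by (auto simp: two_sided_def)

lemma two_sided_eta:
  assumes "\<And>p i c. x ((p, i), c) \<noteq> 0 \<Longrightarrow> (p = 1 \<or> p = 2) \<and> i \<in> {1..n} \<and> c \<in> {1..m}"
  shows "x = two_sided n m (\<lambda>i c. x ((1, i), c)) (\<lambda>i c. x ((2, i), c))"
proof
  fix e :: "(nat \<times> nat) \<times> nat"
  obtain p i c where e: "e = ((p, i), c)" by (metis prod.exhaust)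
  show "x e = two_sided n m (\<lambda>i c. x ((1, i), c)) (\<lambda>i c. x ((2, i), c)) e"
    using assms[of p i c] by (auto simp: e two_sided_def)
qed

lemma two_sided_add: "two_sided n m a b e + two_sided n m a' b' e =
    two_sided n m (\<lambda>i c. a i c + a' i c) (\<lambda>i c. b i c + b' i c) e"
  by (auto simp: two_sided_def split: prod.splits)

definition two_sided_weight :: "nat \<Rightarrow> nat \<Rightarrow> (nat \<Rightarrow> nat \<Rightarrow> real) \<Rightarrow> (nat \<Rightarrow> nat \<Rightarrow> real) \<Rightarrow> bool" where
  "two_sided_weight n m a b \<longleftrightarrow>
     (\<forall>i\<in>{1..n}. \<forall>c\<in>{1..m}. 0 \<le> a i c \<and> 0 \<le> b i c) \<and>
     (\<forall>i\<in>{1..n}. (\<exists>c\<in>{1..m}. 0 < a i c) \<and> (\<exists>c\<in>{1..m}. 0 < b i c)) \<and>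
     (\<forall>i\<in>{1..n}. \<forall>j\<in>{1..n}. \<forall>c\<in>{1..m}. i \<noteq> j \<longrightarrow> \<not> (0 < a i c \<and> 0 < b j c))"

lemma hom_weight_two_sided:
  "hom_weight (K2K n) (complete_graph m) (two_sided n m a b) \<longleftrightarrow> two_sided_weight n m a b"
proof -
  let ?y = "two_sided n m a b"
  have c: "c \<in> {1..m}" if "0 < ?y ((p, i), c)" for p i c
    using that by (auto simp: two_sided_def split: if_splits)
  show ?thesis
  proof
    assume L: "hom_weight (K2K n) (complete_graph m) ?y"
    then have nn: "\<And>e. 0 \<le> ?y e"
      and ex: "\<And>i. i \<in> {1..n} \<Longrightarrow> (\<exists>c. 0 < ?y ((1, i), c)) \<and> (\<exists>c. 0 < ?y ((2, i), c))"
      and di: "\<And>i j c. i \<in> {1..n} \<Longrightarrow> j \<in> {1..n} \<Longrightarrow> i \<noteq> j \<Longrightarrow> \<not> (0 < ?y ((1, i), c) \<and> 0 < ?y ((2, j), c))"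
      unfolding hom_weight_K2K_iff by blast+
    show "two_sided_weight n m a b"
      unfolding two_sided_weight_def
    proof (intro conjI ballI impI)
      fix i c assume ic: "i \<in> {1..n}" "c \<in> {1..m}"
      show "0 \<le> a i c" "0 \<le> b i c" using nn[of "((1, i), c)"] nn[of "((2, i), c)"] ic by simp_all
    next
      fix i assume i: "i \<in> {1..n}"
      show "\<exists>c\<in>{1..m}. 0 < a i c" "\<exists>c\<in>{1..m}. 0 < b i c"
        using ex[OF i] c i by (metis two_sided_simps(1), metis two_sided_simps(3))
    next
      fix i j c assume "i \<in> {1..n}" "j \<in> {1..n}" "c \<in> {1..m}" "i \<noteq> j"
      then show "\<not> (0 < a i c \<and> 0 < b j c)" using di[of i j c] by simp
    qed
  next
    assume R: "two_sided_weight n m a b"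
    show "hom_weight (K2K n) (complete_graph m) ?y"
      unfolding hom_weight_K2K_iff
    proof (intro conjI ballI allI impI)
      fix e show "0 \<le> ?y e" using R by (auto simp: two_sided_def two_sided_weight_def split: prod.splits)
    next
      fix p i c assume nz: "?y ((p, i), c) \<noteq> 0"
      then show "p = 1 \<or> p = 2" "i \<in> {1..n}" "c \<in> {1..m}"
        by (auto simp: two_sided_def split: if_splits)
    next
      fix i assume i: "i \<in> {1..n}"
      then obtain c d where "c \<in> {1..m}" "0 < a i c" "d \<in> {1..m}" "0 < b i d"
        using R unfolding two_sided_weight_def by blast
      then show "\<exists>c. 0 < ?y ((1, i), c)" "\<exists>c. 0 < ?y ((2, i), c)" using i two_sided_simps(1,3) by metis+
    next
      fix i j c assume ij: "i \<in> {1..n}" "j \<in> {1..n}" "i \<noteq> j"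
      show "\<not> (0 < ?y ((1, i), c) \<and> 0 < ?y ((2, j), c))"
      proof
        assume pos: "0 < ?y ((1, i), c) \<and> 0 < ?y ((2, j), c)"
        then have "c \<in> {1..m}" using c by blast
        then have "0 < a i c" "0 < b j c" using pos ij by simp_all
        then show False using R ij \<open>c \<in> {1..m}\<close> unfolding two_sided_weight_def by blast
      qed
    qed
  qed
qed

lemma two_sided_in_space_iff:
  "two_sided n m a b \<in> K2K_space n m \<longleftrightarrow> two_sided_weight n m a b \<and>
     (\<forall>i\<in>{1..n}. \<forall>c\<in>{1..m}. a i c \<le> 1 \<and> b i c \<le> 1) \<and>
     (\<forall>i\<in>{1..n}. (\<exists>c\<in>{1..m}. a i c = 1) \<and> (\<exists>c\<in>{1..m}. b i c = 1))"
proof -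
  let ?y = "two_sided n m a b"
  have V: "pverts (K2K n) = {1, 2} \<times> {1..n}" by (auto simp: cat_product_def complete_graph_def)
  have c: "c \<in> {1..m}" if "?y ((p, i), c) = 1" for p i c
    using that by (auto simp: two_sided_def split: if_splits)
  have 1: "(\<forall>e. ?y e \<le> 1) \<longleftrightarrow> (\<forall>i\<in>{1..n}. \<forall>c\<in>{1..m}. a i c \<le> 1 \<and> b i c \<le> 1)" (is "?l \<longleftrightarrow> ?r")
  proof
    assume l: ?l
    show ?r
    proof (intro ballI)
      fix i c assume "i \<in> {1..n}" "c \<in> {1..m}"
      then show "a i c \<le> 1 \<and> b i c \<le> 1" using l[rule_format, of "((1, i), c)"] l[rule_format, of "((2, i), c)"] by simp
    qed
  qed (auto simp: two_sided_def split: prod.splits)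
  have 2: "(\<forall>v\<in>{1, 2} \<times> {1..n}. \<exists>c. ?y (v, c) = 1) \<longleftrightarrow>
      (\<forall>i\<in>{1..n}. (\<exists>c\<in>{1..m}. a i c = 1) \<and> (\<exists>c\<in>{1..m}. b i c = 1))" (is "?l \<longleftrightarrow> ?r")
  proof
    assume l: ?l
    show ?r
    proof
      fix i assume i: "i \<in> {1..n}"
      obtain c d where "?y ((1, i), c) = 1" "?y ((2, i), d) = 1" using l i by blast
      then show "(\<exists>c\<in>{1..m}. a i c = 1) \<and> (\<exists>c\<in>{1..m}. b i c = 1)"
        using c[of 1 i c] c[of 2 i d] i by (intro conjI bexI[of _ c] bexI[of _ d]) simp_all
    qed
  next
    assume r: ?r
    have "(\<exists>c. ?y ((1, i), c) = 1) \<and> (\<exists>c. ?y ((2, i), c) = 1)" if "i \<in> {1..n}" for i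
      using r that two_sided_simps(1,3)[OF that] by metis
    then show ?l by auto
  qed
  show ?thesis unfolding hom_space_iff_weight hom_weight_two_sided V 1 2 by blast
qed

lemma space_two_sided_cases:
  assumes "x \<in> K2K_space n m"
  obtains a b where "x = two_sided n m a b" "a = (\<lambda>i c. x ((1, i), c))" "b = (\<lambda>i c. x ((2, i), c))"
    "two_sided_weight n m a b" "\<And>i c. a i c \<le> 1" "\<And>i c. b i c \<le> 1"
    "\<And>i. i \<in> {1..n} \<Longrightarrow> \<exists>c\<in>{1..m}. a i c = 1" "\<And>i. i \<in> {1..n} \<Longrightarrow> \<exists>c\<in>{1..m}. b i c = 1"
proof -
  have w: "hom_weight (K2K n) (complete_graph m) x" and le: "\<And>e. x e \<le> 1" using assms by (auto simp: hom_space_iff_weight)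
  have e: "x = two_sided n m (\<lambda>i c. x ((1, i), c)) (\<lambda>i c. x ((2, i), c))"
    using w unfolding hom_weight_K2K_iff by (intro two_sided_eta) blast
  with assms have "two_sided n m (\<lambda>i c. x ((1, i), c)) (\<lambda>i c. x ((2, i), c)) \<in> K2K_space n m" by simp
  then show ?thesis unfolding two_sided_in_space_iff
    by (intro that[OF e refl refl]) (use le in auto)
qed

lemma continuous_on_two_sided:
  assumes "\<And>i c. continuous_on A (\<lambda>x. a x i c)" "\<And>i c. continuous_on A (\<lambda>x. b x i c)"
  shows "continuous_on A (\<lambda>x. two_sided n m (a x) (b x) e)"
proof -
  obtain p i c where e: "e = ((p, i), c)" by (metis prod.exhaust)
  show ?thesis unfolding e two_sided_def prod.case
  proof (cases "i \<in> {1..n} \<and> c \<in> {1..m}")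
    case True
    show "continuous_on A (\<lambda>x. if i \<in> {1..n} \<and> c \<in> {1..m} then
        if p = 1 then a x i c else if p = 2 then b x i c else 0 else 0)"
      unfolding if_P[OF True] using assms by (cases "p = 1"; cases "p = 2") simp_all
  next
    case False
    show "continuous_on A (\<lambda>x. if i \<in> {1..n} \<and> c \<in> {1..m} then
        if p = 1 then a x i c else if p = 2 then b x i c else 0 else 0)"
      unfolding if_not_P[OF False] by simp
  qed
qed

section \<open>Fewer colours than vertices\<close>

text \<open>Otherwise choose a colour \<open>s i\<close> of \<open>a i\<close>; it is used by some
  \<open>b j\<close>, and disjointness forces \<open>j = i\<close>. Then \<open>s i = s j\<close>
  gives \<open>i = j\<close>, and \<open>n\<close> indices inject into \<open>m\<close>
  colours.\<close>

lemma one_sided_colour_exists: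
  fixes a b :: "nat \<Rightarrow> nat \<Rightarrow> real"
  assumes mn: "m < n"
    and a: "\<And>i. i \<in> {1..n} \<Longrightarrow> \<exists>c\<in>{1..m}. 0 < a i c"
    and b: "\<And>i c. i \<in> {1..n} \<Longrightarrow> c \<in> {1..m} \<Longrightarrow> 0 \<le> b i c"
    and disj: "\<And>i j c. i \<in> {1..n} \<Longrightarrow> j \<in> {1..n} \<Longrightarrow> c \<in> {1..m} \<Longrightarrow> i \<noteq> j \<Longrightarrow> \<not> (0 < a i c \<and> 0 < b j c)"
  shows "\<exists>c\<in>{1..m}. (\<exists>i\<in>{1..n}. 0 < a i c) \<and> (\<forall>j\<in>{1..n}. b j c = 0)"
proof (rule ccontr)
  assume no: "\<not> ?thesis"
  obtain s where s: "\<And>i. i \<in> {1..n} \<Longrightarrow> s i \<in> {1..m} \<and> 0 < a i (s i)" using a by metis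
  have bs: "0 < b i (s i)" if i: "i \<in> {1..n}" for i
  proof -
    obtain j where j: "j \<in> {1..n}" "b j (s i) \<noteq> 0" using no s[OF i] i by blast
    then have "0 < b j (s i)" using b[of j "s i"] s[OF i] by auto
    then show ?thesis using disj[of i j "s i"] i j(1) s[OF i] by blast
  qed
  have "inj_on s {1..n}"
  proof (rule inj_onI)
    fix i j assume "i \<in> {1..n}" "j \<in> {1..n}" "s i = s j"
    then show "i = j" using disj[of i j "s i"] s[of i] bs[of j] by auto
  qed
  then have "card {1..n} \<le> card {1..m}" using s by (intro card_inj_on_le) auto
  then show False using mn by simp
qed

text \<open>The factor 2 serves two purposes: no colour is positive for both sides, and positivity
  is strong enough for \<open>net_pos_imp_thin\<close>.\<close>

definition net :: "nat \<Rightarrow> (nat \<Rightarrow> nat \<Rightarrow> real) \<Rightarrow> (nat \<Rightarrow> nat \<Rightarrow> real) \<Rightarrow> nat \<Rightarrow> real" where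
  "net n a b c = max 0 ((\<Sum>i\<in>{1..n}. a i c) - 2 * (\<Sum>i\<in>{1..n}. b i c))"

lemma net_nonneg: "0 \<le> net n a b c"
  by (simp add: net_def)

lemma net_exclusive:
  assumes "two_sided_weight n m a b" "c \<in> {1..m}"
  shows "\<not> (0 < net n a b c \<and> 0 < net n b a c)"
proof -
  have "0 \<le> (\<Sum>i\<in>{1..n}. a i c)" "0 \<le> (\<Sum>i\<in>{1..n}. b i c)"
    using assms by (auto simp: two_sided_weight_def intro!: sum_nonneg)
  then have "(\<Sum>i\<in>{1..n}. a i c) \<le> 2 * (\<Sum>i\<in>{1..n}. b i c) \<or> (\<Sum>i\<in>{1..n}. b i c) \<le> 2 * (\<Sum>i\<in>{1..n}. a i c)"
    by linarith
  then show ?thesis by (auto simp: net_def)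
qed

lemma two_sided_weight_swapD: "two_sided_weight n m a b \<Longrightarrow> two_sided_weight n m b a"
  unfolding two_sided_weight_def
proof (elim conjE, intro conjI)
  assume di: "\<forall>i\<in>{1..n}. \<forall>j\<in>{1..n}. \<forall>c\<in>{1..m}. i \<noteq> j \<longrightarrow> \<not> (0 < a i c \<and> 0 < b j c)"
  show "\<forall>i\<in>{1..n}. \<forall>j\<in>{1..n}. \<forall>c\<in>{1..m}. i \<noteq> j \<longrightarrow> \<not> (0 < b i c \<and> 0 < a j c)"
    using di by metis
qed auto

lemma net_pos_exists:
  assumes w: "two_sided_weight n m a b" and mn: "m < n"
  shows "\<exists>c\<in>{1..m}. 0 < net n a b c"
proof -
  have nn: "\<And>i c. i \<in> {1..n} \<Longrightarrow> c \<in> {1..m} \<Longrightarrow> 0 \<le> a i c \<and> 0 \<le> b i c"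
    using w by (auto simp: two_sided_weight_def)
  have "\<exists>c\<in>{1..m}. (\<exists>i\<in>{1..n}. 0 < a i c) \<and> (\<forall>j\<in>{1..n}. b j c = 0)"
  proof (rule one_sided_colour_exists[OF mn])
    show "\<exists>c\<in>{1..m}. 0 < a i c" if "i \<in> {1..n}" for i
      using w that unfolding two_sided_weight_def by blast
    show "\<not> (0 < a i c \<and> 0 < b j c)" if "i \<in> {1..n}" "j \<in> {1..n}" "c \<in> {1..m}" "i \<noteq> j" for i j c
      using w that unfolding two_sided_weight_def by blast
  qed (use nn in blast)
  then obtain c i where c: "c \<in> {1..m}" "i \<in> {1..n}" "0 < a i c" "\<forall>j\<in>{1..n}. b j c = 0" by blast
  then have "0 < (\<Sum>i\<in>{1..n}. a i c)" using nn by (intro sum_pos2[of _ i]) auto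
  then show ?thesis using c by (intro bexI[of _ c]) (auto simp: net_def)
qed

text \<open>If \<open>b j c\<close> is positive, only \<open>a j\<close> can use \<open>c\<close> on
  the first side, so positivity of \<open>net\<close> says that \<open>a j c\<close> exceeds twice
  the sum of all \<open>b i c\<close>.\<close>

lemma net_pos_imp_thin:
  assumes w: "two_sided_weight n m a b" and c: "c \<in> {1..m}" and j: "j \<in> {1..n}"
    and pos: "0 < net n a b c"
  shows "2 * b j c - a j c \<le> 0"
proof (rule ccontr)
  assume no: "\<not> ?thesis"
  have nn: "\<And>i. i \<in> {1..n} \<Longrightarrow> 0 \<le> a i c \<and> 0 \<le> b i c" using w c by (auto simp: two_sided_weight_def)
  have "0 < b j c" using no nn[OF j] by linarith
  then have z: "a i c = 0" if "i \<in> {1..n} - {j}" for i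
    using that w c j nn[of i] unfolding two_sided_weight_def by (metis DiffE antisym_conv1 singletonI)
  have "(\<Sum>i\<in>{1..n}. a i c) = a j c + (\<Sum>i\<in>{1..n} - {j}. a i c)" using j by (simp add: sum.remove)
  also have "(\<Sum>i\<in>{1..n} - {j}. a i c) = 0" using z by (intro sum.neutral) auto
  finally have "(\<Sum>i\<in>{1..n}. a i c) = a j c" by simp
  moreover have "b j c \<le> (\<Sum>i\<in>{1..n}. b i c)" using nn j by (intro member_le_sum) auto
  ultimately show False using pos no by (simp add: net_def split: if_splits)
qed

definition thin :: "(nat \<Rightarrow> nat \<Rightarrow> real) \<Rightarrow> (nat \<Rightarrow> nat \<Rightarrow> real) \<Rightarrow> nat \<Rightarrow> nat \<Rightarrow> real" where
  "thin a b i c = max 0 (2 * a i c - b i c)"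

lemma zero_sum_signs:
  fixes u :: "'a \<Rightarrow> real"
  assumes "finite U" "(\<Sum>c\<in>U. u c) = 0" "c0 \<in> U" "u c0 \<noteq> 0"
  shows "(\<exists>c\<in>U. 0 < u c) \<and> (\<exists>c\<in>U. u c < 0)"
proof (rule ccontr)
  assume "\<not> ?thesis"
  then consider "\<forall>c\<in>U. u c \<le> 0" | "\<forall>c\<in>U. 0 \<le> u c" by force
  then show False
  proof cases
    case 1
    then have "\<forall>c\<in>U. - u c = 0" using assms sum_nonneg_eq_0_iff[of U "\<lambda>c. - u c"] by (simp add: sum_negf)
    then show False using assms by simp
  next
    case 2
    then show False using assms sum_nonneg_eq_0_iff[of U u] by auto
  qed
qed

locale few_colours =
  fixes n m :: nat
  assumes m2: "2 \<le> m" and mn: "m < n"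
begin

abbreviation side1 :: "((nat \<times> nat) \<times> nat \<Rightarrow> real) \<Rightarrow> nat \<Rightarrow> nat \<Rightarrow> real" where
  "side1 x \<equiv> (\<lambda>i c. x ((1, i), c))"

abbreviation side2 :: "((nat \<times> nat) \<times> nat \<Rightarrow> real) \<Rightarrow> nat \<Rightarrow> nat \<Rightarrow> real" where
  "side2 x \<equiv> (\<lambda>i c. x ((2, i), c))"

text \<open>Each side is divided by its own total, so the entries over all colours sum to 0.\<close>

definition balance :: "((nat \<times> nat) \<times> nat \<Rightarrow> real) \<Rightarrow> nat \<Rightarrow> real" where
  "balance x c = net n (side1 x) (side2 x) c / (\<Sum>d\<in>{1..m}. net n (side1 x) (side2 x) d)
     - net n (side2 x) (side1 x) c / (\<Sum>d\<in>{1..m}. net n (side2 x) (side1 x) d)"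

text \<open>Subtracting the last entry maps the hyperplane of zero sum isomorphically onto the space
  with coordinates \<open>0, ..., m - 2\<close>, those of \<open>nsphere (m - 2)\<close>.\<close>

definition to_sphere_weight :: "((nat \<times> nat) \<times> nat \<Rightarrow> real) \<Rightarrow> nat \<Rightarrow> real" where
  "to_sphere_weight x = (\<lambda>l. if l \<le> m - 2 then balance x (l + 1) - balance x m else 0)"

definition to_sphere :: "((nat \<times> nat) \<times> nat \<Rightarrow> real) \<Rightarrow> nat \<Rightarrow> real" where
  "to_sphere x = radial (m - 2) (to_sphere_weight x)"

text \<open>The inverse of that isomorphism: colour \<open>c\<close> takes entry
  \<open>c - 1\<close>, the last one being 0 on the sphere, and the mean is removed.\<close>

definition centred :: "(nat \<Rightarrow> real) \<Rightarrow> nat \<Rightarrow> real" where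
  "centred y c = y (c - 1) - (\<Sum>d\<in>{1..m}. y (d - 1)) / m"

definition from_sphere_weight :: "(nat \<Rightarrow> real) \<Rightarrow> (nat \<times> nat) \<times> nat \<Rightarrow> real" where
  "from_sphere_weight y = two_sided n m (\<lambda>_ c. max 0 (centred y c)) (\<lambda>_ c. max 0 (- centred y c))"

definition from_sphere :: "(nat \<Rightarrow> real) \<Rightarrow> (nat \<times> nat) \<times> nat \<Rightarrow> real" where
  "from_sphere y = normalise (complete_graph m) (from_sphere_weight y)"

lemma side_weight: "x \<in> K2K_space n m \<Longrightarrow> two_sided_weight n m (side1 x) (side2 x)"
  by (rule space_two_sided_cases) auto

lemma net_sum_pos:
  assumes x: "x \<in> K2K_space n m"
  shows "0 < (\<Sum>d\<in>{1..m}. net n (side1 x) (side2 x) d)" "0 < (\<Sum>d\<in>{1..m}. net n (side2 x) (side1 x) d)"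
proof -
  note w = side_weight[OF x]
  obtain c where "c \<in> {1..m}" "0 < net n (side1 x) (side2 x) c" using net_pos_exists[OF w mn] by blast
  then show "0 < (\<Sum>d\<in>{1..m}. net n (side1 x) (side2 x) d)" by (intro sum_pos2[of _ c]) (auto simp: net_nonneg)
  obtain c where "c \<in> {1..m}" "0 < net n (side2 x) (side1 x) c"
    using net_pos_exists[OF two_sided_weight_swapD[OF w] mn] by blast
  then show "0 < (\<Sum>d\<in>{1..m}. net n (side2 x) (side1 x) d)" by (intro sum_pos2[of _ c]) (auto simp: net_nonneg)
qed

lemma balance_sign:
  assumes x: "x \<in> K2K_space n m" and c: "c \<in> {1..m}"
  shows "0 < balance x c \<longleftrightarrow> 0 < net n (side1 x) (side2 x) c"
    "balance x c < 0 \<longleftrightarrow> 0 < net n (side2 x) (side1 x) c"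
proof -
  let ?p = "net n (side1 x) (side2 x) c" and ?q = "net n (side2 x) (side1 x) c"
  have ex: "\<not> (0 < ?p \<and> 0 < ?q)" by (rule net_exclusive[OF side_weight[OF x] c])
  have "0 \<le> ?p" "0 \<le> ?q" by (rule net_nonneg)+
  with ex consider "?p = 0" | "?q = 0" by linarith
  then show "0 < balance x c \<longleftrightarrow> 0 < ?p" "balance x c < 0 \<longleftrightarrow> 0 < ?q"
    using net_sum_pos[OF x] \<open>0 \<le> ?p\<close> \<open>0 \<le> ?q\<close>
    by (cases; simp add: balance_def zero_less_divide_iff divide_less_0_iff)+
qed

lemma balance_sum: "x \<in> K2K_space n m \<Longrightarrow> (\<Sum>c\<in>{1..m}. balance x c) = 0"
  using net_sum_pos[of x] by (simp add: balance_def sum_subtractf sum_divide_distrib[symmetric])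

lemma to_sphere_weight_nonzero:
  assumes x: "x \<in> K2K_space n m"
  shows "\<exists>l\<le>m - 2. to_sphere_weight x l \<noteq> 0"
proof (rule ccontr)
  assume no: "\<not> ?thesis"
  have eq: "balance x c = balance x m" if c: "c \<in> {1..m}" for c
  proof (cases "c = m")
    case False
    then have "c - 1 \<le> m - 2" "c - 1 + 1 = c" using c by auto
    then show ?thesis using no by (auto simp: to_sphere_weight_def)
  qed simp
  have "(\<Sum>c\<in>{1..m}. balance x c) = (\<Sum>c\<in>{1..m}. balance x m)" by (intro sum.cong refl eq)
  then have "(\<Sum>c\<in>{1..m}. balance x c) = m * balance x m" by simp
  then have "balance x m = 0" using balance_sum[OF x] m2 by simp
  moreover obtain c where "c \<in> {1..m}" "0 < net n (side1 x) (side2 x) c"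
    using net_pos_exists[OF side_weight[OF x] mn] by blast
  ultimately show False using balance_sign(1)[OF x] eq by force
qed

lemma to_sphere_in: "x \<in> K2K_space n m \<Longrightarrow> to_sphere x \<in> topspace (nsphere (m - 2))"
  unfolding to_sphere_def
  by (rule radial_in_nsphere[OF to_sphere_weight_nonzero]) (auto simp: to_sphere_weight_def)

lemma continuous_to_sphere: "continuous_on (K2K_space n m) to_sphere"
proof -
  have net: "continuous_on (K2K_space n m) (\<lambda>x. net n (a x) (b x) c)"
    if "\<And>i. continuous_on (K2K_space n m) (\<lambda>x. a x i c)" "\<And>i. continuous_on (K2K_space n m) (\<lambda>x. b x i c)"
    for a b :: "((nat \<times> nat) \<times> nat \<Rightarrow> real) \<Rightarrow> nat \<Rightarrow> nat \<Rightarrow> real" and c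
    unfolding net_def by (intro continuous_intros that)
  have "continuous_on (K2K_space n m) (\<lambda>x. balance x c)" for c
    unfolding balance_def
    by (intro continuous_intros net continuous_on_coordinate) (metis less_irrefl net_sum_pos)+
  then have "continuous_on (K2K_space n m) (\<lambda>x. to_sphere_weight x l)" for l
    unfolding to_sphere_weight_def by (cases "l \<le> m - 2") (auto intro!: continuous_intros)
  then show ?thesis
    unfolding to_sphere_def using to_sphere_weight_nonzero by (intro continuous_on_radial) auto
qed

lemma centred_sum: "(\<Sum>c\<in>{1..m}. centred y c) = 0"
  using m2 by (simp add: centred_def sum_subtractf)

lemma centred_nonzero:
  assumes y: "y \<in> topspace (nsphere (m - 2))"
  shows "\<exists>c\<in>{1..m}. centred y c \<noteq> 0"
proof (rule ccontr)
  assume no: "\<not> ?thesis"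
  obtain l where l: "l \<le> m - 2" "y l \<noteq> 0" using nsphere_nonzero[OF y] by blast
  have "centred y m = 0" "centred y (l + 1) = 0" using no l m2 by auto
  moreover have "y (m - 1) = 0" using y m2 by (simp add: topspace_nsphere)
  ultimately show False using l by (simp add: centred_def)
qed

lemma from_sphere_weight:
  assumes y: "y \<in> topspace (nsphere (m - 2))"
  shows "hom_weight (K2K n) (complete_graph m) (from_sphere_weight y)"
proof -
  obtain c where "c \<in> {1..m}" "centred y c \<noteq> 0" using centred_nonzero[OF y] by blast
  then obtain c d where "c \<in> {1..m}" "0 < centred y c" "d \<in> {1..m}" "centred y d < 0"
    using zero_sum_signs[OF _ centred_sum] by blast
  then have "\<exists>c\<in>{1..m}. 0 < max 0 (centred y c)" "\<exists>c\<in>{1..m}. 0 < max 0 (- centred y c)"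
  proof -
    show "\<exists>c\<in>{1..m}. 0 < max 0 (centred y c)" using \<open>c \<in> {1..m}\<close> \<open>0 < centred y c\<close> by force
    show "\<exists>c\<in>{1..m}. 0 < max 0 (- centred y c)" using \<open>d \<in> {1..m}\<close> \<open>centred y d < 0\<close> by force
  qed
  then show ?thesis unfolding from_sphere_weight_def hom_weight_two_sided two_sided_weight_def
    by (intro conjI ballI impI) auto
qed

lemma from_sphere_in: "y \<in> topspace (nsphere (m - 2)) \<Longrightarrow> from_sphere y \<in> K2K_space n m"
  unfolding from_sphere_def
  by (rule normalise_in_hom_space[OF finite_complete_graph from_sphere_weight])

lemma continuous_from_sphere: "continuous_on (topspace (nsphere (m - 2))) from_sphere"
  unfolding from_sphere_def
proof (rule continuous_on_normalise[OF finite_complete_graph _ from_sphere_weight])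
  show "continuous_on (topspace (nsphere (m - 2))) (\<lambda>y. from_sphere_weight y e)" for e
    unfolding from_sphere_weight_def centred_def using m2
    by (intro continuous_on_two_sided continuous_intros continuous_on_coordinate) auto
qed

text \<open>The two sides of \<open>from_sphere y\<close> use disjoint colours, so
  \<open>net\<close> returns the weights multiplied by \<open>n\<close>. The peaks \<open>M1\<close>
  and \<open>M2\<close> cancel in \<open>balance\<close>, which leaves \<open>centred y\<close>
  divided by \<open>T\<close>; the radial projection removes this factor.\<close>

lemma to_from_sphere:
  assumes y: "y \<in> topspace (nsphere (m - 2))"
  shows "to_sphere (from_sphere y) = y"
proof -
  let ?u = "centred y" and ?x = "from_sphere y"
  define M1 where "M1 = Max ((\<lambda>c. max 0 (?u c)) ` {1..m})"
  define M2 where "M2 = Max ((\<lambda>c. max 0 (- ?u c)) ` {1..m})"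
  have N: "1 \<in> {1..n}" using mn m2 by auto
  have pk: "peak (complete_graph m) (from_sphere_weight y) (1, i) = M1"
    "peak (complete_graph m) (from_sphere_weight y) (2, i) = M2" if "i \<in> {1..n}" for i
    using that by (auto simp: peak_def M1_def M2_def complete_graph_def from_sphere_weight_def intro!: arg_cong[of _ _ Max] image_cong)
  have M: "0 < M1" "0 < M2"
    using peak_pos[OF finite_complete_graph from_sphere_weight[OF y], of "(1, 1)"]
      peak_pos[OF finite_complete_graph from_sphere_weight[OF y], of "(2, 1)"] pk[OF N] N
    by (auto simp: cat_product_def complete_graph_def)
  have sd: "side1 ?x i c = max 0 (?u c) / M1" "side2 ?x i c = max 0 (- ?u c) / M2" if "i \<in> {1..n}" "c \<in> {1..m}" for i c
    using that pk by (simp_all add: from_sphere_def normalise_def from_sphere_weight_def)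
  have n0: "0 < real n" using mn by simp
  have nt: "net n (side1 ?x) (side2 ?x) c = n / M1 * max 0 (?u c)"
    "net n (side2 ?x) (side1 ?x) c = n / M2 * max 0 (- ?u c)" if c: "c \<in> {1..m}" for c
  proof -
    have s: "(\<Sum>i\<in>{1..n}. side1 ?x i c) = n * (max 0 (?u c) / M1)"
      "(\<Sum>i\<in>{1..n}. side2 ?x i c) = n * (max 0 (- ?u c) / M2)"
      using sd[OF _ c] by simp_all
    have pq: "max 0 (p - 2 * q) = p" if "0 \<le> p" "0 \<le> q" "p = 0 \<or> q = 0" for p q :: real
      using that by auto
    have "max 0 (?u c) = 0 \<or> max 0 (- ?u c) = 0" by linarith
    then have "n * (max 0 (?u c) / M1) = 0 \<or> n * (max 0 (- ?u c) / M2) = 0" by auto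
    moreover have "0 \<le> n * (max 0 (?u c) / M1)" "0 \<le> n * (max 0 (- ?u c) / M2)" using M n0 by simp_all
    ultimately have "net n (side1 ?x) (side2 ?x) c = n * (max 0 (?u c) / M1)"
      "net n (side2 ?x) (side1 ?x) c = n * (max 0 (- ?u c) / M2)"
      unfolding net_def s by (intro pq; blast)+
    then show "net n (side1 ?x) (side2 ?x) c = n / M1 * max 0 (?u c)"
      "net n (side2 ?x) (side1 ?x) c = n / M2 * max 0 (- ?u c)" by simp_all
  qed
  define T where "T = (\<Sum>c\<in>{1..m}. max 0 (?u c))"
  have T2: "(\<Sum>c\<in>{1..m}. max 0 (- ?u c)) = T"
  proof -
    have "max 0 (?u c) - max 0 (- ?u c) = ?u c" for c by (simp add: max_def)
    then have "T - (\<Sum>c\<in>{1..m}. max 0 (- ?u c)) = (\<Sum>c\<in>{1..m}. ?u c)" unfolding T_def sum_subtractf[symmetric] by simp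
    then show ?thesis using centred_sum by simp
  qed
  have T: "0 < T"
  proof -
    obtain c where "c \<in> {1..m}" "?u c \<noteq> 0" using centred_nonzero[OF y] by blast
    then obtain c where "c \<in> {1..m}" "0 < ?u c" using zero_sum_signs[OF _ centred_sum] by blast
    then show ?thesis unfolding T_def by (intro sum_pos2[of _ c]) auto
  qed
  have bal: "balance ?x c = ?u c / T" if c: "c \<in> {1..m}" for c
  proof -
    have S: "(\<Sum>d\<in>{1..m}. net n (side1 ?x) (side2 ?x) d) = n / M1 * T"
      "(\<Sum>d\<in>{1..m}. net n (side2 ?x) (side1 ?x) d) = n / M2 * T"
    proof -
      have "(\<Sum>d\<in>{1..m}. net n (side1 ?x) (side2 ?x) d) = (\<Sum>d\<in>{1..m}. n / M1 * max 0 (?u d))"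
        by (intro sum.cong refl nt)
      then show "(\<Sum>d\<in>{1..m}. net n (side1 ?x) (side2 ?x) d) = n / M1 * T"
        unfolding T_def sum_distrib_left .
      have "(\<Sum>d\<in>{1..m}. net n (side2 ?x) (side1 ?x) d) = (\<Sum>d\<in>{1..m}. n / M2 * max 0 (- ?u d))"
        by (intro sum.cong refl nt)
      then show "(\<Sum>d\<in>{1..m}. net n (side2 ?x) (side1 ?x) d) = n / M2 * T"
        unfolding T2[symmetric] sum_distrib_left .
    qed
    have "balance ?x c = max 0 (?u c) / T - max 0 (- ?u c) / T"
      unfolding balance_def S nt[OF c] using M n0 by simp
    also have "\<dots> = ?u c / T" by (simp add: max_def)
    finally show ?thesis .
  qed
  have z: "y (m - 1) = 0" using y m2 by (simp add: topspace_nsphere)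
  have "to_sphere_weight ?x l = 1 / T * y l" for l
  proof (cases "l \<le> m - 2")
    case True
    then have "l + 1 \<in> {1..m}" "m \<in> {1..m}" using m2 by auto
    then have "to_sphere_weight ?x l = (?u (l + 1) - ?u m) / T"
      using True bal by (simp add: to_sphere_weight_def diff_divide_distrib)
    also have "?u (l + 1) - ?u m = y l" using z by (simp add: centred_def)
    finally show ?thesis by simp
  next
    case False
    then show ?thesis using y by (simp add: to_sphere_weight_def topspace_nsphere)
  qed
  then have "to_sphere_weight ?x = (\<lambda>l. 1 / T * y l)" by blast
  then have "to_sphere ?x = radial (m - 2) (\<lambda>l. 1 / T * y l)" by (simp only: to_sphere_def)
  also have "\<dots> = y" using radial_scale[of "1 / T" "m - 2" y] radial_nsphere[OF y] T by simp
  finally show ?thesis .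
qed

text \<open>The radial projection only scales, so the signs of \<open>centred\<close> on the image
  are those of \<open>balance\<close>, hence given by \<open>net\<close>.\<close>

lemma centred_to_sphere:
  assumes x: "x \<in> K2K_space n m"
  shows "\<exists>r>0. \<forall>c\<in>{1..m}. centred (to_sphere x) c = r * balance x c"
proof -
  define r where "r = 1 / sqrt (\<Sum>l\<le>m - 2. (to_sphere_weight x l)\<^sup>2)"
  have r: "0 < r" unfolding r_def using sum_squares_pos[OF to_sphere_weight_nonzero[OF x]] by simp
  have t: "to_sphere x (c - 1) = r * (balance x c - balance x m)" if c: "c \<in> {1..m}" for c
  proof (cases "c = m")
    case True
    then show ?thesis using m2 by (simp add: to_sphere_def radial_def to_sphere_weight_def)
  next
    case False
    then have "c - 1 \<le> m - 2" "c - 1 + 1 = c" using c by auto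
    then show ?thesis by (simp add: to_sphere_def radial_def to_sphere_weight_def r_def)
  qed
  have "(\<Sum>d\<in>{1..m}. to_sphere x (d - 1)) = (\<Sum>d\<in>{1..m}. r * (balance x d - balance x m))"
    using t by (intro sum.cong) auto
  also have "\<dots> = r * ((\<Sum>d\<in>{1..m}. balance x d) - m * balance x m)"
    by (simp add: sum_distrib_left[symmetric] sum_subtractf)
  finally have "(\<Sum>d\<in>{1..m}. to_sphere x (d - 1)) / m = - (r * balance x m)"
    using balance_sum[OF x] m2 by simp
  then have "centred (to_sphere x) c = r * balance x c" if "c \<in> {1..m}" for c
    using t[OF that] by (simp add: centred_def algebra_simps)
  with r show ?thesis by blast
qed

text \<open>The supports of \<open>x\<close> and of its image need not unite to a cell, since a
  colour of positive \<open>net\<close> may still be used by a vertex of the other side. The thinned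
  point \<open>h x\<close> forms a cell with both of them.\<close>

lemma from_to_sphere:
  "homotopic_with_canon (\<lambda>_. True) (K2K_space n m) (K2K_space n m) (from_sphere \<circ> to_sphere) id"
proof -
  let ?X = "K2K_space n m" and ?H = "complete_graph m"
  define thin_weight where "thin_weight x = two_sided n m (thin (side1 x) (side2 x)) (thin (side2 x) (side1 x))" for x
  define h where "h x = normalise ?H (thin_weight x)" for x
  have tw: "hom_weight (K2K n) ?H (thin_weight x)" if x: "x \<in> ?X" for x
  proof (rule space_two_sided_cases[OF x])
    fix a b assume ab: "a = side1 x" "b = side2 x" and w: "two_sided_weight n m a b"
      and le: "\<And>i c. a i c \<le> 1" "\<And>i c. b i c \<le> 1"
      and one: "\<And>i. i \<in> {1..n} \<Longrightarrow> \<exists>c\<in>{1..m}. a i c = 1" "\<And>i. i \<in> {1..n} \<Longrightarrow> \<exists>c\<in>{1..m}. b i c = 1"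
    have nn: "\<And>i c. i \<in> {1..n} \<Longrightarrow> c \<in> {1..m} \<Longrightarrow> 0 \<le> a i c \<and> 0 \<le> b i c"
      and di: "\<And>i j c. i \<in> {1..n} \<Longrightarrow> j \<in> {1..n} \<Longrightarrow> c \<in> {1..m} \<Longrightarrow> i \<noteq> j \<Longrightarrow> \<not> (0 < a i c \<and> 0 < b j c)"
      using w unfolding two_sided_weight_def by blast+
    have "\<exists>c\<in>{1..m}. 0 < thin a b i c" "\<exists>c\<in>{1..m}. 0 < thin b a i c" if i: "i \<in> {1..n}" for i
    proof -
      \<comment> \<open>A colour of weight 1 survives thinning, because the subtracted weight is at
        most 1.\<close>
      obtain c d where "c \<in> {1..m}" "a i c = 1" "d \<in> {1..m}" "b i d = 1" using one i by blast
      moreover from calculation have "0 < thin a b i c" "0 < thin b a i d"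
        using le(2)[of i c] le(1)[of i d] by (auto simp: thin_def)
      ultimately show "\<exists>c\<in>{1..m}. 0 < thin a b i c" "\<exists>c\<in>{1..m}. 0 < thin b a i c" by blast+
    qed
    moreover have "\<not> (0 < thin a b i c \<and> 0 < thin b a j c)"
      if "i \<in> {1..n}" "j \<in> {1..n}" "c \<in> {1..m}" "i \<noteq> j" for i j c
    proof -
      have "0 < a i c" if "0 < thin a b i c" using that nn[of i c] \<open>i \<in> {1..n}\<close> \<open>c \<in> {1..m}\<close> by (auto simp: thin_def)
      moreover have "0 < b j c" if "0 < thin b a j c" using that nn[of j c] \<open>j \<in> {1..n}\<close> \<open>c \<in> {1..m}\<close> by (auto simp: thin_def)
      ultimately show ?thesis using di[OF that] by blast
    qed
    ultimately show ?thesis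
      unfolding thin_weight_def hom_weight_two_sided two_sided_weight_def ab[symmetric]
      by (auto simp: thin_def)
  qed
  have hin: "h x \<in> ?X" if "x \<in> ?X" for x
    unfolding h_def by (rule normalise_in_hom_space[OF finite_complete_graph tw[OF that]])
  have hc: "continuous_on ?X h"
    unfolding h_def
  proof (rule continuous_on_normalise[OF finite_complete_graph _ tw])
    show "continuous_on ?X (\<lambda>x. thin_weight x e)" for e
      unfolding thin_weight_def thin_def
      by (intro continuous_on_two_sided continuous_intros continuous_on_coordinate)
  qed
  have hpos: "0 < h x (v, c) \<longleftrightarrow> 0 < thin_weight x (v, c)" if "x \<in> ?X" for x v c
    unfolding h_def by (rule normalise_pos_iff[OF finite_complete_graph tw[OF that]])
  have qin: "from_sphere (to_sphere x) \<in> ?X" if "x \<in> ?X" for x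
    using from_sphere_in[OF to_sphere_in[OF that]] .
  have qpos: "0 < from_sphere (to_sphere x) (v, c) \<longleftrightarrow> 0 < from_sphere_weight (to_sphere x) (v, c)"
    if "x \<in> ?X" for x v c
    unfolding from_sphere_def
    by (rule normalise_pos_iff[OF finite_complete_graph from_sphere_weight[OF to_sphere_in[OF that]]])
  \<comment> \<open>Each summand is disjoint across the sides by itself, so only the mixed pairs
    remain to be checked.\<close>
  have sum_weight: "hom_weight (K2K n) ?H (\<lambda>e. x e + y e)"
    if x: "x \<in> ?X" and y: "y \<in> ?X"
      and 1: "\<And>i j c. i \<in> {1..n} \<Longrightarrow> j \<in> {1..n} \<Longrightarrow> c \<in> {1..m} \<Longrightarrow> i \<noteq> j \<Longrightarrow> \<not> (0 < x ((1, i), c) \<and> 0 < y ((2, j), c))"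
      and 2: "\<And>i j c. i \<in> {1..n} \<Longrightarrow> j \<in> {1..n} \<Longrightarrow> c \<in> {1..m} \<Longrightarrow> i \<noteq> j \<Longrightarrow> \<not> (0 < y ((1, i), c) \<and> 0 < x ((2, j), c))"
    for x y
  proof -
    obtain a b where ab: "x = two_sided n m a b" "a = side1 x" "b = side2 x" "two_sided_weight n m a b"
      by (rule space_two_sided_cases[OF x]) (rule that)
    obtain a' b' where ab': "y = two_sided n m a' b'" "a' = side1 y" "b' = side2 y" "two_sided_weight n m a' b'"
      by (rule space_two_sided_cases[OF y]) (rule that)
    have nn: "\<And>i c. i \<in> {1..n} \<Longrightarrow> c \<in> {1..m} \<Longrightarrow> 0 \<le> a i c \<and> 0 \<le> b i c \<and> 0 \<le> a' i c \<and> 0 \<le> b' i c"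
      using ab(4) ab'(4) unfolding two_sided_weight_def by blast
    have "two_sided_weight n m (\<lambda>i c. a i c + a' i c) (\<lambda>i c. b i c + b' i c)"
      unfolding two_sided_weight_def
    proof (intro conjI ballI impI notI)
      fix i assume i: "i \<in> {1..n}"
      obtain c d where "c \<in> {1..m}" "0 < a i c" "d \<in> {1..m}" "0 < b i d" using ab(4) i unfolding two_sided_weight_def by blast
      moreover from calculation have "0 < a i c + a' i c" "0 < b i d + b' i d"
        using nn[OF i, of c] nn[OF i, of d] by simp_all
      ultimately show "\<exists>c\<in>{1..m}. 0 < a i c + a' i c" "\<exists>c\<in>{1..m}. 0 < b i c + b' i c" by blast+
    next
      fix i j c assume ij: "i \<in> {1..n}" "j \<in> {1..n}" "c \<in> {1..m}" "i \<noteq> j"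
        and p: "0 < a i c + a' i c \<and> 0 < b j c + b' j c"
      have "0 < a i c \<or> 0 < a' i c" "0 < b j c \<or> 0 < b' j c" using p nn ij by (smt (verit))+
      moreover have "\<not> (0 < a i c \<and> 0 < b j c)" "\<not> (0 < a' i c \<and> 0 < b' j c)"
        using ab(4) ab'(4) ij unfolding two_sided_weight_def by blast+
      moreover have "\<not> (0 < a i c \<and> 0 < b' j c)" "\<not> (0 < a' i c \<and> 0 < b j c)"
        using 1[OF ij] 2[OF ij] ab(2,3) ab'(2,3) by auto
      ultimately show False by blast
    qed (use nn in auto)
    then have "hom_weight (K2K n) ?H (two_sided n m (\<lambda>i c. a i c + a' i c) (\<lambda>i c. b i c + b' i c))"
      unfolding hom_weight_two_sided .
    moreover have "two_sided n m (\<lambda>i c. a i c + a' i c) (\<lambda>i c. b i c + b' i c) = (\<lambda>e. x e + y e)"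
      unfolding ab(1) ab'(1) by (rule ext) (simp only: two_sided_add ab(2,3) ab'(2,3))
    ultimately show ?thesis by simp
  qed
  have thin_pos: "0 < side1 x i c \<and> 0 < 2 * side1 x i c - side2 x i c" if "x \<in> ?X" "i \<in> {1..n}" "c \<in> {1..m}" "0 < h x ((1, i), c)" for x i c
  proof -
    have "0 < thin (side1 x) (side2 x) i c"
      using that hpos[OF that(1), of "(1, i)" c] by (simp add: thin_weight_def)
    moreover have "0 \<le> side2 x i c" using side_weight[OF that(1)] that(2,3) unfolding two_sided_weight_def by blast
    ultimately show ?thesis by (simp add: thin_def less_max_iff_disj)
  qed
  have thin_pos': "0 < side2 x i c \<and> 0 < 2 * side2 x i c - side1 x i c" if "x \<in> ?X" "i \<in> {1..n}" "c \<in> {1..m}" "0 < h x ((2, i), c)" for x i c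
  proof -
    have "0 < thin (side2 x) (side1 x) i c"
      using that hpos[OF that(1), of "(2, i)" c] by (simp add: thin_weight_def)
    moreover have "0 \<le> side1 x i c" using side_weight[OF that(1)] that(2,3) unfolding two_sided_weight_def by blast
    ultimately show ?thesis by (simp add: thin_def less_max_iff_disj)
  qed
  have net_pos: "0 < net n (side1 x) (side2 x) c" if "x \<in> ?X" "i \<in> {1..n}" "c \<in> {1..m}" "0 < from_sphere (to_sphere x) ((1, i), c)" for x i c
  proof -
    have "\<exists>r>0. centred (to_sphere x) c = r * balance x c" using centred_to_sphere[OF that(1)] that(3) by blast
    then obtain r where r: "0 < r" "centred (to_sphere x) c = r * balance x c" by blast
    have "0 < centred (to_sphere x) c" using that qpos[OF that(1), of "(1, i)" c] by (simp add: from_sphere_weight_def)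
    then show ?thesis using r balance_sign(1)[OF that(1,3)] by (simp add: zero_less_mult_iff)
  qed
  have net_pos': "0 < net n (side2 x) (side1 x) c" if "x \<in> ?X" "i \<in> {1..n}" "c \<in> {1..m}" "0 < from_sphere (to_sphere x) ((2, i), c)" for x i c
  proof -
    have "\<exists>r>0. centred (to_sphere x) c = r * balance x c" using centred_to_sphere[OF that(1)] that(3) by blast
    then obtain r where r: "0 < r" "centred (to_sphere x) c = r * balance x c" by blast
    have "centred (to_sphere x) c < 0" using that qpos[OF that(1), of "(2, i)" c] by (simp add: from_sphere_weight_def)
    then show ?thesis using r balance_sign(2)[OF that(1,3)] by (simp add: mult_less_0_iff)
  qed
  have "homotopic_with_canon (\<lambda>_. True) ?X ?X h id"
  proof (rule contiguous_imp_homotopic[OF finite_complete_graph hc hin])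
    fix x assume x: "x \<in> ?X"
    have di: "\<And>i j c. i \<in> {1..n} \<Longrightarrow> j \<in> {1..n} \<Longrightarrow> c \<in> {1..m} \<Longrightarrow> i \<noteq> j \<Longrightarrow> \<not> (0 < side1 x i c \<and> 0 < side2 x j c)"
      using side_weight[OF x] unfolding two_sided_weight_def by blast
    show "hom_weight (K2K n) ?H (\<lambda>e. h x e + id x e)"
      unfolding id_apply using thin_pos[OF x] thin_pos'[OF x] di by (intro sum_weight hin x) blast+
  qed auto
  moreover have "homotopic_with_canon (\<lambda>_. True) ?X ?X (from_sphere \<circ> to_sphere) h"
  proof (rule contiguous_imp_homotopic[OF finite_complete_graph _ _ hc hin])
    show "continuous_on ?X (from_sphere \<circ> to_sphere)"
      using continuous_to_sphere to_sphere_in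
      by (intro continuous_on_compose continuous_on_subset[OF continuous_from_sphere]) auto
    fix x assume x: "x \<in> ?X"
    show "(from_sphere \<circ> to_sphere) x \<in> ?X" using qin[OF x] by simp
    show "hom_weight (K2K n) ?H (\<lambda>e. (from_sphere \<circ> to_sphere) x e + h x e)"
      unfolding o_apply
    proof (rule sum_weight[OF qin[OF x] hin[OF x]]; intro notI; elim conjE)
      fix i j c assume ij: "i \<in> {1..n}" "j \<in> {1..n}" "c \<in> {1..m}" "i \<noteq> j"
      {
        assume "0 < from_sphere (to_sphere x) ((1, i), c)" "0 < h x ((2, j), c)"
        then show False
          using net_pos_imp_thin[OF side_weight[OF x] ij(3,2) net_pos[OF x ij(1,3)]] thin_pos'[OF x ij(2,3)] by simp
      next
        assume "0 < h x ((1, i), c)" "0 < from_sphere (to_sphere x) ((2, j), c)"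
        then show False
          using net_pos_imp_thin[OF two_sided_weight_swapD[OF side_weight[OF x]] ij(3,1) net_pos'[OF x ij(2,3)]]
            thin_pos[OF x ij(1,3)] by simp
      }
    qed
  qed
  ultimately show ?thesis by (meson homotopic_with_trans)
qed

lemma space_homotopy_equivalent_nsphere:
  "top_of_set (K2K_space n m) homotopy_equivalent_space nsphere (m - 2)"
  unfolding homotopy_equivalent_space_def
proof (intro exI conjI)
  have t: "top_of_set (topspace (nsphere (m - 2))) = nsphere (m - 2)"
    by (simp add: nsphere_top_of_set)
  show "continuous_map (top_of_set (K2K_space n m)) (nsphere (m - 2)) to_sphere"
    using continuous_to_sphere to_sphere_in by (subst t[symmetric]) auto
  show "continuous_map (nsphere (m - 2)) (top_of_set (K2K_space n m)) from_sphere"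
    using continuous_from_sphere from_sphere_in by (subst t[symmetric]) auto
  show "homotopic_with (\<lambda>_. True) (top_of_set (K2K_space n m)) (top_of_set (K2K_space n m)) (from_sphere \<circ> to_sphere) id"
    by (rule from_to_sphere)
  show "homotopic_with (\<lambda>_. True) (nsphere (m - 2)) (nsphere (m - 2)) (to_sphere \<circ> from_sphere) id"
    by (rule homotopic_with_id2) (rule to_from_sphere)
qed

end

section \<open>At least as many colours as vertices\<close>

lemma conn_Hom_K2K:
  assumes "1 \<le> n"
  shows "conn (Hom_complex (K2K n) (complete_graph m)) = conn (top_of_set (K2K_space n m))"
proof (intro conn_homotopy_equivalent homeomorphic_imp_homotopy_equivalent_space Hom_complex_homeomorphic_hom_space)
  show "finite (pverts (K2K n))" "finite (pverts (complete_graph m))" "pverts (K2K n) \<noteq> {}"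
    "parcs (K2K n) \<subseteq> pverts (K2K n) \<times> pverts (K2K n)"
    using assms by (auto simp: cat_product_def complete_graph_def)
qed

section \<open>Points with a single colour at each vertex, and paths moving one side\<close>

definition delta :: "nat \<Rightarrow> nat \<Rightarrow> real" where
  "delta c d = (if d = c then 1 else 0)"

lemma delta_simps [simp]: "delta c c = 1" "0 < delta c d \<longleftrightarrow> d = c" "delta c d = 1 \<longleftrightarrow> d = c"
  "delta c d = 0 \<longleftrightarrow> d \<noteq> c" "0 \<le> delta c d" "delta c d \<le> 1"
  by (auto simp: delta_def)

lemma delta_in_space:
  assumes "\<And>i. i \<in> {1..n} \<Longrightarrow> f i \<in> {1..m} \<and> g i \<in> {1..m}"
    and "\<And>i j. i \<in> {1..n} \<Longrightarrow> j \<in> {1..n} \<Longrightarrow> i \<noteq> j \<Longrightarrow> f i \<noteq> g j"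
  shows "two_sided n m (\<lambda>i. delta (f i)) (\<lambda>i. delta (g i)) \<in> K2K_space n m"
  unfolding two_sided_in_space_iff two_sided_weight_def using assms by auto

lemma two_sided_swap_in_space:
  assumes "two_sided n m a b \<in> K2K_space n m"
  shows "two_sided n m b a \<in> K2K_space n m"
proof -
  have di: "\<forall>i\<in>{1..n}. \<forall>j\<in>{1..n}. \<forall>c\<in>{1..m}. i \<noteq> j \<longrightarrow> \<not> (0 < a i c \<and> 0 < b j c)"
    using assms unfolding two_sided_in_space_iff two_sided_weight_def by blast
  have "\<forall>i\<in>{1..n}. \<forall>j\<in>{1..n}. \<forall>c\<in>{1..m}. i \<noteq> j \<longrightarrow> \<not> (0 < b i c \<and> 0 < a j c)" using di by metis
  then show ?thesis using assms unfolding two_sided_in_space_iff two_sided_weight_def by simp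
qed

text \<open>The new weight grows to full size during the first half and the old one fades during the
  second. One of them is at full size at any time, so the maximum stays 1 without rescaling.\<close>

definition ridge :: "real \<Rightarrow> (nat \<Rightarrow> nat \<Rightarrow> real) \<Rightarrow> (nat \<Rightarrow> nat \<Rightarrow> real) \<Rightarrow> nat \<Rightarrow> nat \<Rightarrow> real" where
  "ridge t a a' i c = max (min 1 (2 - 2 * t) * a i c) (min 1 (2 * t) * a' i c)"

lemma ridge_in_space:
  assumes x: "two_sided n m a b \<in> K2K_space n m" and y: "two_sided n m a' b \<in> K2K_space n m" and t: "t \<in> {0..1}"
  shows "two_sided n m (ridge t a a') b \<in> K2K_space n m"
proof -
  have nn: "0 \<le> a i c" "0 \<le> a' i c" "a i c \<le> 1" "a' i c \<le> 1" if "i \<in> {1..n}" "c \<in> {1..m}" for i c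
    using x y that unfolding two_sided_in_space_iff two_sided_weight_def by blast+
  let ?p = "min 1 (2 - 2 * t)" and ?q = "min 1 (2 * t)"
  have pq: "0 \<le> ?p" "?p \<le> 1" "0 \<le> ?q" "?q \<le> 1" using t by auto
  have pos: "0 < a i c \<or> 0 < a' i c" if "i \<in> {1..n}" "c \<in> {1..m}" "0 < ridge t a a' i c" for i c
    using that nn[OF that(1,2)] pq unfolding ridge_def less_max_iff_disj zero_less_mult_iff by linarith
  have le: "ridge t a a' i c \<le> 1" if "i \<in> {1..n}" "c \<in> {1..m}" for i c
    using nn[OF that] pq unfolding ridge_def by (simp add: mult_le_one)
  have ge: "0 \<le> ridge t a a' i c" if "i \<in> {1..n}" "c \<in> {1..m}" for i c
    using nn[OF that] pq unfolding ridge_def by (simp add: le_max_iff_disj)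
  have one: "\<exists>c\<in>{1..m}. ridge t a a' i c = 1" if i: "i \<in> {1..n}" for i
  proof (cases "t \<le> 1/2")
    case True
    obtain c where c: "c \<in> {1..m}" "a i c = 1" using x i unfolding two_sided_in_space_iff by blast
    have "1 \<le> ridge t a a' i c" using c True by (simp add: ridge_def)
    then show ?thesis using le[OF i c(1)] c(1) by force
  next
    case False
    obtain c where c: "c \<in> {1..m}" "a' i c = 1" using y i unfolding two_sided_in_space_iff by blast
    have "1 \<le> ridge t a a' i c" using c False by (simp add: ridge_def)
    then show ?thesis using le[OF i c(1)] c(1) by force
  qed
  have "\<exists>c\<in>{1..m}. 0 < ridge t a a' i c" if "i \<in> {1..n}" for i using one[OF that] by force
  moreover have "\<not> (0 < ridge t a a' i c \<and> 0 < b j c)"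
    if "i \<in> {1..n}" "j \<in> {1..n}" "c \<in> {1..m}" "i \<noteq> j" for i j c
    using pos[OF that(1,3)] x y that unfolding two_sided_in_space_iff two_sided_weight_def by blast
  ultimately show ?thesis
    using x le ge one unfolding two_sided_in_space_iff two_sided_weight_def by simp
qed

lemma continuous_on_ridge: "continuous_on A (\<lambda>t. ridge t a a' i c)"
  unfolding ridge_def by (intro continuous_intros)

lemma slide_first:
  fixes n m :: nat and a a' b :: "nat \<Rightarrow> nat \<Rightarrow> real"
  assumes x: "two_sided n m a b \<in> K2K_space n m" and y: "two_sided n m a' b \<in> K2K_space n m"
    and nn: "\<And>i c. 0 \<le> a i c" "\<And>i c. 0 \<le> a' i c"
  defines "g \<equiv> \<lambda>t. two_sided n m (ridge t a a') b"
  shows "path g" "path_image g \<subseteq> K2K_space n m" "pathstart g = two_sided n m a b" "pathfinish g = two_sided n m a' b"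
proof -
  show "path g" unfolding path_def g_def
    by (intro continuous_on_coordinatewise_then_product continuous_on_two_sided continuous_on_ridge continuous_on_const)
  show "path_image g \<subseteq> K2K_space n m" using ridge_in_space[OF x y] by (auto simp: path_image_def g_def)
  have "ridge 0 a a' = a" "ridge 1 a a' = a'" using nn by (auto simp: ridge_def fun_eq_iff)
  then show "pathstart g = two_sided n m a b" "pathfinish g = two_sided n m a' b"
    by (simp_all add: pathstart_def pathfinish_def g_def)
qed

lemma slide_second:
  fixes n m :: nat and a b b' :: "nat \<Rightarrow> nat \<Rightarrow> real"
  assumes x: "two_sided n m a b \<in> K2K_space n m" and y: "two_sided n m a b' \<in> K2K_space n m"
    and nn: "\<And>i c. 0 \<le> b i c" "\<And>i c. 0 \<le> b' i c"
  defines "g \<equiv> \<lambda>t. two_sided n m a (ridge t b b')"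
  shows "path g" "path_image g \<subseteq> K2K_space n m" "pathstart g = two_sided n m a b" "pathfinish g = two_sided n m a b'"
proof -
  show "path g" unfolding path_def g_def
    by (intro continuous_on_coordinatewise_then_product continuous_on_two_sided continuous_on_ridge continuous_on_const)
  show "path_image g \<subseteq> K2K_space n m"
    using two_sided_swap_in_space[OF ridge_in_space[OF two_sided_swap_in_space[OF x] two_sided_swap_in_space[OF y]]]
    by (auto simp: path_image_def g_def)
  have "ridge 0 b b' = b" "ridge 1 b b' = b'" using nn by (auto simp: ridge_def fun_eq_iff)
  then show "pathstart g = two_sided n m a b" "pathfinish g = two_sided n m a b'"
    by (simp_all add: pathstart_def pathfinish_def g_def)
qed

lemma slide_first_component:
  assumes "two_sided n m a b \<in> K2K_space n m" "two_sided n m a' b \<in> K2K_space n m"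
    and "\<And>i c. 0 \<le> a i c" "\<And>i c. 0 \<le> a' i c"
  shows "path_component (K2K_space n m) (two_sided n m a b) (two_sided n m a' b)"
  unfolding path_component_def using slide_first[OF assms] by blast

lemma slide_second_component:
  assumes "two_sided n m a b \<in> K2K_space n m" "two_sided n m a b' \<in> K2K_space n m"
    and "\<And>i c. 0 \<le> b i c" "\<And>i c. 0 \<le> b' i c"
  shows "path_component (K2K_space n m) (two_sided n m a b) (two_sided n m a b')"
  unfolding path_component_def using slide_second[OF assms] by blast

text \<open>
  With \<open>n\<close> colours, the point that gives both \<open>(1, i)\<close> and \<open>(2, i)\<close> the colour \<open>i\<close> is isolated.
\<close>
lemma not_trivial_pi_0_equal:
  assumes n: "2 \<le> n"
  shows "\<not> trivial_pi 0 (top_of_set (K2K_space n n))"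
proof
  let ?X = "K2K_space n n"
  assume "trivial_pi 0 (top_of_set ?X)"
  then have "connected_space (top_of_set ?X)"
    by (simp add: trivial_pi_def path_connected_imp_connected_space)
  then have "connectedin euclidean ?X" by (simp add: connectedin_def)
  then have con: "connected ?X" by simp
  define x where "x = two_sided n n delta delta"
  define y where "y = two_sided n n (\<lambda>_. delta 1) (\<lambda>_. delta 2)"
  have xX: "x \<in> ?X" unfolding x_def using delta_in_space[of n "\<lambda>i. i" n "\<lambda>i. i"] by simp
  have yX: "y \<in> ?X" unfolding y_def using delta_in_space[of n "\<lambda>_. 1" n "\<lambda>_. 2"] n by simp
  have "x ((1, 2), 1) = 0" "y ((1, 2), 1) = 1" using n by (simp_all add: x_def y_def)
  then have xy: "x \<noteq> y" by auto
  \<comment> \<open>With \<open>n\<close> colours every colour \<open>c\<close> is also an index. On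
    this open set both vertices of index \<open>c\<close> use \<open>c\<close>, which bans
    \<open>c\<close> at all other indices; the maximum 1 then fixes the remaining values.\<close>
  let ?U = "\<Inter>i\<in>{1..n}. {z. 0 < z ((1, i), i)} \<inter> {z. 0 < z ((2, i), i)} :: ((nat \<times> nat) \<times> nat \<Rightarrow> real) set"
  have opU: "open ?U"
    by (intro open_INT ballI open_Int open_Collect_less continuous_on_const continuous_on_coordinate) simp
  have eq: "?X \<inter> ?U = {x}"
  proof (intro equalityI subsetI)
    fix z assume z: "z \<in> ?X \<inter> ?U"
    then have zX: "z \<in> ?X" by blast
    show "z \<in> {x}"
    proof (rule space_two_sided_cases[OF zX])
      fix a b assume zab: "z = two_sided n n a b" and ab: "a = (\<lambda>i c. z ((1, i), c))" "b = (\<lambda>i c. z ((2, i), c))"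
        and w: "two_sided_weight n n a b"
        and one: "\<And>i. i \<in> {1..n} \<Longrightarrow> \<exists>c\<in>{1..n}. a i c = 1" "\<And>i. i \<in> {1..n} \<Longrightarrow> \<exists>c\<in>{1..n}. b i c = 1"
      have pos: "0 < a i i" "0 < b i i" if "i \<in> {1..n}" for i using z that by (auto simp: ab)
      have nn: "0 \<le> a i c" "0 \<le> b i c" if "i \<in> {1..n}" "c \<in> {1..n}" for i c
        using w that unfolding two_sided_weight_def by blast+
      have di: "\<not> (0 < a i c \<and> 0 < b j c)" if "i \<in> {1..n}" "j \<in> {1..n}" "c \<in> {1..n}" "i \<noteq> j" for i j c
        using w that unfolding two_sided_weight_def by blast
      have zero: "a i c = 0" "b i c = 0" if "i \<in> {1..n}" "c \<in> {1..n}" "c \<noteq> i" for i c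
        using di[of i c c] di[of c i c] pos[OF that(2)] nn[OF that(1,2)] that by auto
      have diag: "a i i = 1" "b i i = 1" if "i \<in> {1..n}" for i
        using one[OF that] zero[OF that] by force+
      have "a i c = delta i c" "b i c = delta i c" if "i \<in> {1..n}" "c \<in> {1..n}" for i c
        using zero[OF that] diag[OF that(1)] by (auto simp: delta_def)
      then have "two_sided n n a b = two_sided n n delta delta"
        by (auto simp: two_sided_def fun_eq_iff)
      then show ?thesis by (simp add: zab x_def)
    qed
  next
    fix z assume "z \<in> {x}"
    moreover have "x \<in> ?U"
    proof (rule INT_I)
      fix i assume "i \<in> {1..n}"
      then show "x \<in> {z. 0 < z ((1, i), i)} \<inter> {z. 0 < z ((2, i), i)}" by (simp add: x_def)
    qed
    ultimately show "z \<in> ?X \<inter> ?U" using xX by blast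
  qed
  have "openin (top_of_set ?X) {x}" using openin_open_Int[OF opU, of ?X] unfolding eq .
  moreover have "closedin (top_of_set ?X) {x}"
  proof -
    have e: "?X \<inter> (\<Union>e. {z. z e \<noteq> x e}) = ?X - {x}" by auto
    have "open (\<Union>e. {z. z e \<noteq> x e})"
      by (intro open_UN ballI open_Collect_neq continuous_on_const continuous_on_coordinate)
    from openin_open_Int[OF this, of ?X] have "openin (top_of_set ?X) (?X - {x})" unfolding e .
    then show ?thesis using xX by (simp add: closedin_def)
  qed
  ultimately have "{x} = {} \<or> {x} = ?X" using con unfolding connected_clopen by blast
  then have "?X = {x}" by blast
  then show False using yX xy by (metis singletonD)
qed

text \<open>Every point is led to a point with one constant colour on each side; any two of these
  are connected because there are at least three colours.\<close>

lemma path_connected_succ: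
  assumes n: "2 \<le> n"
  shows "path_connected (K2K_space n (n + 1))"
proof -
  let ?m = "n + 1"
  let ?X = "K2K_space n ?m"
  let ?R = "path_component ?X"
  note [trans] = path_component_trans
  let ?v = "\<lambda>c d. two_sided n ?m (\<lambda>_. delta c) (\<lambda>_. delta d)"
  have v: "?v c d \<in> ?X" if "c \<in> {1..?m}" "d \<in> {1..?m}" "c \<noteq> d" for c d
    using delta_in_space[of n "\<lambda>_. c" ?m "\<lambda>_. d"] that by simp
  have v1: "?R (?v c d) (?v c' d)" if "c \<in> {1..?m}" "c' \<in> {1..?m}" "d \<in> {1..?m}" "c \<noteq> d" "c' \<noteq> d" for c c' d
    using that by (intro slide_first_component v) auto
  have v2: "?R (?v c d) (?v c d')" if "c \<in> {1..?m}" "d \<in> {1..?m}" "d' \<in> {1..?m}" "c \<noteq> d" "c \<noteq> d'" for c d d'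
    using that by (intro slide_second_component v) auto
  have base: "?R (?v c d) (?v 1 2)" if c: "c \<in> {1..?m}" and d: "d \<in> {1..?m}" and cd: "c \<noteq> d" for c d
  proof -
    have step: "?R (?v e d) (?v 1 2)" if "e \<in> {1..?m}" "e \<noteq> d" "e \<noteq> 2" for e
      by (rule path_component_trans[OF v2[of e d 2] v1[of e 1 2]]) (use that d n in auto)
    show ?thesis
    proof (cases "c = 2")
      case False
      then show ?thesis using step c cd by blast
    next
      case True
      \<comment> \<open>A third colour, different from \<open>d\<close> and 2; it exists because
        \<open>n + 1\<close> is at least 3.\<close>
      define e where "e = (if d = 1 then 3 else 1::nat)"
      have e: "e \<in> {1..?m}" "e \<noteq> d" "e \<noteq> 2" using n by (auto simp: e_def)
      show ?thesis using v1[OF c e(1) d cd e(2)] step[OF e] by (rule path_component_trans)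
    qed
  qed
  have one_sided: "?R x (?v 1 2)"
    if x: "x = two_sided n ?m a b" "x \<in> ?X" and nn: "\<And>i c. 0 \<le> a i c" "\<And>i c. 0 \<le> b i c"
      and c: "c \<in> {1..?m}" "\<And>j. j \<in> {1..n} \<Longrightarrow> b j c = 0" for x a b c
  proof -
    have "\<forall>i\<in>{1..n}. \<exists>d\<in>{1..?m}. b i d = 1" using x(2) unfolding x(1) two_sided_in_space_iff by blast
    moreover have "1 \<in> {1..n}" using n by simp
    ultimately obtain d where d: "d \<in> {1..?m}" "b 1 d = 1" by blast
    then have cd: "c \<noteq> d" using c(2)[of 1] n by auto
    have y: "two_sided n ?m (\<lambda>_. delta c) b \<in> ?X"
      using x c unfolding x(1) two_sided_in_space_iff two_sided_weight_def by auto
    have "?R x (two_sided n ?m (\<lambda>_. delta c) b)"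
      unfolding x(1) by (rule slide_first_component) (use x y nn in auto)
    also have "?R (two_sided n ?m (\<lambda>_. delta c) b) (?v c d)"
      by (rule slide_second_component[OF y v[OF c(1) d(1) cd]]) (use nn in auto)
    also have "?R (?v c d) (?v 1 2)" by (rule base[OF c(1) d(1) cd])
    finally show ?thesis .
  qed
  have one_sided': "?R x (?v 1 2)"
    if x: "x = two_sided n ?m a b" "x \<in> ?X" and nn: "\<And>i c. 0 \<le> a i c" "\<And>i c. 0 \<le> b i c"
      and c: "c \<in> {1..?m}" "\<And>j. j \<in> {1..n} \<Longrightarrow> a j c = 0" for x a b c
  proof -
    have "\<forall>i\<in>{1..n}. \<exists>d\<in>{1..?m}. a i d = 1" using x(2) unfolding x(1) two_sided_in_space_iff by blast
    moreover have "1 \<in> {1..n}" using n by simp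
    ultimately obtain d where d: "d \<in> {1..?m}" "a 1 d = 1" by blast
    then have cd: "d \<noteq> c" using c(2)[of 1] n by auto
    have y: "two_sided n ?m a (\<lambda>_. delta c) \<in> ?X"
      using x c unfolding x(1) two_sided_in_space_iff two_sided_weight_def by auto
    have "?R x (two_sided n ?m a (\<lambda>_. delta c))"
      unfolding x(1) by (rule slide_second_component) (use x y nn in auto)
    also have "?R (two_sided n ?m a (\<lambda>_. delta c)) (?v d c)"
      by (rule slide_first_component[OF y v[OF d(1) c(1) cd]]) (use nn in auto)
    also have "?R (?v d c) (?v 1 2)" by (rule base[OF d(1) c(1) cd])
    finally show ?thesis .
  qed
  have "?R x (?v 1 2)" if xX: "x \<in> ?X" for x
  proof (rule space_two_sided_cases[OF xX])
    fix a b assume xab: "x = two_sided n ?m a b" and ab: "a = (\<lambda>i c. x ((1, i), c))" "b = (\<lambda>i c. x ((2, i), c))"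
      and w: "two_sided_weight n ?m a b"
      and one: "\<And>i. i \<in> {1..n} \<Longrightarrow> \<exists>c\<in>{1..?m}. a i c = 1" "\<And>i. i \<in> {1..n} \<Longrightarrow> \<exists>c\<in>{1..?m}. b i c = 1"
    have nn: "0 \<le> a i c" "0 \<le> b i c" for i c using xX unfolding ab hom_space_def by blast+
    have di: "\<not> (0 < a i c \<and> 0 < b j c)" if "i \<in> {1..n}" "j \<in> {1..n}" "c \<in> {1..?m}" "i \<noteq> j" for i j c
      using w that unfolding two_sided_weight_def by blast
    show ?thesis
    proof (cases "\<exists>c\<in>{1..?m}. (\<forall>j\<in>{1..n}. b j c = 0) \<or> (\<forall>j\<in>{1..n}. a j c = 0)")
      case True
      then show ?thesis using one_sided[OF xab xX nn] one_sided'[OF xab xX nn] by blast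
    next
      case False
      \<comment> \<open>Every colour being used on both sides, \<open>s i\<close> can be shared only
        with \<open>(2, i)\<close>. Hence \<open>s\<close> is injective and misses a colour
        \<open>c\<close>; moving both sides onto \<open>s\<close> frees \<open>c\<close> and leads
        back to the previous case.\<close>
      obtain s where s: "\<And>i. i \<in> {1..n} \<Longrightarrow> s i \<in> {1..?m} \<and> a i (s i) = 1" using one(1) by metis
      have s_diag: "0 < b i (s i)" if i: "i \<in> {1..n}" for i
      proof -
        have sm: "s i \<in> {1..?m}" "0 < a i (s i)" using s[OF i] by auto
        with False obtain j where j: "j \<in> {1..n}" "b j (s i) \<noteq> 0" by blast
        then have "0 < b j (s i)" using nn(2)[of j "s i"] by linarith
        then show ?thesis using di[OF i j(1) sm(1)] sm(2) by blast
      qed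
      have other: "a i c = 0 \<and> b i c = 0" if "i \<in> {1..n}" "j \<in> {1..n}" "c = s j" "i \<noteq> j" for i j c
        using di[of i j c] di[of j i c] s[OF that(2)] s_diag[OF that(2)] nn[of i c] that by auto
      have inj: "inj_on s {1..n}"
        by (rule inj_onI) (metis other s zero_neq_one)
      have "\<not> {1..?m} \<subseteq> s ` {1..n}"
      proof
        assume "{1..?m} \<subseteq> s ` {1..n}"
        then have "card {1..?m} \<le> card {1..n}" using surj_card_le[of "{1..n}" "{1..?m}" s] by simp
        then show False by simp
      qed
      then obtain c where c: "c \<in> {1..?m}" "c \<notin> s ` {1..n}" by blast
      let ?d = "\<lambda>i. delta (s i)"
      have y1: "two_sided n ?m ?d b \<in> ?X"
        using xX[unfolded xab two_sided_in_space_iff] s other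
        unfolding two_sided_in_space_iff two_sided_weight_def by (auto simp: atLeastAtMost_iff simp del: One_nat_def) 
      have y2: "two_sided n ?m ?d ?d \<in> ?X"
        by (rule delta_in_space) (use s inj in \<open>auto dest: inj_onD\<close>)
      have "?R x (two_sided n ?m ?d b)"
        unfolding xab by (rule slide_first_component[OF _ y1]) (use xX xab nn in auto)
      also have "?R (two_sided n ?m ?d b) (two_sided n ?m ?d ?d)"
        by (rule slide_second_component[OF y1 y2]) (use nn in auto)
      also have "?R (two_sided n ?m ?d ?d) (?v 1 2)"
        by (rule one_sided[OF refl y2 _ _ c(1)]) (use c(2) in auto)
      finally show ?thesis .
    qed
  qed
  then show ?thesis unfolding path_connected_component
    by (meson path_component_sym path_component_trans)
qed


text \<open>\<open>y b - y a\<close> is an odd multiple of \<open>pi\<close>. The sine is -1 at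
  \<open>y a + 3 * pi / 2\<close> and at \<open>y a - pi / 2\<close>, so by the intermediate value
  theorem neither is reached, and only \<open>pi\<close> remains.\<close>

lemma half_turn:
  fixes y :: "real \<Rightarrow> real"
  assumes ab: "a \<le> b" and y: "continuous_on {a..b} y"
    and s: "\<And>t. t \<in> {a..b} \<Longrightarrow> 0 \<le> sin (y t)" and ya: "cos (y a) = 1" and yb: "cos (y b) = -1"
  shows "y b = y a + pi"
proof -
  obtain k :: int where k: "y a = real_of_int k * 2 * pi" using ya cos_one_2pi_int by blast
  obtain l :: int where l: "y b = (2 * real_of_int l + 1) * pi" using yb cos_eq_minus1 by blast
  have sink: "sin (y a + r) = sin r" for r
  proof -
    have e: "y a = 2 * pi * real_of_int k" by (simp add: k)
    show ?thesis unfolding e sin_add by (simp only: sin_int_2pin cos_int_2pin mult_zero_left add_0 mult_1)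
  qed
  have no: "\<not> (y a \<le> y a + 3 * pi / 2 \<and> y a + 3 * pi / 2 \<le> y b)"
  proof
    assume "y a \<le> y a + 3 * pi / 2 \<and> y a + 3 * pi / 2 \<le> y b"
    then obtain t where "a \<le> t" "t \<le> b" "y t = y a + 3 * pi / 2" using IVT'[of y a "y a + 3 * pi / 2" b] ab y by auto
    moreover have "sin (y a + 3 * pi / 2) = -1" using sink[of "3 * pi / 2"] sin_3over2_pi by simp
    ultimately show False using s[of t] by simp
  qed
  have no': "\<not> (y b \<le> y a + - (pi / 2))"
  proof
    assume "y b \<le> y a + - (pi / 2)"
    then obtain t where "a \<le> t" "t \<le> b" "y t = y a + - (pi / 2)" using IVT2'[of y b "y a + - (pi / 2)" a] ab y by auto
    moreover have "sin (y a + - (pi / 2)) = -1" using sink[of "- (pi / 2)"] by simp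
    ultimately show False using s[of t] by simp
  qed
  have "l = k"
  proof (rule antisym)
    show "l \<le> k"
    proof (rule ccontr)
      assume "\<not> l \<le> k"
      then have "real_of_int (2 * k + 3) * pi \<le> real_of_int (2 * l + 1) * pi" by (intro mult_right_mono) auto
      then have "y a + 3 * pi \<le> y b" by (simp add: k l algebra_simps)
      then show False using no pi_gt_zero by linarith
    qed
    show "k \<le> l"
    proof (rule ccontr)
      assume "\<not> k \<le> l"
      then have "real_of_int (2 * l + 1) * pi \<le> real_of_int (2 * k - 1) * pi" by (intro mult_right_mono) auto
      then have "y b \<le> y a - pi" by (simp add: k l algebra_simps)
      then show False using no' pi_gt_zero by linarith
    qed
  qed
  then show ?thesis by (simp add: k l algebra_simps)
qed

lemma half_turn':
  fixes y :: "real \<Rightarrow> real"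
  assumes "a \<le> b" "continuous_on {a..b} y"
    and "\<And>t. t \<in> {a..b} \<Longrightarrow> sin (y t) \<le> 0" "cos (y a) = -1" "cos (y b) = 1"
  shows "y b = y a + pi"
  using half_turn[of a b "\<lambda>t. y t - pi"] assms
  by (simp add: sin_diff cos_diff continuous_on_diff)

text \<open>If \<open>y\<close> moved, it would pass a value at distance \<open>r\<close> from
  \<open>y a\<close> with \<open>0 < r\<close> and \<open>r \<le> pi\<close>, where the cosine is no
  longer -1.\<close>

lemma no_turn:
  fixes y :: "real \<Rightarrow> real"
  assumes ab: "a \<le> b" and y: "continuous_on {a..b} y" and s: "\<And>t. t \<in> {a..b} \<Longrightarrow> cos (y t) = -1"
  shows "y b = y a"
proof -
  have sub: False if r: "0 < r" "r \<le> pi" "t \<in> {a..b}" "y t = y a + r \<or> y t = y a - r" for r t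
  proof -
    have ca: "cos (y a) = -1" using s ab by simp
    then have "(sin (y a))\<^sup>2 = 0" using sin_cos_squared_add[of "y a"] by simp
    then have "sin (y a) = 0" by simp
    then have "cos (y t) = - cos r" using r(4) ca by (auto simp: cos_add cos_diff)
    then have "cos r = 1" using s[OF r(3)] by simp
    then show False using cos_monotone_0_pi[of 0 r] r by simp
  qed
  show ?thesis
  proof (rule linorder_cases[of "y a" "y b"])
    assume less: "y a < y b"
    define r where "r = min (y b - y a) pi"
    have r: "y a \<le> y a + r" "y a + r \<le> y b" using less by (auto simp: r_def)
    obtain t where "a \<le> t" "t \<le> b" "y t = y a + r" using IVT'[OF r ab y] by blast
    then show ?thesis using sub[of r t] less by (auto simp: r_def)
  next
    assume less: "y b < y a"
    define r where "r = min (y a - y b) pi"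
    have r: "y b \<le> y a - r" "y a - r \<le> y a" using less by (auto simp: r_def)
    obtain t where "a \<le> t" "t \<le> b" "y t = y a - r" using IVT2'[OF r ab y] by blast
    then show ?thesis using sub[of r t] less by (auto simp: r_def)
  qed simp
qed

section \<open>A loop with nonzero winding number\<close>

text \<open>
  A permutation \<open>s\<close> of the \<open>n + 1\<close> colours stands for the point giving the colour \<open>s i\<close> to both
  \<open>(1, i)\<close> and \<open>(2, i)\<close>, with \<open>s (n + 1)\<close> left over. These points are the only passages between
  the cells where the leftover colour is used on the first side and those where it is used on
  the second side. Moving the leftover colour to both \<open>(1, i)\<close> and \<open>(2, i)\<close> leads from \<open>s\<close> to
  \<open>s \<circ> transpose i (n + 1)\<close> with the roles of the sides exchanged, whence the sign.
\<close>
definition perm_weight :: "nat \<Rightarrow> ((nat \<times> nat) \<times> nat \<Rightarrow> real) \<Rightarrow> (nat \<Rightarrow> nat) \<Rightarrow> real" where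
  "perm_weight n x s = (\<Prod>i\<in>{1..n}. x ((1, i), s i) * x ((2, i), s i))"

definition side_excess :: "nat \<Rightarrow> ((nat \<times> nat) \<times> nat \<Rightarrow> real) \<Rightarrow> nat \<Rightarrow> real" where
  "side_excess n x c = (\<Sum>i\<in>{1..n}. x ((1, i), c) - x ((2, i), c))"

text \<open>The value is 1 at the point of a permutation and -1 where all \<open>perm_weight\<close>
  vanish. The imaginary part is a signed expansion in the style of a determinant, each term
  measuring which side uses the leftover colour more.\<close>

definition circle_map :: "nat \<Rightarrow> ((nat \<times> nat) \<times> nat \<Rightarrow> real) \<Rightarrow> complex" where
  "circle_map n x =
     Complex (2 * (\<Sum>s | s permutes {1..n + 1}. perm_weight n x s) - 1)
       (\<Sum>s | s permutes {1..n + 1}. of_int (sign s) * perm_weight n x s * side_excess n x (s (n + 1)))"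

lemma continuous_on_circle_map: "continuous_on S (circle_map n)"
proof -
  have e: "circle_map n = (\<lambda>x. complex_of_real (2 * (\<Sum>s | s permutes {1..n + 1}. perm_weight n x s) - 1) +
    \<i> * complex_of_real (\<Sum>s | s permutes {1..n + 1}. of_int (sign s) * perm_weight n x s * side_excess n x (s (n + 1))))"
    by (simp add: circle_map_def Complex_eq fun_eq_iff)
  show ?thesis unfolding e perm_weight_def side_excess_def
    by (intro continuous_intros continuous_on_coordinate)
qed

text \<open>The numbers are the weights of one vertex pair on two colours, each vertex having
  maximum 1. The minus sign hidden in \<open>im\<close> matters: with a plus sign,
  \<open>p = t = 1\<close> and \<open>q = r = 1/4\<close> would be a zero of the map.\<close>

lemma square_nonvanishing:
  fixes p q r t :: real
  assumes "0 < p" "p \<le> 1" "0 < q" "q \<le> 1" "0 < r" "r \<le> 1" "0 < t" "t \<le> 1"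
    and "p = 1 \<or> r = 1" "q = 1 \<or> t = 1"
    and im: "p * q * (r - t) = r * t * (p - q)"
  shows "2 * (p * q + r * t) \<noteq> 1"
proof -
  have prod1: "x = 1 \<and> y = 1" if "0 < x" "x \<le> 1" "0 < y" "y \<le> 1" "x + y = 2 * (x * y)" for x y :: real
  proof -
    have "x * y \<le> x * 1" "x * y \<le> 1 * y" using that by (intro mult_mono; simp)+
    then have "x * y = x" "x * y = y" using that(5) by linarith+
    then show ?thesis using that by simp
  qed
  consider "p = 1" "q = 1" | "r = 1" "t = 1" | "p = 1" "t = 1" | "r = 1" "q = 1" using assms by blast
  then show ?thesis
  proof cases
    case 1
    then show ?thesis using mult_pos_pos[OF assms(5,7)] by simp
  next
    case 2
    then show ?thesis using mult_pos_pos[OF assms(1,3)] by simp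
  next
    case 3
    then have "q + r = 2 * (q * r)" using im by (simp add: algebra_simps)
    then have "q = 1 \<and> r = 1" using prod1 assms by blast
    then show ?thesis using 3 by simp
  next
    case 4
    then have "p + t = 2 * (p * t)" using im by (simp add: algebra_simps)
    then have "p = 1 \<and> t = 1" using prod1 assms by blast
    then show ?thesis using 4 by simp
  qed
qed

text \<open>Once some permutation \<open>s\<close> has positive weight, at most one other
  permutation can have it. If there is none, a vanishing imaginary part forces real part 1; if there
  is one, the claim is \<open>square_nonvanishing\<close>.\<close>

lemma circle_map_nonzero:
  assumes n: "1 \<le> n" and x: "x \<in> K2K_space n (n + 1)"
  shows "circle_map n x \<noteq> 0"
proof (rule space_two_sided_cases[OF x])
  let ?m = "n + 1" and ?N = "{1..n}" and ?P = "{s. s permutes {1..n + 1}}"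
  let ?w = "perm_weight n x" and ?z = "side_excess n x"
  fix a b assume ab: "a = (\<lambda>i c. x ((1, i), c))" "b = (\<lambda>i c. x ((2, i), c))"
    and w: "two_sided_weight n ?m a b" and le: "\<And>i c. a i c \<le> 1" "\<And>i c. b i c \<le> 1"
    and one: "\<And>i. i \<in> ?N \<Longrightarrow> \<exists>c\<in>{1..?m}. a i c = 1" "\<And>i. i \<in> ?N \<Longrightarrow> \<exists>c\<in>{1..?m}. b i c = 1"
  have nn: "0 \<le> a i c" "0 \<le> b i c" for i c using x unfolding ab hom_space_def by blast+
  have di: "\<not> (0 < a i c \<and> 0 < b j c)" if "i \<in> ?N" "j \<in> ?N" "c \<in> {1..?m}" "i \<noteq> j" for i j c
    using w that unfolding two_sided_weight_def by blast
  have wt: "?w s = (\<Prod>i\<in>?N. a i (s i) * b i (s i))" for s by (simp add: perm_weight_def ab)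
  have zt: "?z c = (\<Sum>i\<in>?N. a i c - b i c)" for c by (simp add: side_excess_def ab)
  have pos: "0 < a i (s i) \<and> 0 < b i (s i)" if "?w s \<noteq> 0" "i \<in> ?N" for s i
  proof -
    have "\<forall>i\<in>?N. a i (s i) * b i (s i) \<noteq> 0" using that(1) unfolding wt by (simp add: prod_zero_iff)
    then have "a i (s i) * b i (s i) \<noteq> 0" using that(2) by blast
    then show ?thesis using nn[of i "s i"] by (auto simp: less_le)
  qed
  have finP: "finite ?P" by (rule finite_permutations) simp
  show ?thesis
  proof (cases "\<forall>s\<in>?P. ?w s = 0")
    case True
    then have "(\<Sum>s | s permutes {1..n + 1}. ?w s) = 0" by (intro sum.neutral) auto
    then show ?thesis by (simp add: circle_map_def complex_eq_iff)
  next
    case False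
    then obtain s where sP: "s permutes {1..?m}" and sw: "?w s \<noteq> 0" by blast
    have srange: "s i \<in> {1..?m}" if "i \<in> {1..?m}" for i using permutes_in_image[OF sP] that by blast
    have sinj: "s i = s j \<longleftrightarrow> i = j" for i j using permutes_inj[OF sP] by (auto dest: injD)
    have ssurj: "\<exists>i\<in>{1..?m}. c = s i" if "c \<in> {1..?m}" for c
      using permutes_image[OF sP] that by blast
    define c where "c = s ?m"
    have cr: "c \<in> {1..?m}" unfolding c_def using srange by simp
    have off: "a i (s j) = 0 \<and> b i (s j) = 0" if "i \<in> ?N" "j \<in> ?N" "i \<noteq> j" for i j
    proof -
      have sr: "s j \<in> {1..?m}" using srange that(2) by simp
      have "\<not> 0 < a i (s j)" using di[OF that(1,2) sr that(3)] pos[OF sw that(2)] by blast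
      moreover have "\<not> 0 < b i (s j)" using di[OF that(2,1) sr that(3)[symmetric]] pos[OF sw that(2)] by blast
      ultimately show ?thesis using nn[of i "s j"] by linarith
    qed
    have supp: "d = s i \<or> d = c" if "i \<in> ?N" "d \<in> {1..?m}" "a i d \<noteq> 0 \<or> b i d \<noteq> 0" for i d
    proof -
      have "\<exists>j\<in>{1..?m}. d = s j" using ssurj that(2) .
      then obtain j where j: "j \<in> {1..?m}" "d = s j" by blast
      show ?thesis
      proof (cases "j = ?m")
        case False
        then have "j \<in> ?N" using j by auto
        then show ?thesis using off[OF that(1), of j] that(3) j by (cases "i = j") auto
      qed (use j in \<open>simp add: c_def\<close>)
    qed
    have full: "(a i c = 0 \<longrightarrow> a i (s i) = 1) \<and> (b i c = 0 \<longrightarrow> b i (s i) = 1)"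
      and full1: "(a i (s i) = 1 \<or> a i c = 1) \<and> (b i (s i) = 1 \<or> b i c = 1)" if i: "i \<in> ?N" for i
    proof -
      obtain d e where "d \<in> {1..?m}" "a i d = 1" "e \<in> {1..?m}" "b i e = 1" using one[OF i] by blast
      then have "(d = s i \<or> d = c) \<and> (e = s i \<or> e = c)" using supp[OF i, of d] supp[OF i, of e] by auto
      then show "(a i (s i) = 1 \<or> a i c = 1) \<and> (b i (s i) = 1 \<or> b i c = 1)"
        using \<open>a i d = 1\<close> \<open>b i e = 1\<close> by auto
      then show "(a i c = 0 \<longrightarrow> a i (s i) = 1) \<and> (b i c = 0 \<longrightarrow> b i (s i) = 1)" by auto
    qed
    \<comment> \<open>The vertices of index \<open>i\<close> use at most \<open>s i\<close> and the
      leftover \<open>c\<close>. Another permutation of nonzero weight must therefore send one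
      \<open>i\<close> to \<open>c\<close>, and injectivity determines the rest.\<close>
    have perm_cases: "t = s \<or> (\<exists>i\<in>?N. 0 < a i c \<and> 0 < b i c \<and> t = s \<circ> Transposition.transpose i ?m)"
      if tP: "t permutes {1..?m}" and tw: "?w t \<noteq> 0" for t
    proof -
      have trange: "t i \<in> {1..?m}" if "i \<in> {1..?m}" for i using permutes_in_image[OF tP] that by blast
      have tinj: "t i = t j \<longleftrightarrow> i = j" for i j using permutes_inj[OF tP] by (auto dest: injD)
      have tval: "t i = s i \<or> t i = c" if "i \<in> ?N" for i
        using supp[OF that, of "t i"] trange[of i] pos[OF tw that] that by auto
      show ?thesis
      proof (cases "\<exists>i\<in>?N. t i = c")
        case True
        then obtain i where i: "i \<in> ?N" "t i = c" by blast
        have tj: "t j = s j" if "j \<in> ?N" "j \<noteq> i" for j using tval[OF that(1)] tinj[of j i] i that by auto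
        have "t ?m = s i"
        proof -
          obtain j where j: "j \<in> {1..?m}" "t ?m = s j" using ssurj[OF trange] by fastforce
          have "j \<noteq> ?m"
          proof
            assume "j = ?m"
            then have "t ?m = t i" using j i(2) unfolding c_def by presburger
            then have "?m = i" using tinj by blast
            then show False using i(1) by simp
          qed
          then have jN: "j \<in> ?N" using j by auto
          have "j = i"
          proof (rule ccontr)
            assume "j \<noteq> i"
            then have "t ?m = t j" using tj[OF jN] j by simp
            then show False using tinj jN by simp
          qed
          then show ?thesis using j by simp
        qed
        have "t = s \<circ> Transposition.transpose i ?m"
        proof
          fix j
          consider "j = i" | "j = ?m" | "j \<in> ?N" "j \<noteq> i" | "j \<notin> {1..?m}" by fastforce
          then show "t j = (s \<circ> Transposition.transpose i ?m) j"
          proof cases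
            case 4
            then have "j \<noteq> i" "j \<noteq> ?m" using i by auto
            then show ?thesis using permutes_not_in[OF tP 4] permutes_not_in[OF sP 4] by simp
          qed (use i tj \<open>t ?m = s i\<close> in \<open>auto simp: c_def\<close>)
        qed
        then show ?thesis using pos[OF tw i(1)] i by auto
      next
        case False
        then have ts: "t i = s i" if "i \<in> ?N" for i using tval that by blast
        have "t ?m = s ?m"
        proof -
          obtain j where j: "j \<in> {1..?m}" "t ?m = s j" using ssurj[OF trange] by fastforce
          have "j = ?m"
          proof (rule ccontr)
            assume "j \<noteq> ?m"
            then have jN: "j \<in> ?N" using j by auto
            then have "t ?m = t j" using ts j by simp
            then show False using tinj jN by simp
          qed
          then show ?thesis using j by simp
        qed
        have "t = s"
        proof
          fix j
          consider "j = ?m" | "j \<in> ?N" | "j \<notin> {1..?m}" by fastforce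
          then show "t j = s j"
            by cases (use ts \<open>t ?m = s ?m\<close> permutes_not_in[OF tP] permutes_not_in[OF sP] in auto)
        qed
        then show ?thesis by blast
      qed
    qed
    show ?thesis
    proof (cases "\<exists>i\<in>?N. 0 < a i c \<and> 0 < b i c")
      case False
      have Q: "\<forall>t\<in>?P - {s}. ?w t = 0" using perm_cases False by blast
      have re: "(\<Sum>t | t permutes {1..n + 1}. ?w t) = ?w s"
        using sum.mono_neutral_right[OF finP, of "{s}" ?w] Q sP by simp
      have im: "(\<Sum>t | t permutes {1..n + 1}. of_int (sign t) * ?w t * ?z (t ?m)) = of_int (sign s) * ?w s * ?z c"
        using sum.mono_neutral_right[OF finP, of "{s}" "\<lambda>t. of_int (sign t) * ?w t * ?z (t ?m)"] Q sP
        by (simp add: c_def)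
      have "?w s = 1" if z0: "?z c = 0"
      proof -
        have az: "a i c = 0 \<and> b i c = 0" if i: "i \<in> ?N" for i
        proof (rule ccontr)
          assume "\<not> ?thesis"
          then consider "0 < a i c" | "0 < b i c" using nn[of i c] by linarith
          then show False
          proof cases
            case 1
            have "\<not> 0 < b j c" if "j \<in> ?N" for j
              using di[OF i that cr] False i 1 by (cases "j = i") blast+
            then have "b j c = 0" if "j \<in> ?N" for j using nn(2)[of j c] that by fastforce
            then have "?z c = (\<Sum>i\<in>?N. a i c)" unfolding zt by (intro sum.cong) auto
            moreover have "0 < (\<Sum>i\<in>?N. a i c)" using 1 i nn by (intro sum_pos2[of _ i]) auto
            ultimately show False using z0 by simp
          next
            case 2
            have "\<not> 0 < a j c" if "j \<in> ?N" for j
              using di[OF that i cr] False i 2 by (cases "j = i") blast+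
            then have "a j c = 0" if "j \<in> ?N" for j using nn(1)[of j c] that by fastforce
            then have "?z c = - (\<Sum>i\<in>?N. b i c)" unfolding zt sum_negf[symmetric] by (intro sum.cong) auto
            moreover have "0 < (\<Sum>i\<in>?N. b i c)" using 2 i nn by (intro sum_pos2[of _ i]) auto
            ultimately show False using z0 by simp
          qed
        qed
        then show ?thesis unfolding wt using full by (intro prod.neutral) auto
      qed
      then show ?thesis using sw unfolding circle_map_def re im by (auto simp: complex_eq_iff sign_def)
    next
      case True
      then obtain i where i: "i \<in> ?N" and ip: "0 < a i c" "0 < b i c" by blast
      \<comment> \<open>Sharing \<open>c\<close> at \<open>i\<close> excludes it at all other
        indices, so exactly \<open>s\<close> and \<open>t\<close> contribute and all factors of
        other indices are 1.\<close>
      define t where "t = s \<circ> Transposition.transpose i ?m"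
      have tr: "Transposition.transpose i ?m permutes {1..?m}" using i by (intro permutes_swap_id) auto
      have tP: "t permutes {1..?m}" unfolding t_def by (rule permutes_compose[OF tr sP])
      have sgn: "sign t = - sign s"
        unfolding t_def using i sP tr
        by (subst sign_compose) (auto intro: permutes_imp_permutation simp: sign_swap_id)
      have offc: "a j c = 0 \<and> b j c = 0" if "j \<in> ?N" "j \<noteq> i" for j
      proof -
        have "\<not> 0 < a j c" using di[OF that(1) i cr that(2)] ip by blast
        moreover have "\<not> 0 < b j c" using di[OF i that(1) cr that(2)[symmetric]] ip by blast
        ultimately show ?thesis using nn[of j c] by linarith
      qed
      have ti: "t i = c" "t ?m = s i" and tj: "\<And>j. j \<in> ?N \<Longrightarrow> j \<noteq> i \<Longrightarrow> t j = s j"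
        using i by (auto simp: t_def c_def)
      have st: "s \<noteq> t" using sinj[of i ?m] i ti(1) by (auto simp: c_def)
      have rest: "(\<Prod>j\<in>?N - {i}. a j (s j) * b j (s j)) = 1"
        using full offc by (intro prod.neutral) auto
      have ws: "?w s = a i (s i) * b i (s i)"
        unfolding wt prod.remove[OF finite_atLeastAtMost i] rest by simp
      have rest': "(\<Prod>j\<in>?N - {i}. a j (t j) * b j (t j)) = 1"
        using full offc tj by (intro prod.neutral) auto
      have wtt: "?w t = a i c * b i c"
        unfolding wt prod.remove[OF finite_atLeastAtMost i] rest' ti by simp
      have zd: "?z d = a i d - b i d" if "\<And>j. j \<in> ?N \<Longrightarrow> j \<noteq> i \<Longrightarrow> a j d = 0 \<and> b j d = 0" for d
      proof -
        have r: "(\<Sum>j\<in>?N - {i}. a j d - b j d) = 0" using that by (intro sum.neutral) auto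
        show ?thesis unfolding zt sum.remove[OF finite_atLeastAtMost i] r by simp
      qed
      have zs: "?z (s ?m) = a i c - b i c" using zd[of c] offc by (simp add: c_def)
      have zt': "?z (t ?m) = a i (s i) - b i (s i)" unfolding ti using zd[of "s i"] off i by simp
      have only: "?w u = 0" if u: "u \<in> ?P - {s, t}" for u
      proof (rule ccontr)
        assume "?w u \<noteq> 0"
        then obtain k where k: "k \<in> ?N" "0 < a k c" "u = s \<circ> Transposition.transpose k ?m"
          using perm_cases[of u] u by blast
        then have "k = i" using offc[of k] by auto
        then show False using k u by (simp add: t_def)
      qed
      have re: "(\<Sum>u | u permutes {1..n + 1}. ?w u) = ?w s + ?w t"
        using sum.mono_neutral_right[OF finP, of "{s, t}" ?w] only sP tP st by simp
      have im: "(\<Sum>u | u permutes {1..n + 1}. of_int (sign u) * ?w u * ?z (u ?m)) =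
          of_int (sign s) * (?w s * ?z (s ?m) - ?w t * ?z (t ?m))"
        using sum.mono_neutral_right[OF finP, of "{s, t}" "\<lambda>u. of_int (sign u) * ?w u * ?z (u ?m)"] only sP tP st
        by (simp add: sgn algebra_simps)
      show ?thesis
      proof
        assume z: "circle_map n x = 0"
        have "of_int (sign s) * (?w s * ?z (s ?m) - ?w t * ?z (t ?m)) = (0::real)"
          using z unfolding circle_map_def im by (simp add: complex_eq_iff)
        then have "?w s * ?z (s ?m) = ?w t * ?z (t ?m)" by (auto simp: sign_def split: if_splits)
        then have "a i (s i) * b i (s i) * (a i c - b i c) = a i c * b i c * (a i (s i) - b i (s i))"
          unfolding ws wtt zs zt' .
        moreover have "2 * (a i (s i) * b i (s i) + a i c * b i c) = 1"
          using z unfolding circle_map_def re ws wtt by (simp add: complex_eq_iff)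
        ultimately show False
          using square_nonvanishing[of "a i (s i)" "b i (s i)" "a i c" "b i c"] pos[OF sw i] ip le full1[OF i] by blast
      qed
    qed
  qed
qed

text \<open>The imaginary part of a continuous logarithm gains \<open>pi\<close> on the upper arc,
  nothing on the constant one and \<open>pi\<close> again on the lower arc, so the logarithm does
  not close up.\<close>

lemma winding_number_three_arcs:
  assumes p: "path p1" "path p2" "path p3"
    and ends: "pathstart p1 = 1" "pathfinish p1 = -1" "pathstart p3 = -1" "pathfinish p3 = 1"
    and p2: "\<And>t. t \<in> {0..1} \<Longrightarrow> p2 t = -1"
    and nz: "0 \<notin> path_image p1" "0 \<notin> path_image p3"
    and up: "\<And>t. t \<in> {0..1} \<Longrightarrow> 0 \<le> Im (p1 t)" and down: "\<And>t. t \<in> {0..1} \<Longrightarrow> Im (p3 t) \<le> 0"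
  shows "winding_number (p1 +++ (p2 +++ p3)) 0 \<noteq> 0"
proof
  let ?p = "p1 +++ (p2 +++ p3)"
  assume w: "winding_number ?p 0 = 0"
  have e2: "pathstart p2 = -1" "pathfinish p2 = -1" using p2[of 0] p2[of 1] by (auto simp: pathstart_def pathfinish_def)
  have pp: "path ?p" using p ends e2 by (intro path_join_imp) auto
  have "0 \<notin> path_image p2" using p2 by (auto simp: path_image_def)
  then have "0 \<notin> path_image ?p" using nz ends e2 by (simp add: path_image_join)
  then obtain q where q: "path q" "pathfinish q - pathstart q = 2 * of_real pi * \<i> * winding_number ?p 0"
    and eq: "\<And>t. t \<in> {0..1} \<Longrightarrow> ?p t = 0 + exp (q t)"
    using winding_number_as_continuous_log[OF pp] by metis
  define y where "y t = Im (q t)" for t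
  have yc: "continuous_on {0..1} y" using q(1) unfolding y_def path_def by (intro continuous_intros)
  \<comment> \<open>The nested join runs \<open>p1\<close> on \<open>[0, 1/2]\<close>,
    \<open>p2\<close> on \<open>[1/2, 3/4]\<close> and \<open>p3\<close> on \<open>[3/4, 1]\<close>;
    at the break points the formulas agree because the ends match.\<close>
  have P1: "?p t = p1 (2 * t)" if "t \<in> {0..1/2}" for t using that by (simp add: joinpaths_def)
  have P2: "?p t = p2 (4 * t - 2)" if t: "t \<in> {1/2..3/4}" for t
  proof (cases "t = 1/2")
    case True
    show ?thesis unfolding True using ends e2 by (simp add: joinpaths_def pathfinish_def pathstart_def)
  next
    case False
    then show ?thesis using t by (simp add: joinpaths_def algebra_simps)
  qed
  have P3: "?p t = p3 (4 * t - 3)" if t: "t \<in> {3/4..1}" for t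
  proof (cases "t = 3/4")
    case True
    show ?thesis unfolding True using ends e2 by (simp add: joinpaths_def pathfinish_def pathstart_def)
  next
    case False
    then show ?thesis using t by (simp add: joinpaths_def algebra_simps)
  qed
  have sgn: "0 \<le> sin (y t) \<longleftrightarrow> 0 \<le> Im (?p t)" "sin (y t) \<le> 0 \<longleftrightarrow> Im (?p t) \<le> 0" if "t \<in> {0..1}" for t
    unfolding eq[OF that] by (simp_all add: Im_exp y_def zero_le_mult_iff mult_le_0_iff)
  have cs: "cos (y t) = r" if t: "t \<in> {0..1}" "?p t = of_real r" "\<bar>r\<bar> = 1" for t r
  proof -
    have e: "exp (q t) = of_real r" using eq[OF t(1)] t(2) by simp
    then have "exp (Re (q t)) = 1" using t(3) by (metis norm_exp_eq_Re norm_of_real)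
    moreover have "Re (exp (q t)) = r" using e by simp
    ultimately show ?thesis by (simp add: Re_exp y_def)
  qed
  have m: "?p 0 = of_real 1" "?p (1/2) = of_real (-1)" "?p (3/4) = of_real (-1)" "?p 1 = of_real 1"
    using P1[of 0] P1[of "1/2"] P3[of "3/4"] P3[of 1] ends by (simp_all add: pathstart_def pathfinish_def)
  have "y (1/2) = y 0 + pi"
  proof (rule half_turn[of 0 "1/2" y])
    show "continuous_on {0..1/2} y" using yc by (rule continuous_on_subset) auto
    show "0 \<le> sin (y t)" if "t \<in> {0..1/2}" for t
      using sgn(1)[of t] up[of "2 * t"] P1[OF that] that by simp
  qed (use cs m in auto)
  moreover have "y (3/4) = y (1/2)"
  proof (rule no_turn[of "1/2" "3/4" y])
    show "continuous_on {1/2..3/4} y" using yc by (rule continuous_on_subset) auto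
    show "cos (y t) = -1" if "t \<in> {1/2..3/4}" for t
      using cs[of t "-1"] P2[OF that] p2[of "4 * t - 2"] that by simp
  qed simp
  moreover have "y 1 = y (3/4) + pi"
  proof (rule half_turn'[of "3/4" 1 y])
    show "continuous_on {3/4..1} y" using yc by (rule continuous_on_subset) auto
    show "sin (y t) \<le> 0" if "t \<in> {3/4..1}" for t
      using sgn(2)[of t] down[of "4 * t - 3"] P3[OF that] that by simp
  qed (use cs m in auto)
  ultimately have "y 1 - y 0 = 2 * pi" by simp
  moreover have "q 1 = q 0" using q(2) w by (simp add: pathstart_def pathfinish_def)
  ultimately show False using pi_gt_zero by (simp add: y_def)
qed

section \<open>Values of \<open>circle_map\<close> along the loop\<close>

lemma perm_weight_two_sided:
  assumes "s permutes {1..n + 1}"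
  shows "perm_weight n (two_sided n (n + 1) a b) s = (\<Prod>i\<in>{1..n}. a i (s i) * b i (s i))"
  unfolding perm_weight_def
proof (rule prod.cong[OF refl])
  fix i assume i: "i \<in> {1..n}"
  then have "i \<in> {1..n + 1}" by simp
  then have "s i \<in> {1..n + 1}" using permutes_in_image[OF assms] by blast
  then show "two_sided n (n + 1) a b ((1, i), s i) * two_sided n (n + 1) a b ((2, i), s i) = a i (s i) * b i (s i)"
    using i by (simp only: two_sided_simps)
qed

text \<open>A permutation takes the value \<open>c\<close> at most once, so one of the indices 1 and
  2, both available as \<open>2 \<le> n\<close>, contributes a factor 0.\<close>

lemma circle_map_constant_side:
  assumes n: "2 \<le> n"
    and c: "(\<forall>i. a i = delta c) \<or> (\<forall>i. b i = delta c)"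
  shows "circle_map n (two_sided n (n + 1) a b) = -1"
proof -
  have z: "perm_weight n (two_sided n (n + 1) a b) s = 0" if s: "s permutes {1..n + 1}" for s
  proof -
    have "s 1 \<noteq> s 2" using inj_eq[OF permutes_inj[OF s], of 1 2] by simp
    then obtain i where i: "i \<in> {1, 2}" "s i \<noteq> c" by auto
    then have "a i (s i) * b i (s i) = 0" using c by (auto simp: delta_def)
    then show ?thesis unfolding perm_weight_two_sided[OF s] using i n by (intro prod_zero bexI[of _ i]) auto
  qed
  then show ?thesis unfolding circle_map_def by (simp add: complex_eq_iff)
qed

text \<open>A permutation fixing \<open>1, ..., n\<close> also fixes \<open>n + 1\<close>, so only
  the identity survives.\<close>

lemma sum_permutations_diagonal:
  fixes f :: "(nat \<Rightarrow> nat) \<Rightarrow> real"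
  assumes "\<And>s. s permutes {1..n + 1} \<Longrightarrow> i0 s \<Longrightarrow> f s = 0"
    and "\<And>s. \<not> i0 s \<Longrightarrow> \<forall>i\<in>{1..n}. s i = i"
  shows "(\<Sum>s | s permutes {1..n + 1}. f s) = f id"
proof -
  have "f s = 0" if s: "s permutes {1..n + 1}" "s \<noteq> id" for s
  proof (rule assms(1)[OF s(1)], rule ccontr)
    assume "\<not> i0 s"
    then have fix1: "s i = i" if "i \<in> {1..n}" for i using assms(2) that by blast
    have "s (n + 1) = n + 1"
    proof (rule ccontr)
      assume ne: "s (n + 1) \<noteq> n + 1"
      have "s (n + 1) \<in> {1..n + 1}" using permutes_in_image[OF s(1), of "n + 1"] by simp
      then have "s (n + 1) \<in> {1..n}" using ne by auto
      then have "s (s (n + 1)) = s (n + 1)" using fix1 by blast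
      then show False using inj_eq[OF permutes_inj[OF s(1)], of "s (n + 1)" "n + 1"] ne by simp
    qed
    have "s = id"
    proof
      fix i
      consider "i \<in> {1..n}" | "i = n + 1" | "i \<notin> {1..n + 1}" by fastforce
      then show "s i = id i"
        by cases (use fix1 \<open>s (n + 1) = n + 1\<close> permutes_not_in[OF s(1)] in auto)
    qed
    then show False using s(2) by blast
  qed
  then have "(\<Sum>s | s permutes {1..n + 1}. f s) = (\<Sum>s\<in>{id}. f s)"
    using permutes_id by (intro sum.mono_neutral_right) (auto intro: finite_permutations)
  then show ?thesis by simp
qed

lemma circle_map_diagonal_side:
  defines "X n a b \<equiv> two_sided n (n + 1) a b"
  shows "circle_map n (X n a delta) =
      Complex (2 * (\<Prod>i\<in>{1..n}. a i i) - 1) ((\<Prod>i\<in>{1..n}. a i i) * (\<Sum>i\<in>{1..n}. a i (n + 1)))"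
    and "circle_map n (X n delta b) =
      Complex (2 * (\<Prod>i\<in>{1..n}. b i i) - 1) (- ((\<Prod>i\<in>{1..n}. b i i) * (\<Sum>i\<in>{1..n}. b i (n + 1))))"
proof -
  let ?i0 = "\<lambda>s. \<exists>i\<in>{1..n}. s i \<noteq> i"
  have z: "perm_weight n (X n a delta) s = 0 \<and> perm_weight n (X n delta b) s = 0"
    if "s permutes {1..n + 1}" "?i0 s" for s
  proof -
    note i0 = that(2)
    obtain i where i: "i \<in> {1..n}" "s i \<noteq> i" using i0 by blast
    show ?thesis unfolding X_def perm_weight_two_sided[OF that(1)] using i
      by (intro conjI prod_zero bexI[of _ i]) auto
  qed
  have S: "(\<Sum>s | s permutes {1..n + 1}. f s) = f id"
    if "\<And>s. s permutes {1..n + 1} \<Longrightarrow> ?i0 s \<Longrightarrow> f s = 0" for f :: "(nat \<Rightarrow> nat) \<Rightarrow> real"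
    by (rule sum_permutations_diagonal[of n ?i0]) (use that in auto)
  have w: "perm_weight n (X n a delta) id = (\<Prod>i\<in>{1..n}. a i i)"
    "perm_weight n (X n delta b) id = (\<Prod>i\<in>{1..n}. b i i)"
    unfolding X_def perm_weight_two_sided[OF permutes_id] by simp_all
  have "side_excess n (X n a delta) (n + 1) = (\<Sum>i\<in>{1..n}. a i (n + 1))"
    unfolding side_excess_def X_def by (intro sum.cong) (auto simp: two_sided_def delta_def)
  then show "circle_map n (X n a delta) =
      Complex (2 * (\<Prod>i\<in>{1..n}. a i i) - 1) ((\<Prod>i\<in>{1..n}. a i i) * (\<Sum>i\<in>{1..n}. a i (n + 1)))"
    unfolding circle_map_def using z by (subst (1 2) S) (simp_all add: w)
  have "side_excess n (X n delta b) (n + 1) = - (\<Sum>i\<in>{1..n}. b i (n + 1))"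
    unfolding side_excess_def X_def sum_negf[symmetric] by (intro sum.cong) (auto simp: two_sided_def delta_def)
  then show "circle_map n (X n delta b) =
      Complex (2 * (\<Prod>i\<in>{1..n}. b i i) - 1) (- ((\<Prod>i\<in>{1..n}. b i i) * (\<Sum>i\<in>{1..n}. b i (n + 1))))"
    unfolding circle_map_def using z by (subst (1 2) S) (simp_all add: w)
qed

text \<open>Composed with \<open>F\<close>, a null-homotopy of the loop becomes one in the punctured
  plane, with end points fixed.\<close>

lemma trivial_pi_1_imp_winding_number_0:
  fixes F :: "'a::topological_space \<Rightarrow> complex"
  assumes triv: "trivial_pi 1 (top_of_set S)"
    and g: "path g" "path_image g \<subseteq> S" "pathfinish g = pathstart g"
    and F: "continuous_on S F" "\<And>x. x \<in> S \<Longrightarrow> F x \<noteq> 0"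
  shows "winding_number (F \<circ> g) 0 = 0"
proof -
  let ?C = "topspace (cube 1)"
  define x where "x = pathstart g"
  have xS: "x \<in> S" using g(2) pathstart_in_path_image unfolding x_def by blast
  have C: "?C = {t. 0 \<le> t 0 \<and> t 0 \<le> 1 \<and> (\<forall>i\<ge>1. t i = 0)}" by (auto simp: topspace_cube)
  have fc: "continuous_on ?C (\<lambda>t. g (t 0))"
    using g(1) unfolding path_def
    by (rule continuous_on_compose2[OF _ continuous_on_coordinate]) (unfold C, auto)
  have fS: "g (t 0) \<in> S" if "t \<in> ?C" for t using that g(2) unfolding C path_image_def by auto
  have fm: "continuous_map (cube 1) (top_of_set S) (\<lambda>t. g (t 0))"
    using fc fS by (subst cube_top_of_set) auto
  have fb: "\<forall>t\<in>cube_boundary 1. g (t 0) = x"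
    using g(3) by (auto simp: cube_boundary_def x_def pathstart_def pathfinish_def)
  have "homotopic_with (\<lambda>h. \<forall>t\<in>cube_boundary 1. h t = x) (cube 1) (top_of_set S) (\<lambda>t. g (t 0)) (\<lambda>_. x)"
    using triv[unfolded trivial_pi_iff[OF zero_less_one]] xS fm fb by simp
  then obtain H where H: "continuous_map (top_of_set ({0..1::real} \<times> ?C)) (top_of_set S) H"
    and H0: "\<forall>t. H (0, t) = g (t 0)" and H1: "\<forall>t. H (1, t) = x"
    and Hb: "\<forall>s\<in>{0..1}. \<forall>t\<in>cube_boundary 1. H (s, t) = x"
    unfolding homotopic_with_def prod_interval_cube by blast
  have eC: "(\<lambda>i::nat. if i = 0 then u else 0) \<in> ?C" if "u \<in> {0..1}" for u :: real using that unfolding C by auto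
  have eb: "(\<lambda>i::nat. if i = 0 then u else 0) \<in> cube_boundary 1" if "u = 0 \<or> u = 1" for u :: real
    using that eC[of u] unfolding cube_boundary_def by auto
  have Hc: "continuous_on ({0..1} \<times> ?C) H" and HS: "\<And>z. z \<in> {0..1} \<times> ?C \<Longrightarrow> H z \<in> S"
    using H by auto
  \<comment> \<open>Identifies the unit interval with \<open>cube 1\<close>, whose points are
    sequences supported at index 0.\<close>
  let ?G = "\<lambda>z. (fst z, \<lambda>i::nat. if i = 0 then snd z else (0::real)) :: real \<times> (nat \<Rightarrow> real)"
  have Gc: "continuous_on ({0..1} \<times> {0..1}) ?G"
  proof (intro continuous_on_Pair continuous_on_coordinatewise_then_product continuous_on_fst continuous_on_id)
    show "continuous_on ({0..1} \<times> {0..1}) (\<lambda>z::real \<times> real. if i = 0 then snd z else 0)" for i :: nat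
      by (cases "i = 0") (auto intro: continuous_intros)
  qed
  have GC: "?G ` ({0..1} \<times> {0..1}) \<subseteq> {0..1} \<times> ?C" using eC by auto
  have hc: "continuous_on ({0..1} \<times> {0..1}) (\<lambda>z. F (H (?G z)))"
    using continuous_on_compose2[OF F(1) continuous_on_compose2[OF Hc Gc GC]] HS GC by (simp add: image_subset_iff)
  have hnz: "F (H (?G z)) \<noteq> 0" if "z \<in> {0..1} \<times> {0..1}" for z
    using F(2) HS GC that by (metis (no_types, lifting) image_subset_iff)
  have "homotopic_paths (- {0}) (F \<circ> g) (linepath (F x) (F x))"
    unfolding homotopic_paths
  proof (intro exI[of _ "\<lambda>z. F (H (?G z))"] conjI ballI)
    fix t :: real assume t: "t \<in> {0..1}"
    show "F (H (?G (0, t))) = (F \<circ> g) t" using H0 by simp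
    show "F (H (?G (1, t))) = linepath (F x) (F x) t" using H1 by (simp add: linepath_def algebra_simps)
    have Hx: "H (?G (t, u)) = x" if "u = 0 \<or> u = 1" for u
      unfolding fst_conv snd_conv using Hb t eb[OF that] by blast
    show "pathstart ((\<lambda>z. F (H (?G z))) \<circ> Pair t) = pathstart (F \<circ> g)"
      "pathfinish ((\<lambda>z. F (H (?G z))) \<circ> Pair t) = pathfinish (F \<circ> g)"
      unfolding pathstart_compose pathfinish_compose g(3) x_def[symmetric]
      unfolding pathstart_def pathfinish_def o_apply Hx[OF disjI1[OF refl]] Hx[OF disjI2[OF refl]] by (rule refl)+
  qed (use hc hnz in auto)
  then have "winding_number (F \<circ> g) 0 = winding_number (linepath (F x) (F x)) 0"
    by (rule winding_number_homotopic_paths)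
  then show ?thesis using F(2)[OF xS] by simp
qed

text \<open>The loop starts at the passage of the identity, leaves by moving the first side to the
  leftover colour \<open>n + 1\<close> and returns with the second side on that colour.\<close>

lemma not_trivial_pi_1_succ:
  assumes n: "2 \<le> n"
  shows "\<not> trivial_pi 1 (top_of_set (K2K_space n (n + 1)))"
proof
  let ?m = "n + 1"
  let ?X = "K2K_space n ?m" and ?F = "circle_map n"
  let ?c = "\<lambda>d. \<lambda>_::nat. delta d"
  assume triv: "trivial_pi 1 (top_of_set ?X)"
  have v: "two_sided n ?m delta delta \<in> ?X" "two_sided n ?m (?c ?m) delta \<in> ?X" "two_sided n ?m delta (?c ?m) \<in> ?X"
    using delta_in_space[of n "\<lambda>i. i" ?m "\<lambda>i. i"] delta_in_space[of n "\<lambda>i. ?m" ?m "\<lambda>i. i"]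
      delta_in_space[of n "\<lambda>i. i" ?m "\<lambda>i. ?m"] by auto
  have vc: "two_sided n ?m (?c p) (?c q) \<in> ?X" if "p \<in> {1..?m}" "q \<in> {1..?m}" "p \<noteq> q" for p q
    using delta_in_space[of n "\<lambda>_. p" ?m "\<lambda>_. q"] that by simp
  have vm1: "two_sided n ?m (?c ?m) (?c 1) \<in> ?X" and v21: "two_sided n ?m (?c 2) (?c 1) \<in> ?X"
    and v2m: "two_sided n ?m (?c 2) (?c ?m) \<in> ?X"
    by (rule vc; use n in simp)+
  define g1 where "g1 = (\<lambda>t. two_sided n ?m (ridge t delta (?c ?m)) delta)"
  \<comment> \<open>To hand the colour \<open>n + 1\<close> from the first side to the second, the
    sides are parked in turn on the colours 1 and 2, which differ from \<open>n + 1\<close> as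
    \<open>2 \<le> n\<close>.\<close>
  define g2 where "g2 = (\<lambda>t. two_sided n ?m (?c ?m) (ridge t delta (?c 1)))"
  define g3 where "g3 = (\<lambda>t. two_sided n ?m (ridge t (?c ?m) (?c 2)) (?c 1))"
  define g4 where "g4 = (\<lambda>t. two_sided n ?m (?c 2) (ridge t (?c 1) (?c ?m)))"
  define g5 where "g5 = (\<lambda>t. two_sided n ?m (ridge t (?c 2) delta) (?c ?m))"
  define g6 where "g6 = (\<lambda>t. two_sided n ?m delta (ridge t (?c ?m) delta))"
  have 1: "path g1" "path_image g1 \<subseteq> ?X" "pathstart g1 = two_sided n ?m delta delta" "pathfinish g1 = two_sided n ?m (?c ?m) delta"
    unfolding g1_def by (rule slide_first[OF v(1,2)]; simp)+
  have 2: "path g2" "path_image g2 \<subseteq> ?X" "pathstart g2 = two_sided n ?m (?c ?m) delta" "pathfinish g2 = two_sided n ?m (?c ?m) (?c 1)"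
    unfolding g2_def by (rule slide_second[OF v(2) vm1]; simp)+
  have 3: "path g3" "path_image g3 \<subseteq> ?X" "pathstart g3 = two_sided n ?m (?c ?m) (?c 1)" "pathfinish g3 = two_sided n ?m (?c 2) (?c 1)"
    unfolding g3_def by (rule slide_first[OF vm1 v21]; simp)+
  have 4: "path g4" "path_image g4 \<subseteq> ?X" "pathstart g4 = two_sided n ?m (?c 2) (?c 1)" "pathfinish g4 = two_sided n ?m (?c 2) (?c ?m)"
    unfolding g4_def by (rule slide_second[OF v21 v2m]; simp)+
  have 5: "path g5" "path_image g5 \<subseteq> ?X" "pathstart g5 = two_sided n ?m (?c 2) (?c ?m)" "pathfinish g5 = two_sided n ?m delta (?c ?m)"
    unfolding g5_def by (rule slide_first[OF v2m v(3)]; simp)+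
  have 6: "path g6" "path_image g6 \<subseteq> ?X" "pathstart g6 = two_sided n ?m delta (?c ?m)" "pathfinish g6 = two_sided n ?m delta delta"
    unfolding g6_def by (rule slide_second[OF v(3,1)]; simp)+
  \<comment> \<open>All along \<open>h\<close> at least one side has a single constant colour, so
    \<open>circle_map\<close> is constantly -1 there.\<close>
  define h where "h = g2 +++ (g3 +++ (g4 +++ g5))"
  have h: "path h" "path_image h \<subseteq> ?X" "pathstart h = two_sided n ?m (?c ?m) delta" "pathfinish h = two_sided n ?m delta (?c ?m)"
    unfolding h_def using 2 3 4 5 by (simp_all add: path_image_join)
  have "?F z = -1" if "z \<in> path_image g2 \<union> path_image g3 \<union> path_image g4 \<union> path_image g5" for z
  proof -
    have "?F (g2 t) = -1" for t unfolding g2_def by (rule circle_map_constant_side[OF n, where c = ?m]) simp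
    moreover have "?F (g3 t) = -1" for t unfolding g3_def by (rule circle_map_constant_side[OF n, where c = 1]) simp
    moreover have "?F (g4 t) = -1" for t unfolding g4_def by (rule circle_map_constant_side[OF n, where c = 2]) simp
    moreover have "?F (g5 t) = -1" for t unfolding g5_def by (rule circle_map_constant_side[OF n, where c = ?m]) simp
    ultimately show ?thesis using that by (auto simp: path_image_def)
  qed
  moreover have "path_image h \<subseteq> path_image g2 \<union> path_image g3 \<union> path_image g4 \<union> path_image g5"
    unfolding h_def using 2 3 4 5 by (auto simp: path_image_join)
  moreover have "h t \<in> path_image h" if "t \<in> {0..1}" for t using that by (simp add: path_image_def)
  ultimately have Fh: "?F (h t) = -1" if "t \<in> {0..1}" for t using that by blast
  have Fx: "?F (two_sided n ?m delta delta) = 1"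
    using circle_map_diagonal_side(1)[of n delta] by (simp add: complex_eq_iff delta_def)
  have Fm: "?F (two_sided n ?m (?c ?m) delta) = -1" "?F (two_sided n ?m delta (?c ?m)) = -1"
    by (rule circle_map_constant_side[OF n, where c = ?m]; simp)+
  have ridge_nn: "0 \<le> ridge t p q i c" if "t \<in> {0..1}" "\<And>i c. 0 \<le> p i c" "\<And>i c. 0 \<le> q i c" for t p q i c
    using that by (simp add: ridge_def le_max_iff_disj)
  have Fc: "continuous_on A ?F" for A by (rule continuous_on_circle_map)
  have Fnz: "?F z \<noteq> 0" if "z \<in> ?X" for z using circle_map_nonzero[OF _ that] n by simp
  have w: "winding_number ((?F \<circ> g1) +++ ((?F \<circ> h) +++ (?F \<circ> g6))) 0 \<noteq> 0"
  proof (rule winding_number_three_arcs)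
    show "path (?F \<circ> g1)" "path (?F \<circ> h)" "path (?F \<circ> g6)"
      by (intro path_continuous_image Fc 1(1) h(1) 6(1))+
    show "pathstart (?F \<circ> g1) = 1" "pathfinish (?F \<circ> g1) = -1" "pathstart (?F \<circ> g6) = -1" "pathfinish (?F \<circ> g6) = 1"
      using 1 6 Fx Fm by (simp_all add: pathstart_compose pathfinish_compose)
    show "(?F \<circ> h) t = -1" if "t \<in> {0..1}" for t using Fh[OF that] by simp
    show "0 \<notin> path_image (?F \<circ> g1)" "0 \<notin> path_image (?F \<circ> g6)"
    proof -
      have "0 \<notin> ?F ` A" if "A \<subseteq> ?X" for A using Fnz that by force
      then show "0 \<notin> path_image (?F \<circ> g1)" "0 \<notin> path_image (?F \<circ> g6)"
        unfolding path_image_compose using 1(2) 6(2) by simp_all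
    qed
    fix t :: real assume t: "t \<in> {0..1}"
    show "0 \<le> Im ((?F \<circ> g1) t)"
      unfolding o_apply g1_def circle_map_diagonal_side using ridge_nn[OF t]
      by (auto intro!: mult_nonneg_nonneg prod_nonneg sum_nonneg)
    show "Im ((?F \<circ> g6) t) \<le> 0"
      unfolding o_apply g6_def circle_map_diagonal_side using ridge_nn[OF t]
      by (auto intro!: mult_nonneg_nonneg prod_nonneg sum_nonneg)
  qed
  have "winding_number (?F \<circ> (g1 +++ (h +++ g6))) 0 = 0"
  proof (rule trivial_pi_1_imp_winding_number_0[OF triv])
    show "path (g1 +++ (h +++ g6))" "path_image (g1 +++ (h +++ g6)) \<subseteq> ?X"
      "pathfinish (g1 +++ (h +++ g6)) = pathstart (g1 +++ (h +++ g6))"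
      using 1 h 6 by (simp_all add: path_image_join)
  qed (use Fc Fnz in auto)
  then show False using w by (simp add: path_compose_join)
qed

theorem corollary1p3:
  fixes n m :: nat
  assumes "n \<ge> 2" and "2 \<le> m" and "m \<le> n + 1"
  shows "conn (Hom_complex (cat_product (complete_graph 2) (complete_graph n)) (complete_graph m)) =
    (if m = n + 1 then Fin 0
     else if m = n then Fin (-1)
     else Fin (int m - 3))"
proof -
  let ?X = "top_of_set (K2K_space n m)"
  have e: "conn (Hom_complex (K2K n) (complete_graph m)) = conn ?X"
    by (rule conn_Hom_K2K) (use assms in simp)
  have ne: "topspace ?X \<noteq> {}"
  proof -
    have "two_sided n m (\<lambda>i. delta 1) (\<lambda>i. delta 2) \<in> K2K_space n m"
      by (rule delta_in_space) (use assms in auto)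
    then show ?thesis by auto
  qed
  consider "m = n + 1" | "m = n" | "m < n" using assms by linarith
  then show ?thesis
  proof cases
    case 1
    have "conn ?X = Fin 0"
    proof (rule conn_eq_FinI[OF ne])
      show "trivial_pi j ?X" if "int j \<le> 0" for j
        using that path_connected_succ[OF assms(1)] 1 by (simp add: trivial_pi_def flip: path_connectedin_euclidean)
      show "\<not> trivial_pi 1 ?X" using not_trivial_pi_1_succ[OF assms(1)] 1 by simp
    qed simp
    with 1 e show ?thesis by simp
  next
    case 2
    have "conn ?X = Fin (-1)"
      by (rule conn_eq_FinI[OF ne, of "-1" 0]) (use not_trivial_pi_0_equal[OF assms(1)] 2 in auto)
    with 2 e show ?thesis by simp
  next
    case 3
    then interpret few_colours n m by unfold_locales (use assms in auto)
    have "conn ?X = Fin (int (m - 2) - 1)"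
      using conn_homotopy_equivalent[OF space_homotopy_equivalent_nsphere] conn_nsphere by simp
    also have "int (m - 2) - 1 = int m - 3" using assms by simp
    finally show ?thesis using 3 e by simp
  qed
qed

end
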